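(* Let $M$ denote either the sphere $\mathbb{S}^2$ or the torus $\mathbb{T}^2$. There is a constant $\mathrm{k}\le \frac{3\pi}{32}$ such that for every $N\ge 1$ and every family $\{\psi_j\}_{j=1}^N\subset \dot H^1(M)$ that is orthonormal in $L_2(M)$, the function $$\rho(x):=\sum_{j=1}^N|\psi_j(x)|^2$$ satisfies $$\int_{M}\rho(x)^2\,dM\le \mathrm{k}\sum_{j=1}^N\|\nabla\psi_j\|^2 .$$
   Context: $\mathbb{S}^2$ is the unit sphere in $\mathbb{R}^3$ with its standard round metric and surface measure (total area $4\pi$). $\mathbb{T}^2$ is the flat two-dimensional torus with equal periods, i.e. $\mathbb{R}^2/(L\mathbb{Z})^2$ for some $L>0$, with Lebesgue measure. Functions are scalar and real-valued. $\dot H^1(M)$ is the Sobolev space of functions $\psi\in H^1(M)$ with mean value zero, $\int_M\psi\,dM=0$. $\|\cdot\|$ is the $L_2(M)$ norm, $\nabla$ is the (Riemannian) gradient, $\|\nabla\psi\|^2=\int_M|\nabla\psi|^2dM$, and $dM$ denotes the Riemannian measure on $M$. *)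

theory Defs
  imports "HOL-Analysis.Analysis"
begin

text \<open>\<open>C\<^sup>k\<close> and \<open>C\<^sup>\<infinity>\<close> functions on an open set \<open>U\<close>; the components of \<open>G\<close> are the
  first partial derivatives of \<open>f\<close>.\<close>

primrec Ck_on :: "nat \<Rightarrow> 'a::euclidean_space set \<Rightarrow> ('a \<Rightarrow> real) \<Rightarrow> bool" where
  "Ck_on 0 U f \<longleftrightarrow> continuous_on U f"
| "Ck_on (Suc k) U f \<longleftrightarrow>
     (\<exists>G. (\<forall>x\<in>U. GDERIV f x :> G x) \<and> (\<forall>b\<in>Basis. Ck_on k U (\<lambda>x. G x \<bullet> b)))"

definition smooth_on :: "'a::euclidean_space set \<Rightarrow> ('a \<Rightarrow> real) \<Rightarrow> bool" where
  "smooth_on U f \<longleftrightarrow> (\<forall>k. Ck_on k U f)"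

definition L2 :: "'a measure \<Rightarrow> ('a \<Rightarrow> 'b::euclidean_space) set" where
  "L2 M = {f \<in> borel_measurable M. integrable M (\<lambda>x. (norm (f x))\<^sup>2)}"

definition L2_norm :: "'a measure \<Rightarrow> ('a \<Rightarrow> 'b::euclidean_space) \<Rightarrow> real" where
  "L2_norm M f = sqrt (\<integral>x. (norm (f x))\<^sup>2 \<partial>M)"

definition L2_orthonormal :: "'a measure \<Rightarrow> 'i set \<Rightarrow> ('i \<Rightarrow> 'a \<Rightarrow> real) \<Rightarrow> bool" where
  "L2_orthonormal M I \<psi> \<longleftrightarrow>
     (\<forall>i\<in>I. \<psi> i \<in> L2 M) \<and>
     (\<forall>i\<in>I. \<forall>j\<in>I. (\<integral>x. \<psi> i x * \<psi> j x \<partial>M) = (if i = j then 1 else 0))"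

text \<open>The data of a compact surface used to build \<open>H\<^sup>1\<close>: its Riemannian measure, whose \<open>space\<close>
  is the surface as a point set, and the relation ``\<open>f\<close> is a smooth function on the surface and
  \<open>G\<close> is its Riemannian gradient''.  Tangent vectors are vectors of the ambient space \<open>'a\<close>.\<close>

record 'a surface =
  vol :: "'a measure"
  smooth_grad :: "('a \<Rightarrow> real) \<Rightarrow> ('a \<Rightarrow> 'a) \<Rightarrow> bool"

text \<open>\<open>H\<^sup>1(M)\<close> is the completion of the smooth functions in the norm
  \<open>(\<parallel>\<psi>\<parallel>\<^sup>2 + \<parallel>\<nabla>\<psi>\<parallel>\<^sup>2)\<^sup>1\<^sup>/\<^sup>2\<close>, realised inside \<open>L\<^sub>2(M)\<close>: \<open>\<psi>\<close> belongs to it, with gradient \<open>g\<close>, if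
  \<open>(\<psi>, g)\<close> is an \<open>L\<^sub>2\<close> limit of pairs \<open>(\<phi>\<^sub>n, \<nabla>\<phi>\<^sub>n)\<close> with \<open>\<phi>\<^sub>n\<close> smooth.  On the surfaces below,
  \<open>\<phi>\<^sub>n\<close> and \<open>\<nabla>\<phi>\<^sub>n\<close> are bounded and Borel, so all the integrals involved are finite.\<close>

definition has_H1_gradient ::
  "'a::euclidean_space surface \<Rightarrow> ('a \<Rightarrow> real) \<Rightarrow> ('a \<Rightarrow> 'a) \<Rightarrow> bool" where
  "has_H1_gradient M \<psi> g \<longleftrightarrow>
     \<psi> \<in> L2 (vol M) \<and> g \<in> L2 (vol M) \<and>
     (\<exists>\<phi> G. (\<forall>n::nat. smooth_grad M (\<phi> n) (G n)) \<and>
        (\<lambda>n. L2_norm (vol M) (\<lambda>x. \<phi> n x - \<psi> x)) \<longlonglongrightarrow> 0 \<and>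
        (\<lambda>n. L2_norm (vol M) (\<lambda>x. G n x - g x)) \<longlonglongrightarrow> 0)"

definition H1 :: "'a::euclidean_space surface \<Rightarrow> ('a \<Rightarrow> real) set" where
  "H1 M = {\<psi>. \<exists>g. has_H1_gradient M \<psi> g}"

text \<open>The gradient is determined almost everywhere, so the choice of \<open>g\<close> is immaterial
  in integrals.\<close>

definition H1_grad :: "'a::euclidean_space surface \<Rightarrow> ('a \<Rightarrow> real) \<Rightarrow> 'a \<Rightarrow> 'a" where
  "H1_grad M \<psi> = (SOME g. has_H1_gradient M \<psi> g)"

definition H1_dot :: "'a::euclidean_space surface \<Rightarrow> ('a \<Rightarrow> real) set" where
  "H1_dot M = {\<psi> \<in> H1 M. (\<integral>x. \<psi> x \<partial>vol M) = 0}"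

text \<open>The Riemannian measure of the round sphere in spherical coordinates
  (\<open>\<theta>\<close> the polar angle, \<open>\<phi>\<close> the azimuth), where \<open>\<surd>(det g) = sin \<theta>\<close>.\<close>

definition spherical_coords :: "real \<times> real \<Rightarrow> real^3" where
  "spherical_coords = (\<lambda>(\<theta>, \<phi>). vector [sin \<theta> * cos \<phi>, sin \<theta> * sin \<phi>, cos \<theta>])"

definition sphere_measure :: "(real^3) measure" where
  "sphere_measure =
     distr (density (restrict_space lborel ({0..pi} \<times> {0..2*pi})) (\<lambda>(\<theta>, \<phi>). ennreal (sin \<theta>)))
       (restrict_space borel (sphere 0 1)) spherical_coords"

text \<open>A function on \<open>S\<^sup>2\<close> is smooth if it is the restriction of a smooth function on a
  neighbourhood.  Its gradient at \<open>x\<close> is the vector tangent at \<open>x\<close> which represents the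
  derivative of the function along the sphere.\<close>

definition S2 :: "(real^3) surface" where
  "S2 = \<lparr> vol = sphere_measure,
     smooth_grad = (\<lambda>f G. (\<exists>U. open U \<and> sphere 0 1 \<subseteq> U \<and> smooth_on U f) \<and>
       (\<forall>x\<in>sphere 0 1. G x \<bullet> x = 0 \<and>
          (f has_derivative (\<lambda>h. G x \<bullet> h)) (at x within sphere 0 1))) \<rparr>"

text \<open>The points of \<open>T\<^sup>2 = \<real>\<^sup>2/(L\<int>)\<^sup>2\<close> are represented in the fundamental domain \<open>[0,L)\<^sup>2\<close>; smooth
  functions on \<open>T\<^sup>2\<close> are smooth functions on \<open>\<real>\<^sup>2\<close> with period \<open>L\<close> in each coordinate.\<close>

definition T2 :: "real \<Rightarrow> (real^2) surface" where
  "T2 L = \<lparr> vol = restrict_space lborel {x. \<forall>i. 0 \<le> x $ i \<and> x $ i < L},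
     smooth_grad = (\<lambda>f G. (\<forall>x i. f (x + axis i L) = f x) \<and> smooth_on UNIV f \<and>
       (\<forall>x. GDERIV f x :> G x)) \<rparr>"

end

theory Submission
  imports Defs "HOL-Computational_Algebra.Polynomial"
begin

text \<open>
  Let \<open>\<psi>\<^sub>1, \<dots>, \<psi>\<^sub>N\<close> be orthonormal of mean zero, and let \<open>u\<^sub>j(s) = e\<^sup>s\<^sup>\<Delta> \<psi>\<^sub>j\<close> be their heat flows.
  Fix a point \<open>x\<close> and a time \<open>t > 0\<close>, and split \<open>\<psi>\<^sub>j = m(-\<Delta>) \<psi>\<^sub>j + (1 - m)(-\<Delta>) \<psi>\<^sub>j\<close> with the cutoff
  \<open>m(\<lambda>) = (e\<^sup>-\<^sup>t\<^sup>\<lambda> + e\<^sup>-\<^sup>3\<^sup>t\<^sup>\<lambda>) / 2\<close>.  The two parts are controlled by the two hypotheses.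

  \<^item> \<^emph>\<open>Low energies use orthonormality.\<close>  The numbers \<open>m(-\<Delta>) \<psi>\<^sub>j(x)\<close> are the coefficients of
    one function, the kernel of \<open>m(-\<Delta>)\<close> at \<open>x\<close>; by Bessel's inequality the sum of their squares
    is at most the diagonal value at \<open>x\<close> of the kernel of \<open>m(-\<Delta>)\<^sup>2\<close>, a combination of heat
    kernels.  If the heat kernel without its constant mode is at most \<open>B / (4\<pi>\<tau>)\<close> on the diagonal
    at every time \<open>\<tau>\<close>, this gives \<open>7B / (96\<pi>t)\<close> (\<open>low_energy_part\<close>).

  \<^item> \<^emph>\<open>High energies use the gradients.\<close>  The rest is \<open>(u\<^sub>j(0) - u\<^sub>j(t)) + (u\<^sub>j(t) - u\<^sub>j(3t)) / 2\<close>,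
    a weighted time integral of \<open>-\<partial>\<^sub>s u\<^sub>j\<close>.  By the Cauchy--Schwarz inequality in \<open>s\<close> the sum of
    its squares at \<open>x\<close> is at most \<open>3/2 \<cdot> t \<cdot> K(x)\<close>, where
    \<open>K(x) = \<Sum>\<^sub>j \<integral> |\<partial>\<^sub>s u\<^sub>j(s, x)|\<^sup>2 ds\<close> over all \<open>s > 0\<close> (\<open>high_energy_part\<close>).

  Choosing \<open>t\<close> separately at each \<open>x\<close> yields \<open>\<rho>(x)\<^sup>2 \<le> 7B/(4\<pi>) \<cdot> K(x)\<close> (\<open>energy_density_bound\<close>), and
  \<open>\<integral> K = 1/2 \<cdot> \<Sum>\<^sub>j \<parallel>\<nabla>\<psi>\<^sub>j\<parallel>\<^sup>2\<close> because a mode of eigenvalue \<open>\<lambda>\<close> contributes \<open>\<integral> (\<lambda> e\<^sup>-\<^sup>\<lambda>\<^sup>s)\<^sup>2 ds = \<lambda> / 2\<close>.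
  So \<open>k = 7B / (8\<pi>)\<close> works, and \<open>B = 21/20\<close> is small enough for \<open>k \<le> 3\<pi>/32\<close>.  The pure heat cutoff
  \<open>e\<^sup>-\<^sup>t\<^sup>\<lambda>\<close> would give \<open>B/\<pi>\<close>, which misses \<open>3\<pi>/32\<close> even for \<open>B = 1\<close>; averaging two times suffices.
  To keep all sums finite, the argument is applied to spectral truncations of the \<open>\<psi>\<^sub>j\<close>; they converge
  in \<open>L\<^sub>2\<close>, and Fatou's lemma passes to the limit (\<open>lieb_thirring\<close>).

  All of this takes place in the locale \<open>spectral_surface\<close>, which asks for the kernels of the spectral
  projections, Green's formula against them, density of their span, and the bound
  on the heat kernel.  It remains to provide these data.

  \<^item> \<^emph>\<open>Sphere\<close> (\<open>sphere_spectral_surface\<close>).  The kernels are \<open>(2n + 1)/(4\<pi>) \<cdot> P\<^sub>n(x \<bullet> y)\<close> with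
    eigenvalue \<open>n(n + 1)\<close>.  Everything is derived from the divergence theorem in spherical coordinates:
    Green's formula becomes Legendre's differential equation, and the reproducing property follows
    from the Funk--Hecke formula.  The heat kernel bound holds with \<open>B = 1\<close>, because
    \<open>\<Sum> (2n + 1) e\<^sup>-\<^sup>\<tau>\<^sup>n\<^sup>(\<^sup>n\<^sup>+\<^sup>1\<^sup>)\<close> is a midpoint sum of a convex function.

  \<^item> \<^emph>\<open>Torus\<close> (\<open>torus_spectral_surface\<close>).  A real orthonormal basis indexed by the whole frequency
    lattice is given by \<open>cos + sin\<close> of each wave.  The heat kernel bound is a bound for
    \<open>\<Sum> e\<^sup>-\<^sup>c\<^sup>|\<^sup>k\<^sup>|\<^sup>2\<close> over nonzero lattice points \<open>k\<close> (\<open>lattice_gauss_sum_le\<close>): positivity of the square of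
    \<open>\<Sum> (-1)\<^sup>n e\<^sup>-\<^sup>c\<^sup>n\<^sup>2\<close> shows that small \<open>c\<close> may be doubled, which leaves \<open>c \<ge> 1\<close>.
\<close>


section \<open>Square integrable functions\<close>

lemma L2_borel: "f \<in> L2 M \<Longrightarrow> f \<in> borel_measurable M"
  by (simp add: L2_def)

lemma L2_inner_integrable:
  fixes f g :: "'a \<Rightarrow> 'b::euclidean_space"
  assumes f: "f \<in> L2 M" and g: "g \<in> L2 M"
  shows "integrable M (\<lambda>x. f x \<bullet> g x)"
proof (rule Bochner_Integration.integrable_bound)
  show "integrable M (\<lambda>x. (norm (f x))\<^sup>2 + (norm (g x))\<^sup>2)"
    using f g by (auto simp: L2_def)
  show "(\<lambda>x. f x \<bullet> g x) \<in> borel_measurable M"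
    using f g by (auto simp: L2_def)
  have "\<bar>f x \<bullet> g x\<bar> \<le> (norm (f x))\<^sup>2 + (norm (g x))\<^sup>2" for x
  proof -
    have "\<bar>f x \<bullet> g x\<bar> \<le> norm (f x) * norm (g x)" by (rule Cauchy_Schwarz_ineq2)
    also have "\<dots> \<le> (norm (f x))\<^sup>2 + (norm (g x))\<^sup>2"
      using sum_squares_bound[of "norm (f x)" "norm (g x)"]
        mult_nonneg_nonneg[OF norm_ge_zero norm_ge_zero, of "f x" "g x"] by linarith
    finally show ?thesis .
  qed
  then show "AE x in M. norm (f x \<bullet> g x) \<le> norm ((norm (f x))\<^sup>2 + (norm (g x))\<^sup>2)"
    by auto
qed

lemma L2_mult_integrable:
  fixes f g :: "'a \<Rightarrow> real"
  shows "f \<in> L2 M \<Longrightarrow> g \<in> L2 M \<Longrightarrow> integrable M (\<lambda>x. f x * g x)"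
  using L2_inner_integrable[of f M g] by simp

lemma L2_scaleR:
  assumes "f \<in> L2 M"
  shows "(\<lambda>x. c *\<^sub>R f x) \<in> L2 M"
  using assms by (auto simp: L2_def power_mult_distrib)

lemma L2_mult_left:
  fixes f :: "'a \<Rightarrow> real"
  shows "f \<in> L2 M \<Longrightarrow> (\<lambda>x. c * f x) \<in> L2 M"
  using L2_scaleR[of f M c] by simp

lemma L2_add:
  fixes f g :: "'a \<Rightarrow> 'b::euclidean_space"
  assumes f: "f \<in> L2 M" and g: "g \<in> L2 M"
  shows "(\<lambda>x. f x + g x) \<in> L2 M"
proof -
  have "(norm (f x + g x))\<^sup>2 = (norm (f x))\<^sup>2 + 2 * (f x \<bullet> g x) + (norm (g x))\<^sup>2" for x
    by (simp add: power2_norm_eq_inner algebra_simps inner_commute)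
  then show ?thesis
    using f g L2_inner_integrable[OF f g] by (auto simp: L2_def)
qed

lemma L2_diff:
  fixes f g :: "'a \<Rightarrow> 'b::euclidean_space"
  assumes "f \<in> L2 M" "g \<in> L2 M"
  shows "(\<lambda>x. f x - g x) \<in> L2 M"
  using L2_add[OF assms(1) L2_scaleR[OF assms(2), of "-1"]] by simp

lemma L2_zero: "(\<lambda>x. 0) \<in> L2 M"
  by (simp add: L2_def)

lemma L2_sum:
  fixes f :: "'i \<Rightarrow> 'a \<Rightarrow> 'b::euclidean_space"
  assumes "\<And>i. i \<in> I \<Longrightarrow> f i \<in> L2 M"
  shows "(\<lambda>x. \<Sum>i\<in>I. f i x) \<in> L2 M"
  using assms by (induction I rule: infinite_finite_induct) (auto intro: L2_add L2_zero)

lemma L2_norm_square: "(L2_norm M f)\<^sup>2 = (\<integral>x. (norm (f x))\<^sup>2 \<partial>M)"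
  by (simp add: L2_norm_def)

lemma L2_norm_nonneg: "0 \<le> L2_norm M f"
  by (simp add: L2_norm_def)

lemma L2_Cauchy_Schwarz:
  fixes f g :: "'a \<Rightarrow> 'b::euclidean_space"
  assumes f: "f \<in> L2 M" and g: "g \<in> L2 M"
  shows "\<bar>\<integral>x. f x \<bullet> g x \<partial>M\<bar> \<le> L2_norm M f * L2_norm M g"
proof -
  let ?A = "\<integral>x. (norm (f x))\<^sup>2 \<partial>M" and ?B = "\<integral>x. (norm (g x))\<^sup>2 \<partial>M" and ?C = "\<integral>x. f x \<bullet> g x \<partial>M"
  have int: "integrable M (\<lambda>x. (norm (f x))\<^sup>2)" "integrable M (\<lambda>x. (norm (g x))\<^sup>2)"
    "integrable M (\<lambda>x. f x \<bullet> g x)"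
    using f g L2_inner_integrable[OF f g] by (auto simp: L2_def)
  have q: "0 \<le> s\<^sup>2 * ?A - 2 * s * t * ?C + t\<^sup>2 * ?B" for s t
  proof -
    have e: "(norm (s *\<^sub>R f x - t *\<^sub>R g x))\<^sup>2
        = s\<^sup>2 * (norm (f x))\<^sup>2 - 2 * s * t * (f x \<bullet> g x) + t\<^sup>2 * (norm (g x))\<^sup>2" for x
      unfolding power2_norm_eq_inner
      by (simp add: inner_diff_left inner_diff_right inner_commute power2_eq_square)
    have "0 \<le> (\<integral>x. (norm (s *\<^sub>R f x - t *\<^sub>R g x))\<^sup>2 \<partial>M)" by simp
    also have "\<dots> = s\<^sup>2 * ?A - 2 * s * t * ?C + t\<^sup>2 * ?B"
      unfolding e using int by simp
    finally show ?thesis .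
  qed
  have nn: "0 \<le> ?A" "0 \<le> ?B" by auto
  have "?C\<^sup>2 \<le> ?A * ?B"
  proof (cases "?A = 0")
    case False
    then have "0 < ?A" using nn by linarith
    moreover have "0 \<le> ?A * (?A * ?B - ?C\<^sup>2)"
      using q[of ?C ?A] by (simp add: power2_eq_square algebra_simps)
    ultimately have "0 \<le> ?A * ?B - ?C\<^sup>2" by (simp add: zero_le_mult_iff)
    then show ?thesis by simp
  next
    case True
    then have "0 \<le> - 2 * s * ?C + ?B" for s using q[of s 1] by simp
    from this[of "(?B + 1) / (2 * ?C)"] have "?C = 0"
      by (cases "?C = 0") (auto simp: field_simps)
    then show ?thesis using True by simp
  qed
  then have "\<bar>?C\<bar> \<le> sqrt (?A * ?B)"
    by (intro real_le_rsqrt) simp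
  then show ?thesis by (simp add: L2_norm_def real_sqrt_mult)
qed

text \<open>By the Cauchy--Schwarz inequality; it carries integral identities from smooth functions to \<open>H\<^sup>1\<close>.\<close>

lemma L2_tendsto_inner:
  fixes f h :: "'a \<Rightarrow> 'b::euclidean_space"
  assumes F: "\<And>n. F n \<in> L2 M" and f: "f \<in> L2 M" and h: "h \<in> L2 M"
    and lim: "(\<lambda>n::nat. L2_norm M (\<lambda>x. F n x - f x)) \<longlonglongrightarrow> 0"
  shows "(\<lambda>n. \<integral>x. F n x \<bullet> h x \<partial>M) \<longlonglongrightarrow> (\<integral>x. f x \<bullet> h x \<partial>M)"
proof -
  have bd: "\<bar>(\<integral>x. F n x \<bullet> h x \<partial>M) - (\<integral>x. f x \<bullet> h x \<partial>M)\<bar>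
      \<le> L2_norm M (\<lambda>x. F n x - f x) * L2_norm M h" for n
  proof -
    have "(\<integral>x. F n x \<bullet> h x \<partial>M) - (\<integral>x. f x \<bullet> h x \<partial>M) = (\<integral>x. (F n x - f x) \<bullet> h x \<partial>M)"
      using L2_inner_integrable[OF F h] L2_inner_integrable[OF f h]
      by (simp add: inner_diff_left)
    then show ?thesis using L2_Cauchy_Schwarz[OF L2_diff[OF F f] h] by simp
  qed
  have "(\<lambda>n. (\<integral>x. F n x \<bullet> h x \<partial>M) - (\<integral>x. f x \<bullet> h x \<partial>M)) \<longlonglongrightarrow> 0"
  proof (rule Lim_null_comparison[OF always_eventually])
    show "(\<lambda>n. L2_norm M (\<lambda>x. F n x - f x) * L2_norm M h) \<longlonglongrightarrow> 0"
      using tendsto_mult_right[OF lim, of "L2_norm M h"] by simp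
  qed (use bd in auto)
  then show ?thesis by (simp add: LIM_zero_iff)
qed

lemma (in finite_measure) L2_bounded:
  fixes f :: "'a \<Rightarrow> 'b::euclidean_space"
  assumes f: "f \<in> borel_measurable M" and C: "\<And>x. x \<in> space M \<Longrightarrow> norm (f x) \<le> C"
  shows "f \<in> L2 M"
proof -
  have "integrable M (\<lambda>x. (norm (f x))\<^sup>2)"
  proof (rule integrable_const_bound[where B = "C\<^sup>2"])
    show "AE x in M. norm ((norm (f x))\<^sup>2) \<le> C\<^sup>2"
      using C by (auto intro!: AE_I2 power_mono)
  qed (use f in auto)
  then show ?thesis using f by (simp add: L2_def)
qed

lemma (in finite_measure) L2_integrable:
  fixes f :: "'a \<Rightarrow> 'b::euclidean_space"
  assumes f: "f \<in> L2 M"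
  shows "integrable M f"
proof (rule Bochner_Integration.integrable_bound)
  show "integrable M (\<lambda>x. 1 + (norm (f x))\<^sup>2)" using f by (simp add: L2_def)
  have "norm (f x) \<le> 1 + (norm (f x))\<^sup>2" for x
    using sum_squares_bound[of 1 "norm (f x)"] norm_ge_zero[of "f x"]
    by (simp only: power_one mult_1_right)
  then show "AE x in M. norm (f x) \<le> norm (1 + (norm (f x))\<^sup>2)" by auto
qed (use f in \<open>simp add: L2_def\<close>)

text \<open>The difference of the two sides is \<open>\<parallel>h - \<Sum>\<^sub>j \<langle>\<psi>\<^sub>j, h\<rangle> \<psi>\<^sub>j\<parallel>\<^sup>2\<close>.\<close>

lemma Bessel_inequality:
  fixes h :: "'a \<Rightarrow> real"
  assumes on: "L2_orthonormal M J \<psi>" and J: "finite J" and h: "h \<in> L2 M"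
  shows "(\<Sum>j\<in>J. (\<integral>x. \<psi> j x * h x \<partial>M)\<^sup>2) \<le> (\<integral>x. (h x)\<^sup>2 \<partial>M)"
proof -
  define c where "c j = (\<integral>x. \<psi> j x * h x \<partial>M)" for j
  define s where "s x = (\<Sum>j\<in>J. c j * \<psi> j x)" for x
  have L: "\<psi> j \<in> L2 M" if "j \<in> J" for j using on that by (auto simp: L2_orthonormal_def)
  have sL: "s \<in> L2 M" unfolding s_def by (intro L2_sum L2_mult_left L)
  have int1: "integrable M (\<lambda>x. f x * g x)" if "f \<in> L2 M" "g \<in> L2 M" for f g :: "'a \<Rightarrow> real"
    using that by (rule L2_mult_integrable)
  have sh: "(\<integral>x. s x * h x \<partial>M) = (\<Sum>j\<in>J. (c j)\<^sup>2)"
  proof -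
    have "(\<integral>x. s x * h x \<partial>M) = (\<integral>x. (\<Sum>j\<in>J. c j * (\<psi> j x * h x)) \<partial>M)"
      unfolding s_def by (simp add: sum_distrib_right mult.assoc)
    also have "\<dots> = (\<Sum>j\<in>J. c j * c j)"
      unfolding c_def by (subst Bochner_Integration.integral_sum) (auto intro!: int1 L h)
    finally show ?thesis by (simp add: power2_eq_square)
  qed
  have js: "(\<integral>x. \<psi> j x * s x \<partial>M) = c j" if j: "j \<in> J" for j
  proof -
    have "(\<integral>x. \<psi> j x * s x \<partial>M) = (\<integral>x. (\<Sum>i\<in>J. c i * (\<psi> j x * \<psi> i x)) \<partial>M)"
      unfolding s_def by (simp add: sum_distrib_left mult.left_commute)
    also have "\<dots> = (\<Sum>i\<in>J. c i * (\<integral>x. \<psi> j x * \<psi> i x \<partial>M))"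
      by (subst Bochner_Integration.integral_sum) (auto intro!: int1 L j)
    also have "\<dots> = (\<Sum>i\<in>J. c i * (if j = i then 1 else 0))"
      using on j by (intro sum.cong refl) (auto simp: L2_orthonormal_def)
    also have "\<dots> = c j" using j J by (simp add: if_distrib sum.delta cong: if_cong)
    finally show ?thesis .
  qed
  have ss: "(\<integral>x. s x * s x \<partial>M) = (\<Sum>j\<in>J. (c j)\<^sup>2)"
  proof -
    have "(\<integral>x. s x * s x \<partial>M) = (\<integral>x. (\<Sum>j\<in>J. c j * (\<psi> j x * s x)) \<partial>M)"
      unfolding s_def by (simp add: sum_distrib_right mult.assoc)
    also have "\<dots> = (\<Sum>j\<in>J. c j * (\<integral>x. \<psi> j x * s x \<partial>M))"
      by (subst Bochner_Integration.integral_sum) (auto intro!: int1 L sL)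
    finally show ?thesis using js by (simp add: power2_eq_square)
  qed
  have "0 \<le> (\<integral>x. (h x - s x)\<^sup>2 \<partial>M)" by simp
  also have "\<dots> = (\<integral>x. h x * h x - 2 * (s x * h x) + s x * s x \<partial>M)"
    by (simp add: power2_eq_square algebra_simps)
  also have "\<dots> = (\<integral>x. h x * h x \<partial>M) - (\<Sum>j\<in>J. (c j)\<^sup>2)"
    using int1[OF h h] int1[OF sL h] int1[OF sL sL] sh ss by simp
  finally show ?thesis by (simp add: c_def power2_eq_square)
qed

section \<open>The heat flow at a point\<close>

text \<open>Here \<open>a i\<close> is the value at a point of the \<open>i\<close>-th spectral component of a function \<open>\<psi>\<close>, so that the
  flow \<open>u(s)\<close> is the value of \<open>e\<^sup>s\<^sup>\<Delta> \<psi>\<close> at that point.\<close>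

definition heat_flow :: "'i set \<Rightarrow> ('i \<Rightarrow> real) \<Rightarrow> ('i \<Rightarrow> real) \<Rightarrow> real \<Rightarrow> real" where
  "heat_flow I lam a s = (\<Sum>i\<in>I. a i * exp (- s * lam i))"

text \<open>This is the integral of \<open>|u'|\<^sup>2\<close> over \<open>[s, \<infinity>)\<close>, with the integrals of the products of
  exponentials evaluated.  Working with the antiderivative avoids any integration in time.\<close>

definition heat_energy :: "'i set \<Rightarrow> ('i \<Rightarrow> real) \<Rightarrow> ('i \<Rightarrow> real) \<Rightarrow> real \<Rightarrow> real" where
  "heat_energy I lam a s =
     (\<Sum>i\<in>I. \<Sum>k\<in>I. a i * a k * (lam i * lam k / (lam i + lam k)) * exp (- s * (lam i + lam k)))"

lemma heat_flow_deriv: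
  "(heat_flow I lam a has_real_derivative - (\<Sum>i\<in>I. lam i * a i * exp (- s * lam i))) (at s)"
  unfolding heat_flow_def
  by (auto intro!: derivative_eq_intros sum.cong simp: sum_negf [symmetric])

lemma heat_energy_deriv:
  assumes "\<And>i. i \<in> I \<Longrightarrow> 0 < lam i"
  shows "(heat_energy I lam a has_real_derivative - (\<Sum>i\<in>I. lam i * a i * exp (- s * lam i))\<^sup>2) (at s)"
proof -
  have "(heat_energy I lam a has_real_derivative (\<Sum>i\<in>I. \<Sum>k\<in>I. a i * a k *
      (lam i * lam k / (lam i + lam k)) * (exp (- s * (lam i + lam k)) * - (lam i + lam k)))) (at s)"
    unfolding heat_energy_def
    by (intro DERIV_sum DERIV_cmult) (auto intro!: derivative_eq_intros)
  also have "(\<Sum>i\<in>I. \<Sum>k\<in>I. a i * a k *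
      (lam i * lam k / (lam i + lam k)) * (exp (- s * (lam i + lam k)) * - (lam i + lam k)))
    = (\<Sum>i\<in>I. \<Sum>k\<in>I. - ((lam i * a i * exp (- s * lam i)) * (lam k * a k * exp (- s * lam k))))"
  proof (intro sum.cong refl)
    fix i k assume "i \<in> I" "k \<in> I"
    then have "lam i + lam k \<noteq> 0" using assms[of i] assms[of k] by linarith
    moreover have "exp (- s * (lam i + lam k)) = exp (- s * lam i) * exp (- s * lam k)"
      by (simp add: exp_add [symmetric] algebra_simps)
    ultimately show "a i * a k * (lam i * lam k / (lam i + lam k)) *
        (exp (- s * (lam i + lam k)) * - (lam i + lam k))
      = - ((lam i * a i * exp (- s * lam i)) * (lam k * a k * exp (- s * lam k)))"
      by (simp add: field_simps)
  qed
  also have "\<dots> = - (\<Sum>i\<in>I. lam i * a i * exp (- s * lam i))\<^sup>2"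
    by (simp add: power2_eq_square sum_product sum_negf)
  finally show ?thesis .
qed

lemma heat_energy_antimono:
  assumes "\<And>i. i \<in> I \<Longrightarrow> 0 < lam i" and "r \<le> s"
  shows "heat_energy I lam a s \<le> heat_energy I lam a r"
  using assms(2)
  by (rule DERIV_nonpos_imp_nonincreasing) (use heat_energy_deriv[OF assms(1)] in force)

text \<open>A decreasing function of \<open>s\<close> that tends to \<open>0\<close>.\<close>

lemma heat_energy_nonneg:
  assumes pos: "\<And>i. i \<in> I \<Longrightarrow> 0 < lam i"
  shows "0 \<le> heat_energy I lam a s"
proof (rule tendsto_le[OF trivial_limit_at_top_linorder tendsto_const])
  show "((\<lambda>s. heat_energy I lam a s) \<longlongrightarrow> 0) at_top"
    unfolding heat_energy_def
  proof (intro tendsto_null_sum tendsto_mult_right_zero)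
    fix i k assume "i \<in> I" "k \<in> I"
    then have "0 < lam i + lam k" using pos by (simp add: add_pos_pos)
    then have "filterlim (\<lambda>s. s * (lam i + lam k)) at_top at_top"
      by (intro filterlim_at_top_mult_tendsto_pos[where c = "lam i + lam k"] tendsto_const filterlim_ident)
    then have "filterlim (\<lambda>s. - (s * (lam i + lam k))) at_bot at_top"
      by (simp add: filterlim_uminus_at_bot)
    then show "((\<lambda>s. exp (- s * (lam i + lam k))) \<longlongrightarrow> 0) at_top"
      using filterlim_compose[OF exp_at_bot] by force
  qed
  show "\<forall>\<^sub>F s' in at_top. heat_energy I lam a s' \<le> heat_energy I lam a s"
    using eventually_ge_at_top[of s] by eventually_elim (rule heat_energy_antimono[OF pos])
qed

text \<open>The Cauchy--Schwarz inequality for the integral of \<open>u'\<close> over \<open>[r, s]\<close>.  Integrating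
  \<open>(u' + c)\<^sup>2 \<ge> 0\<close>, with \<open>c\<close> the mean slope of \<open>-u\<close>, amounts to the monotonicity of
  \<open>Q - 2 c U - c\<^sup>2 t\<close>, where \<open>Q\<close> is the energy and \<open>U\<close> the flow.\<close>

lemma heat_increment:
  assumes pos: "\<And>i. i \<in> I \<Longrightarrow> 0 < lam i" and rs: "r < s"
  shows "(heat_flow I lam a r - heat_flow I lam a s)\<^sup>2
    \<le> (s - r) * (heat_energy I lam a r - heat_energy I lam a s)"
proof -
  let ?U = "heat_flow I lam a" and ?Q = "heat_energy I lam a"
  define c where "c = (?U r - ?U s) / (s - r)"
  define v where "v s = (\<Sum>i\<in>I. lam i * a i * exp (- s * lam i))" for s
  define f where "f t = ?Q t - 2 * c * ?U t - c\<^sup>2 * t" for t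
  have "(f has_real_derivative - (v t)\<^sup>2 - 2 * c * - v t - c\<^sup>2 * 1) (at t)" for t
    unfolding f_def v_def
    by (intro DERIV_diff DERIV_cmult heat_flow_deriv heat_energy_deriv pos DERIV_ident)
  moreover have "- (v t)\<^sup>2 - 2 * c * - v t - c\<^sup>2 * 1 = - (v t - c)\<^sup>2" for t
    by (simp add: power2_eq_square algebra_simps)
  ultimately have d: "(f has_real_derivative - (v t - c)\<^sup>2) (at t)" for t by metis
  have "f s \<le> f r"
    using less_imp_le[OF rs] by (rule DERIV_nonpos_imp_nonincreasing) (use d in force)
  then have "2 * c * (?U r - ?U s) - c\<^sup>2 * (s - r) \<le> ?Q r - ?Q s"
    by (simp add: f_def algebra_simps)
  moreover have "?U r - ?U s = c * (s - r)" using rs by (simp add: c_def)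
  ultimately have "c\<^sup>2 * (s - r) \<le> ?Q r - ?Q s" by (simp add: power2_eq_square)
  from mult_left_mono[OF this, of "s - r"] rs
  have "(c * (s - r))\<^sup>2 \<le> (s - r) * (?Q r - ?Q s)" by (simp add: power2_eq_square algebra_simps)
  then show ?thesis using \<open>?U r - ?U s = c * (s - r)\<close> by simp
qed

text \<open>Averaging the times \<open>t\<close> and \<open>3t\<close> improves the final constant from \<open>B/\<pi>\<close>, which a single time
  gives, to \<open>7B/(8\<pi>)\<close>.\<close>

definition heat_cutoff :: "real \<Rightarrow> real \<Rightarrow> real" where
  "heat_cutoff t l = (exp (- t * l) + exp (- (3 * t) * l)) / 2"

text \<open>The left-hand side is the square of \<open>(u(0) - u(t)) + (u(t) - u(3t)) / 2\<close>.  Both increments are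
  bounded by \<open>heat_increment\<close>; the second interval is twice as long as the first but enters with
  weight \<open>1/2\<close>, and \<open>(v + w/2)\<^sup>2 \<le> 3/2 \<cdot> (v\<^sup>2 + w\<^sup>2/2)\<close> makes the energies telescope.\<close>

lemma high_energy_part:
  assumes pos: "\<And>i. i \<in> I \<Longrightarrow> 0 < lam i" and t: "0 < t"
  shows "((\<Sum>i\<in>I. a i) - (\<Sum>i\<in>I. heat_cutoff t (lam i) * a i))\<^sup>2 \<le> 3/2 * t * heat_energy I lam a 0"
proof -
  let ?U = "heat_flow I lam a" and ?Q = "heat_energy I lam a"
  let ?A = "?U 0 - ?U t" and ?B = "?U t - ?U (3 * t)"
  have "(\<Sum>i\<in>I. heat_cutoff t (lam i) * a i) = (?U t + ?U (3 * t)) / 2"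
    unfolding heat_flow_def heat_cutoff_def
    by (simp add: sum.distrib [symmetric] sum_divide_distrib algebra_simps)
  moreover have "(\<Sum>i\<in>I. a i) = ?U 0" by (simp add: heat_flow_def)
  ultimately have e: "(\<Sum>i\<in>I. a i) - (\<Sum>i\<in>I. heat_cutoff t (lam i) * a i) = ?A + ?B / 2"
    by (simp add: field_simps)
  have "?A\<^sup>2 \<le> t * (?Q 0 - ?Q t)"
    using heat_increment[of I lam 0 t a, OF pos t] by simp
  then have A: "?A\<^sup>2 \<le> t * ?Q 0 - t * ?Q t" by (simp add: right_diff_distrib)
  have "?B\<^sup>2 \<le> 2 * t * (?Q t - ?Q (3 * t))"
    using heat_increment[of I lam t "3 * t" a, OF pos] t by simp
  then have B: "?B\<^sup>2 \<le> 2 * (t * ?Q t) - 2 * (t * ?Q (3 * t))" by (simp add: right_diff_distrib)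
  have sq: "(u + w / 2)\<^sup>2 \<le> 3/2 * (u\<^sup>2 + w\<^sup>2 / 2)" for u w :: real
  proof -
    have "3/2 * (u\<^sup>2 + w\<^sup>2 / 2) - (u + w / 2)\<^sup>2 = (u - w)\<^sup>2 / 2"
      by (simp add: power2_eq_square field_simps)
    then show ?thesis using zero_le_power2[of "u - w"] by linarith
  qed
  have Q: "0 \<le> t * ?Q (3 * t)"
    using t heat_energy_nonneg[of I lam a "3 * t", OF pos] by simp
  have "(?A + ?B / 2)\<^sup>2 \<le> 3/2 * (t * ?Q 0)"
  proof -
    have "s \<le> 3/2 * p" if "s \<le> 3/2 * (x + y / 2)" "x \<le> p - q" "y \<le> 2 * q - 2 * r" "0 \<le> r"
      for x y p q r s :: real
    proof -
      have "x + y / 2 \<le> p" using that(2-4) by simp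
      from mult_left_mono[OF this, of "3/2"] that(1) show ?thesis by simp
    qed
    from this[OF sq A B Q] show ?thesis .
  qed
  then show ?thesis unfolding e by (simp add: mult.assoc)
qed

text \<open>At the time \<open>t = 4c/r\<close> the first term is exactly half of \<open>\<surd>r\<close>, so the other half is bounded
  by the second term.\<close>

lemma square_le_of_all_times:
  assumes r: "0 \<le> r" and c: "0 < c" and K: "0 \<le> K"
    and le: "\<And>t. 0 < t \<Longrightarrow> sqrt r \<le> sqrt (c / t) + sqrt (3/2 * t * K)"
  shows "r\<^sup>2 \<le> 24 * c * K"
proof (cases "r = 0")
  case False
  then have r: "0 < r" using r by simp
  have "sqrt r \<le> sqrt (c / (4 * c / r)) + sqrt (3/2 * (4 * c / r) * K)"
    by (rule le) (use r c in simp)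
  also have "c / (4 * c / r) = r / 4" using r c by (simp add: field_simps)
  also have "sqrt (r / 4) = sqrt r / 2" by (simp add: real_sqrt_divide)
  finally have "sqrt r \<le> 2 * sqrt (3/2 * (4 * c / r) * K)" by simp
  also have "\<dots> = sqrt (24 * c * K / r)"
    using real_sqrt_mult[of 4 "3/2 * (4 * c / r) * K"] by (simp add: mult.assoc)
  finally have "r \<le> 24 * c * K / r" by simp
  then show ?thesis using r by (simp add: field_simps power2_eq_square)
qed (use c K in simp)


section \<open>Surfaces with an explicit spectral decomposition\<close>

text \<open>Products of integrable functions of one variable are integrable on the product space.\<close>

lemma (in pair_sigma_finite) Fubini_dominated:
  fixes q :: "'a \<Rightarrow> 'b \<Rightarrow> real"
  assumes q: "case_prod q \<in> borel_measurable (M1 \<Otimes>\<^sub>M M2)"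
    and f: "integrable M1 f" and h: "integrable M2 h"
    and le: "\<And>x y. x \<in> space M1 \<Longrightarrow> y \<in> space M2 \<Longrightarrow> \<bar>q x y\<bar> \<le> C * (f x * h y)"
  shows "(\<integral>x. (\<integral>y. q x y \<partial>M2) \<partial>M1) = (\<integral>y. (\<integral>x. q x y \<partial>M1) \<partial>M2)"
proof -
  have [measurable]: "f \<in> borel_measurable M1" "h \<in> borel_measurable M2" using f h by auto
  have "integrable (M1 \<Otimes>\<^sub>M M2) (\<lambda>p. C * (f (fst p) * h (snd p)))"
  proof (rule Fubini_integrable)
    have "integrable M1 (\<lambda>x. \<bar>C\<bar> * (\<bar>f x\<bar> * (\<integral>y. \<bar>h y\<bar> \<partial>M2)))" using f by simp
    then show "integrable M1 (\<lambda>x. \<integral>y. norm (C * (f (fst (x, y)) * h (snd (x, y)))) \<partial>M2)"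
      by (simp add: abs_mult)
    show "AE x in M1. integrable M2 (\<lambda>y. C * (f (fst (x, y)) * h (snd (x, y))))"
      using h by simp
  qed measurable
  then have "integrable (M1 \<Otimes>\<^sub>M M2) (case_prod q)"
  proof (rule Bochner_Integration.integrable_bound[OF _ q])
    show "AE p in M1 \<Otimes>\<^sub>M M2. norm (case_prod q p) \<le> norm (C * (f (fst p) * h (snd p)))"
    proof (rule AE_I2)
      fix p assume "p \<in> space (M1 \<Otimes>\<^sub>M M2)"
      then have "\<bar>q (fst p) (snd p)\<bar> \<le> C * (f (fst p) * h (snd p))"
        by (intro le) (auto simp: space_pair_measure)
      then show "norm (case_prod q p) \<le> norm (C * (f (fst p) * h (snd p)))"
        by (simp add: case_prod_beta)
    qed
  qed
  from Fubini_integral[OF this] show ?thesis by simp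
qed

text \<open>The linear span of the constants and of all kernels \<open>Z i x\<close> with \<open>i\<close> in some \<open>F R\<close> and
  \<open>x \<in> X\<close>.  It serves as the dense class in \<open>L\<^sub>2\<close>.\<close>

inductive kernel_span :: "('i \<Rightarrow> 'a \<Rightarrow> 'a \<Rightarrow> real) \<Rightarrow> (nat \<Rightarrow> 'i set) \<Rightarrow> 'a set \<Rightarrow> ('a \<Rightarrow> real) \<Rightarrow> bool"
  for Z :: "'i \<Rightarrow> 'a \<Rightarrow> 'a \<Rightarrow> real" and F :: "nat \<Rightarrow> 'i set" and X :: "'a set" where
  const: "kernel_span Z F X (\<lambda>y. c)"
| kernel: "i \<in> F R \<Longrightarrow> x \<in> X \<Longrightarrow> kernel_span Z F X (Z i x)"
| scale: "kernel_span Z F X f \<Longrightarrow> kernel_span Z F X (\<lambda>y. c * f y)"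
| add: "kernel_span Z F X f \<Longrightarrow> kernel_span Z F X g \<Longrightarrow> kernel_span Z F X (\<lambda>y. f y + g y)"

text \<open>For every mode \<open>i\<close>, \<open>Z i\<close> is the kernel of an orthogonal projection onto eigenfunctions of \<open>-\<Delta>\<close>
  with eigenvalue \<open>lam i\<close>, and \<open>D i x\<close> is the gradient of \<open>Z i x\<close>.  A mode may stand for a whole
  eigenspace (sphere) or for a single eigenfunction (torus).  The finite sets \<open>F R\<close> exhaust the
  modes; constants are not among them, whence \<open>0 < lam i\<close>.  The axiom \<open>trace\<close> compares the heat
  kernel on the diagonal with \<open>1/(4\<pi>\<tau>)\<close>, its value in the plane.\<close>

locale spectral_surface =
  fixes M :: "'a::euclidean_space surface"
    and Z :: "'i \<Rightarrow> 'a \<Rightarrow> 'a \<Rightarrow> real"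
    and D :: "'i \<Rightarrow> 'a \<Rightarrow> 'a \<Rightarrow> 'a"
    and lam :: "'i \<Rightarrow> real"
    and F :: "nat \<Rightarrow> 'i set"
    and B :: real
  assumes finite_vol: "finite_measure (vol M)"
    and smooth_borel: "smooth_grad M \<phi> G \<Longrightarrow>
      \<phi> \<in> borel_measurable (vol M) \<and> G \<in> borel_measurable (vol M)"
    and smooth_bounded: "smooth_grad M \<phi> G \<Longrightarrow>
      \<exists>C. \<forall>x\<in>space (vol M). \<bar>\<phi> x\<bar> \<le> C \<and> norm (G x) \<le> C"
    and finite_modes: "finite (F R)"
    and mono_modes: "mono F"
    and lam_pos: "i \<in> F R \<Longrightarrow> 0 < lam i"
    and Z_borel: "i \<in> F R \<Longrightarrow> case_prod (Z i) \<in> borel_measurable (vol M \<Otimes>\<^sub>M vol M)"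
    and D_borel: "i \<in> F R \<Longrightarrow> case_prod (D i) \<in> borel_measurable (vol M \<Otimes>\<^sub>M vol M)"
    and kernel_bounded: "i \<in> F R \<Longrightarrow>
      \<exists>C. \<forall>x\<in>space (vol M). \<forall>y\<in>space (vol M). \<bar>Z i x y\<bar> \<le> C \<and> norm (D i x y) \<le> C"
    and Z_sym: "i \<in> F R \<Longrightarrow> x \<in> space (vol M) \<Longrightarrow> y \<in> space (vol M) \<Longrightarrow> Z i x y = Z i y x"
    and reproducing: "i \<in> F R \<Longrightarrow> j \<in> F R \<Longrightarrow> x \<in> space (vol M) \<Longrightarrow> z \<in> space (vol M) \<Longrightarrow>
      (\<integral>y. Z i x y * Z j y z \<partial>vol M) = (if i = j then Z i x z else 0)"
    and Z_smooth: "i \<in> F R \<Longrightarrow> x \<in> space (vol M) \<Longrightarrow> smooth_grad M (Z i x) (D i x)"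
    and green: "smooth_grad M \<phi> G \<Longrightarrow> i \<in> F R \<Longrightarrow> x \<in> space (vol M) \<Longrightarrow>
      (\<integral>y. G y \<bullet> D i x y \<partial>vol M) = lam i * (\<integral>y. \<phi> y * Z i x y \<partial>vol M)"
    and dense: "smooth_grad M \<phi> G \<Longrightarrow> 0 < \<epsilon> \<Longrightarrow>
      \<exists>q. kernel_span Z F (space (vol M)) q \<and> (\<forall>y\<in>space (vol M). \<bar>\<phi> y - q y\<bar> \<le> \<epsilon>)"
    and trace: "x \<in> space (vol M) \<Longrightarrow> 0 < \<tau> \<Longrightarrow>
      (\<Sum>i\<in>F R. exp (- \<tau> * lam i) * Z i x x) \<le> B / (4 * pi * \<tau>)"
    and B_pos: "0 < B"
    and const_smooth: "smooth_grad M (\<lambda>_. 1) (\<lambda>_. 0)"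
begin

sublocale finite_measure "vol M" by (rule finite_vol)
sublocale P: pair_sigma_finite "vol M" "vol M" ..

abbreviation "\<mu> \<equiv> vol M"

definition proj :: "'i \<Rightarrow> ('a \<Rightarrow> real) \<Rightarrow> 'a \<Rightarrow> real" where
  "proj i f x = (\<integral>y. Z i x y * f y \<partial>\<mu>)"

definition grad_proj :: "'i \<Rightarrow> ('a \<Rightarrow> real) \<Rightarrow> 'a \<Rightarrow> 'a" where
  "grad_proj i f y = (\<integral>x. f x *\<^sub>R D i x y \<partial>\<mu>)"

text \<open>A bounded kernel defines an operator on \<open>L\<^sub>2\<close>, and its adjoint has the transposed kernel.  Used
  both for the scalar kernels \<open>Z i\<close> and for their gradients.\<close>

lemma bounded_kernel:
  fixes k :: "'a \<Rightarrow> 'a \<Rightarrow> 'b::euclidean_space"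
  assumes k: "case_prod k \<in> borel_measurable (\<mu> \<Otimes>\<^sub>M \<mu>)"
    and C: "\<And>x y. x \<in> space \<mu> \<Longrightarrow> y \<in> space \<mu> \<Longrightarrow> norm (k x y) \<le> C" and f: "f \<in> L2 \<mu>"
  shows "(\<lambda>y. \<integral>x. f x *\<^sub>R k x y \<partial>\<mu>) \<in> L2 \<mu>"
    and "h \<in> L2 \<mu> \<Longrightarrow> (\<integral>y. h y \<bullet> (\<integral>x. f x *\<^sub>R k x y \<partial>\<mu>) \<partial>\<mu>) = (\<integral>x. f x * (\<integral>y. h y \<bullet> k x y \<partial>\<mu>) \<partial>\<mu>)"
proof -
  note [measurable] = k L2_borel[OF f]
  have int: "integrable \<mu> (\<lambda>x. f x *\<^sub>R k x y)" if y: "y \<in> space \<mu>" for y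
  proof (rule Bochner_Integration.integrable_bound)
    show "integrable \<mu> (\<lambda>x. C * \<bar>f x\<bar>)" using L2_integrable[OF f] by simp
    have "norm (f x *\<^sub>R k x y) \<le> norm (C * \<bar>f x\<bar>)" if x: "x \<in> space \<mu>" for x
      using mult_left_mono[OF C[OF x y], of "\<bar>f x\<bar>"] order_trans[OF norm_ge_zero C[OF x y]]
      by (simp add: abs_mult mult.commute)
    then show "AE x in \<mu>. norm (f x *\<^sub>R k x y) \<le> norm (C * \<bar>f x\<bar>)" by auto
    have "(\<lambda>x. k x y) \<in> borel_measurable \<mu>"
      using measurable_compose[OF measurable_Pair2'[OF y] k] by simp
    then show "(\<lambda>x. f x *\<^sub>R k x y) \<in> borel_measurable \<mu>" by measurable
  qed
  have "(\<lambda>y. \<integral>x. f x *\<^sub>R k x y \<partial>\<mu>) \<in> borel_measurable \<mu>" by measurable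
  moreover have "norm (\<integral>x. f x *\<^sub>R k x y \<partial>\<mu>) \<le> (\<integral>x. C * \<bar>f x\<bar> \<partial>\<mu>)" if y: "y \<in> space \<mu>" for y
  proof -
    have "norm (\<integral>x. f x *\<^sub>R k x y \<partial>\<mu>) \<le> (\<integral>x. norm (f x *\<^sub>R k x y) \<partial>\<mu>)"
      by (rule integral_norm_bound)
    also have "\<dots> \<le> (\<integral>x. C * \<bar>f x\<bar> \<partial>\<mu>)"
      using L2_integrable[OF f] integrable_norm[OF int[OF y]] C[OF _ y]
      by (intro integral_mono) (auto simp: mult.commute[of C] intro!: mult_left_mono)
    finally show ?thesis .
  qed
  ultimately show "(\<lambda>y. \<integral>x. f x *\<^sub>R k x y \<partial>\<mu>) \<in> L2 \<mu>" by (intro L2_bounded)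
  assume h: "h \<in> L2 \<mu>"
  note [measurable] = L2_borel[OF h]
  have "(\<integral>y. h y \<bullet> (\<integral>x. f x *\<^sub>R k x y \<partial>\<mu>) \<partial>\<mu>) = (\<integral>y. (\<integral>x. f x * (h y \<bullet> k x y) \<partial>\<mu>) \<partial>\<mu>)"
  proof (rule Bochner_Integration.integral_cong[OF refl])
    fix y assume "y \<in> space \<mu>"
    from int[OF this] show "h y \<bullet> (\<integral>x. f x *\<^sub>R k x y \<partial>\<mu>) = (\<integral>x. f x * (h y \<bullet> k x y) \<partial>\<mu>)"
      by (subst integral_inner_right[symmetric]) auto
  qed
  also have "\<dots> = (\<integral>x. (\<integral>y. f x * (h y \<bullet> k x y) \<partial>\<mu>) \<partial>\<mu>)"
  proof (rule P.Fubini_dominated[symmetric])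
    show "integrable \<mu> (\<lambda>x. \<bar>f x\<bar>)" "integrable \<mu> (\<lambda>x. norm (h x))"
      using L2_integrable f h by auto
    show "\<bar>f x * (h y \<bullet> k x y)\<bar> \<le> C * (\<bar>f x\<bar> * norm (h y))" if "x \<in> space \<mu>" "y \<in> space \<mu>" for x y
    proof -
      have "\<bar>h y \<bullet> k x y\<bar> \<le> norm (h y) * C"
        by (rule order_trans[OF Cauchy_Schwarz_ineq2 mult_left_mono[OF C[OF that]]]) simp
      from mult_left_mono[OF this, of "\<bar>f x\<bar>"] show ?thesis by (simp add: abs_mult ac_simps)
    qed
  qed measurable
  finally show "(\<integral>y. h y \<bullet> (\<integral>x. f x *\<^sub>R k x y \<partial>\<mu>) \<partial>\<mu>) = (\<integral>x. f x * (\<integral>y. h y \<bullet> k x y \<partial>\<mu>) \<partial>\<mu>)"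
    by simp
qed

lemma smooth_L2: assumes "smooth_grad M \<phi> G" shows "\<phi> \<in> L2 \<mu>" "G \<in> L2 \<mu>"
proof -
  obtain C where C: "\<And>x. x \<in> space \<mu> \<Longrightarrow> \<bar>\<phi> x\<bar> \<le> C \<and> norm (G x) \<le> C"
    using smooth_bounded[OF assms] by blast
  show "\<phi> \<in> L2 \<mu>" "G \<in> L2 \<mu>"
    using smooth_borel[OF assms] C by (auto intro!: L2_bounded[where C=C])
qed

lemma Z_L2: assumes "i \<in> F R" "x \<in> space \<mu>" shows "Z i x \<in> L2 \<mu>" "D i x \<in> L2 \<mu>"
  using smooth_L2[OF Z_smooth[OF assms]] by auto

lemma reproducing': 
  assumes "i \<in> F R" "j \<in> F R" "x \<in> space \<mu>" "z \<in> space \<mu>"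
  shows "(\<integral>y. Z i x y * Z j z y \<partial>\<mu>) = (if i = j then Z i x z else 0)"
proof -
  have "(\<integral>y. Z i x y * Z j z y \<partial>\<mu>) = (\<integral>y. Z i x y * Z j y z \<partial>\<mu>)"
    by (rule Bochner_Integration.integral_cong) (use Z_sym assms in auto)
  then show ?thesis using reproducing assms by simp
qed

lemma proj_L2:
  assumes i: "i \<in> F R" and f: "f \<in> L2 \<mu>"
  shows "proj i f \<in> L2 \<mu>"
    and "h \<in> L2 \<mu> \<Longrightarrow> (\<integral>x. f x * proj i h x \<partial>\<mu>) = (\<integral>x. proj i f x * h x \<partial>\<mu>)"
proof -
  obtain C where C: "\<And>x y. x \<in> space \<mu> \<Longrightarrow> y \<in> space \<mu> \<Longrightarrow> norm (Z i y x) \<le> C"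
    using kernel_bounded[OF i] by auto
  have k: "case_prod (\<lambda>x y. Z i y x) \<in> borel_measurable (\<mu> \<Otimes>\<^sub>M \<mu>)"
    using measurable_pair_swap[OF Z_borel[OF i]] by simp
  show "proj i f \<in> L2 \<mu>"
    using bounded_kernel(1)[OF k C f] by (simp add: proj_def [abs_def] mult.commute)
  assume h: "h \<in> L2 \<mu>"
  have "(\<integral>x. proj i f x * h x \<partial>\<mu>) = (\<integral>x. f x * (\<integral>y. h y * Z i y x \<partial>\<mu>) \<partial>\<mu>)"
    using bounded_kernel(2)[OF k C f h] by (simp add: proj_def mult.commute)
  also have "\<dots> = (\<integral>x. f x * proj i h x \<partial>\<mu>)"
  proof (rule Bochner_Integration.integral_cong[OF refl])
    fix x assume x: "x \<in> space \<mu>"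
    have "(\<integral>y. h y * Z i y x \<partial>\<mu>) = proj i h x"
      unfolding proj_def by (rule Bochner_Integration.integral_cong) (use Z_sym[OF i x] in auto)
    then show "f x * (\<integral>y. h y * Z i y x \<partial>\<mu>) = f x * proj i h x" by simp
  qed
  finally show "(\<integral>x. f x * proj i h x \<partial>\<mu>) = (\<integral>x. proj i f x * h x \<partial>\<mu>)" by simp
qed

lemmas proj_symmetric = proj_L2(2)

lemma proj_kernel:
  assumes "i \<in> F R" "j \<in> F R" "x \<in> space \<mu>" "z \<in> space \<mu>"
  shows "proj j (Z i x) z = (if i = j then Z i x z else 0)"
  unfolding proj_def using reproducing'[of j R i z x] assms Z_sym[of i R x z] by auto

lemma proj_proj:
  assumes i: "i \<in> F R" and j: "j \<in> F R" and f: "f \<in> L2 \<mu>" and x: "x \<in> space \<mu>"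
  shows "proj i (proj j f) x = (if i = j then proj i f x else 0)"
proof -
  have "proj i (proj j f) x = (\<integral>y. Z i x y * proj j f y \<partial>\<mu>)" by (simp add: proj_def)
  also have "\<dots> = (\<integral>y. proj j (Z i x) y * f y \<partial>\<mu>)"
    by (rule proj_symmetric[OF j Z_L2(1)[OF i x] f])
  also have "\<dots> = (\<integral>y. (if i = j then Z i x y * f y else 0) \<partial>\<mu>)"
    by (rule Bochner_Integration.integral_cong) (use proj_kernel[OF i j x] in auto)
  finally show ?thesis by (simp add: proj_def)
qed

lemma proj_orthogonal:
  assumes i: "i \<in> F R" and j: "j \<in> F R" and f: "f \<in> L2 \<mu>" and h: "h \<in> L2 \<mu>"
  shows "(\<integral>x. proj i f x * proj j h x \<partial>\<mu>) = (if i = j then \<integral>x. f x * proj i h x \<partial>\<mu> else 0)"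
proof -
  have "(\<integral>x. proj i f x * proj j h x \<partial>\<mu>) = (\<integral>x. f x * proj i (proj j h) x \<partial>\<mu>)"
    using proj_symmetric[OF i f proj_L2(1)[OF j h]] by simp
  also have "\<dots> = (\<integral>x. (if i = j then f x * proj i h x else 0) \<partial>\<mu>)"
    by (rule Bochner_Integration.integral_cong) (use proj_proj[OF i j h] in auto)
  finally show ?thesis by simp
qed

text \<open>For smooth functions this is the axiom \<open>green\<close>; both sides are continuous in the \<open>H\<^sup>1\<close> norm.\<close>

lemma green_H1:
  assumes g: "has_H1_gradient M \<psi> g" and i: "i \<in> F R" and x: "x \<in> space \<mu>"
  shows "(\<integral>y. g y \<bullet> D i x y \<partial>\<mu>) = lam i * proj i \<psi> x"
proof -
  from g obtain \<phi> G where sm: "\<And>n::nat. smooth_grad M (\<phi> n) (G n)"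
    and l1: "(\<lambda>n. L2_norm \<mu> (\<lambda>x. \<phi> n x - \<psi> x)) \<longlonglongrightarrow> 0"
    and l2: "(\<lambda>n. L2_norm \<mu> (\<lambda>x. G n x - g x)) \<longlonglongrightarrow> 0"
    and L: "\<psi> \<in> L2 \<mu>" "g \<in> L2 \<mu>"
    unfolding has_H1_gradient_def by blast
  have "(\<lambda>n. \<integral>y. G n y \<bullet> D i x y \<partial>\<mu>) \<longlonglongrightarrow> (\<integral>y. g y \<bullet> D i x y \<partial>\<mu>)"
    by (rule L2_tendsto_inner[OF smooth_L2(2)[OF sm] L(2) Z_L2(2)[OF i x] l2])
  moreover have "(\<lambda>n. \<integral>y. \<phi> n y \<bullet> Z i x y \<partial>\<mu>) \<longlonglongrightarrow> (\<integral>y. \<psi> y \<bullet> Z i x y \<partial>\<mu>)"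
    by (rule L2_tendsto_inner[OF smooth_L2(1)[OF sm] L(1) Z_L2(1)[OF i x] l1])
  then have "(\<lambda>n. lam i * (\<integral>y. \<phi> n y * Z i x y \<partial>\<mu>)) \<longlonglongrightarrow> lam i * (\<integral>y. \<psi> y * Z i x y \<partial>\<mu>)"
    by (intro tendsto_mult_left) simp
  then have "(\<lambda>n. \<integral>y. G n y \<bullet> D i x y \<partial>\<mu>) \<longlonglongrightarrow> lam i * proj i \<psi> x"
    using green[OF sm i x] by (simp add: proj_def mult.commute)
  ultimately show ?thesis by (rule LIMSEQ_unique)
qed

lemma grad_proj_L2:
  assumes i: "i \<in> F R" and f: "f \<in> L2 \<mu>"
  shows "grad_proj i f \<in> L2 \<mu>"
    and "h \<in> L2 \<mu> \<Longrightarrow> (\<integral>y. h y \<bullet> grad_proj i f y \<partial>\<mu>) = (\<integral>x. f x * (\<integral>y. h y \<bullet> D i x y \<partial>\<mu>) \<partial>\<mu>)"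
proof -
  obtain C where C: "\<And>x y. x \<in> space \<mu> \<Longrightarrow> y \<in> space \<mu> \<Longrightarrow> norm (D i x y) \<le> C"
    using kernel_bounded[OF i] by blast
  show "grad_proj i f \<in> L2 \<mu>"
    unfolding grad_proj_def [abs_def] by (rule bounded_kernel(1)[OF D_borel[OF i] C f])
  show "h \<in> L2 \<mu> \<Longrightarrow> (\<integral>y. h y \<bullet> grad_proj i f y \<partial>\<mu>) = (\<integral>x. f x * (\<integral>y. h y \<bullet> D i x y \<partial>\<mu>) \<partial>\<mu>)"
    unfolding grad_proj_def by (rule bounded_kernel(2)[OF D_borel[OF i] C f])
qed

lemmas grad_proj_inner = grad_proj_L2(2)

text \<open>Gradients of different spectral components are orthogonal: apply \<open>green\<close> to the kernel \<open>Z i x\<close>,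
  which is smooth, and use that the kernels reproduce each other.\<close>

lemma grad_proj_orthogonal:
  assumes i: "i \<in> F R" and j: "j \<in> F R" and f: "f \<in> L2 \<mu>"
  shows "(\<integral>y. grad_proj j f y \<bullet> grad_proj i f y \<partial>\<mu>)
    = (if i = j then lam i * (\<integral>x. f x * proj i f x \<partial>\<mu>) else 0)"
proof -
  have "(\<integral>y. grad_proj j f y \<bullet> D i x y \<partial>\<mu>) = (if i = j then lam i * proj i f x else 0)"
    if x: "x \<in> space \<mu>" for x
  proof -
    have "(\<integral>y. grad_proj j f y \<bullet> D i x y \<partial>\<mu>) = (\<integral>y. D i x y \<bullet> grad_proj j f y \<partial>\<mu>)"
      by (simp add: inner_commute)
    also have "\<dots> = (\<integral>z. f z * (\<integral>y. D i x y \<bullet> D j z y \<partial>\<mu>) \<partial>\<mu>)"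
      by (rule grad_proj_inner[OF j f Z_L2(2)[OF i x]])
    also have "\<dots> = (\<integral>z. (if i = j then lam i * (Z i x z * f z) else 0) \<partial>\<mu>)"
    proof (rule Bochner_Integration.integral_cong[OF refl])
      fix z assume z: "z \<in> space \<mu>"
      have "(\<integral>y. D i x y \<bullet> D j z y \<partial>\<mu>) = lam j * (\<integral>y. Z i x y * Z j z y \<partial>\<mu>)"
        by (rule green[OF Z_smooth[OF i x] j z])
      then show "f z * (\<integral>y. D i x y \<bullet> D j z y \<partial>\<mu>) = (if i = j then lam i * (Z i x z * f z) else 0)"
        using reproducing'[OF i j x z] by simp
    qed
    finally show ?thesis by (simp add: proj_def)
  qed
  then have "(\<integral>x. f x * (\<integral>y. grad_proj j f y \<bullet> D i x y \<partial>\<mu>) \<partial>\<mu>)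
      = (\<integral>x. (if i = j then lam i * (f x * proj i f x) else 0) \<partial>\<mu>)"
    by (intro Bochner_Integration.integral_cong) auto
  then show ?thesis using grad_proj_inner[OF i f grad_proj_L2(1)[OF j f]] by simp
qed

text \<open>Bessel's inequality for the gradient \<open>g\<close>: the gradients of the spectral components of \<open>\<psi>\<close> are
  orthogonal, and by Green's formula their inner products with \<open>g\<close> equal their squared norms.\<close>

lemma spectral_energy_le:
  assumes g: "has_H1_gradient M \<psi> g"
  shows "(\<Sum>i\<in>F R. lam i * (\<integral>x. \<psi> x * proj i \<psi> x \<partial>\<mu>)) \<le> (L2_norm \<mu> g)\<^sup>2"
proof -
  have L: "\<psi> \<in> L2 \<mu>" "g \<in> L2 \<mu>" using g by (auto simp: has_H1_gradient_def)
  define q where "q i = lam i * (\<integral>x. \<psi> x * proj i \<psi> x \<partial>\<mu>)" for i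
  define W where "W y = (\<Sum>i\<in>F R. grad_proj i \<psi> y)" for y
  have WL: "W \<in> L2 \<mu>" unfolding W_def by (intro L2_sum grad_proj_L2(1)[OF _ L(1)])
  have gW: "(\<integral>y. g y \<bullet> W y \<partial>\<mu>) = (\<Sum>i\<in>F R. q i)"
  proof -
    have "(\<integral>y. g y \<bullet> W y \<partial>\<mu>) = (\<Sum>i\<in>F R. \<integral>y. g y \<bullet> grad_proj i \<psi> y \<partial>\<mu>)"
      unfolding W_def inner_sum_right
      by (intro Bochner_Integration.integral_sum L2_inner_integrable L grad_proj_L2)
    also have "\<dots> = (\<Sum>i\<in>F R. q i)"
    proof (rule sum.cong[OF refl])
      fix i assume i: "i \<in> F R"
      have "(\<integral>y. g y \<bullet> grad_proj i \<psi> y \<partial>\<mu>) = (\<integral>x. \<psi> x * (\<integral>y. g y \<bullet> D i x y \<partial>\<mu>) \<partial>\<mu>)"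
        by (rule grad_proj_inner[OF i L])
      also have "\<dots> = (\<integral>x. lam i * (\<psi> x * proj i \<psi> x) \<partial>\<mu>)"
        by (rule Bochner_Integration.integral_cong) (use green_H1[OF g i] in auto)
      finally show "(\<integral>y. g y \<bullet> grad_proj i \<psi> y \<partial>\<mu>) = q i" by (simp add: q_def)
    qed
    finally show ?thesis .
  qed
  have WW: "(\<integral>y. W y \<bullet> W y \<partial>\<mu>) = (\<Sum>i\<in>F R. q i)"
  proof -
    have "(\<integral>y. W y \<bullet> W y \<partial>\<mu>) = (\<Sum>i\<in>F R. \<integral>y. W y \<bullet> grad_proj i \<psi> y \<partial>\<mu>)"
      unfolding W_def inner_sum_right
      by (intro Bochner_Integration.integral_sum L2_inner_integrable L2_sum L grad_proj_L2)
    also have "\<dots> = (\<Sum>i\<in>F R. \<Sum>j\<in>F R. \<integral>y. grad_proj j \<psi> y \<bullet> grad_proj i \<psi> y \<partial>\<mu>)"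
      unfolding W_def inner_sum_left
      by (intro sum.cong refl Bochner_Integration.integral_sum L2_inner_integrable L grad_proj_L2)
    also have "\<dots> = (\<Sum>i\<in>F R. \<Sum>j\<in>F R. if i = j then q i else 0)"
      by (intro sum.cong refl) (simp add: grad_proj_orthogonal[OF _ _ L(1)] q_def)
    also have "\<dots> = (\<Sum>i\<in>F R. q i)"
      using finite_modes by simp
    finally show ?thesis .
  qed
  have "0 \<le> (\<integral>y. (norm (g y - W y))\<^sup>2 \<partial>\<mu>)" by simp
  also have "\<dots> = (\<integral>y. (norm (g y))\<^sup>2 - 2 * (g y \<bullet> W y) + W y \<bullet> W y \<partial>\<mu>)"
    by (simp add: power2_norm_eq_inner algebra_simps inner_commute)
  also have "\<dots> = (\<integral>y. (norm (g y))\<^sup>2 \<partial>\<mu>) - (\<Sum>i\<in>F R. q i)"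
    using L2_inner_integrable[OF L(2) WL] L2_inner_integrable[OF WL WL] L(2) gW WW
    by (simp add: L2_def)
  finally show ?thesis by (simp add: q_def L2_norm_square)
qed


subsection \<open>The spectral truncations converge\<close>

lemma kernel_mean_zero:
  assumes "i \<in> F R" "x \<in> space \<mu>"
  shows "(\<integral>y. Z i x y \<partial>\<mu>) = 0"
  using green[OF const_smooth assms] lam_pos[OF assms(1)] by simp

definition trunc :: "nat \<Rightarrow> ('a \<Rightarrow> real) \<Rightarrow> 'a \<Rightarrow> real" where
  "trunc R f x = (\<Sum>i\<in>F R. proj i f x)"

lemma trunc_L2: "f \<in> L2 \<mu> \<Longrightarrow> trunc R f \<in> L2 \<mu>"
  unfolding trunc_def [abs_def] by (intro L2_sum proj_L2(1))

lemma proj_residual: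
  assumes f: "f \<in> L2 \<mu>" and i: "i \<in> F R" and x: "x \<in> space \<mu>"
  shows "proj i (\<lambda>y. f y - trunc R f y) x = 0"
proof -
  have "proj i (\<lambda>y. f y - trunc R f y) x
      = (\<integral>y. Z i x y * f y \<partial>\<mu>) - (\<integral>y. Z i x y * trunc R f y \<partial>\<mu>)"
    unfolding proj_def right_diff_distrib
    by (intro Bochner_Integration.integral_diff L2_mult_integrable Z_L2[OF i x] f trunc_L2)
  also have "(\<integral>y. Z i x y * trunc R f y \<partial>\<mu>) = (\<Sum>j\<in>F R. \<integral>y. Z i x y * proj j f y \<partial>\<mu>)"
    unfolding trunc_def sum_distrib_left
    by (intro Bochner_Integration.integral_sum L2_mult_integrable Z_L2[OF i x] f proj_L2[where R = R])
  also have "\<dots> = (\<Sum>j\<in>F R. if i = j then proj i f x else 0)"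
    by (intro sum.cong refl) (simp add: proj_def[symmetric] proj_proj[OF i _ f x])
  also have "\<dots> = proj i f x" using i finite_modes by simp
  finally show ?thesis by (simp add: proj_def)
qed

lemma proj_mean_zero:
  assumes f: "f \<in> L2 \<mu>" and i: "i \<in> F R"
  shows "(\<integral>x. proj i f x \<partial>\<mu>) = 0"
proof -
  have 1: "(\<lambda>x. 1 :: real) \<in> L2 \<mu>" by (rule smooth_L2(1)[OF const_smooth])
  have "(\<integral>x. 1 * proj i f x \<partial>\<mu>) = (\<integral>x. proj i (\<lambda>x. 1) x * f x \<partial>\<mu>)"
    by (rule proj_symmetric[OF i 1 f])
  also have "\<dots> = (\<integral>x. 0 \<partial>\<mu>)"
    by (rule Bochner_Integration.integral_cong) (use kernel_mean_zero[OF i] in \<open>auto simp: proj_def\<close>)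
  finally show ?thesis by simp
qed

text \<open>A function whose first spectral components and mean vanish is orthogonal to everything spanned by
  the corresponding kernels; \<open>R\<close> bounds the modes that occur in \<open>q\<close>.\<close>

lemma kernel_span_orthogonal:
  assumes "kernel_span Z F (space \<mu>) q"
  shows "\<exists>R. \<forall>R'\<ge>R. \<forall>r\<in>L2 \<mu>. (\<integral>y. r y \<partial>\<mu>) = 0 \<longrightarrow> (\<forall>i\<in>F R'. \<forall>x\<in>space \<mu>. proj i r x = 0) \<longrightarrow>
    (\<integral>y. r y * q y \<partial>\<mu>) = 0"
    and "q \<in> L2 \<mu>"
proof -
  have L: "f \<in> L2 \<mu>" if "kernel_span Z F (space \<mu>) f" for f
    using that
  proof induction
    case (const c)
    show ?case by (rule L2_bounded[where C = "\<bar>c\<bar>"]) auto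
  qed (auto intro: Z_L2 L2_mult_left L2_add)
  from L[OF assms] show "q \<in> L2 \<mu>" .
  show "\<exists>R. \<forall>R'\<ge>R. \<forall>r\<in>L2 \<mu>. (\<integral>y. r y \<partial>\<mu>) = 0 \<longrightarrow> (\<forall>i\<in>F R'. \<forall>x\<in>space \<mu>. proj i r x = 0) \<longrightarrow>
      (\<integral>y. r y * q y \<partial>\<mu>) = 0"
    using assms
  proof induction
    case (kernel i R x)
    have "(\<integral>y. r y * Z i x y \<partial>\<mu>) = proj i r x" for r by (simp add: proj_def mult.commute)
    moreover have "i \<in> F R'" if "R \<le> R'" for R'
      using monoD[OF mono_modes that] kernel(1) by blast
    ultimately show ?case using kernel(2) by (intro exI[of _ R]) auto
  next
    case (scale f c)
    then obtain R where "\<forall>R'\<ge>R. \<forall>r\<in>L2 \<mu>. (\<integral>y. r y \<partial>\<mu>) = 0 \<longrightarrow>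
        (\<forall>i\<in>F R'. \<forall>x\<in>space \<mu>. proj i r x = 0) \<longrightarrow> (\<integral>y. r y * f y \<partial>\<mu>) = 0" by blast
    then show ?case by (intro exI[of _ R]) (simp add: mult.left_commute)
  next
    case (add f g)
    then obtain R R' where R: "\<forall>S\<ge>R. \<forall>r\<in>L2 \<mu>. (\<integral>y. r y \<partial>\<mu>) = 0 \<longrightarrow>
        (\<forall>i\<in>F S. \<forall>x\<in>space \<mu>. proj i r x = 0) \<longrightarrow> (\<integral>y. r y * f y \<partial>\<mu>) = 0"
      and R': "\<forall>S\<ge>R'. \<forall>r\<in>L2 \<mu>. (\<integral>y. r y \<partial>\<mu>) = 0 \<longrightarrow>
        (\<forall>i\<in>F S. \<forall>x\<in>space \<mu>. proj i r x = 0) \<longrightarrow> (\<integral>y. r y * g y \<partial>\<mu>) = 0" by blast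
    show ?case
    proof (intro exI[of _ "max R R'"] allI impI ballI)
      fix S r assume S: "max R R' \<le> S" and r: "r \<in> L2 \<mu>" and m: "(\<integral>y. r y \<partial>\<mu>) = 0"
        and p: "\<forall>i\<in>F S. \<forall>x\<in>space \<mu>. proj i r x = 0"
      have "(\<integral>y. r y * f y \<partial>\<mu>) = 0" "(\<integral>y. r y * g y \<partial>\<mu>) = 0"
        using R R' S r m p by auto
      then show "(\<integral>y. r y * (f y + g y) \<partial>\<mu>) = 0"
        using L2_mult_integrable[OF r L[OF add.hyps(1)]] L2_mult_integrable[OF r L[OF add.hyps(2)]]
        by (simp add: distrib_left)
    qed
  qed auto
qed

text \<open>The residual \<open>r = f - trunc R f\<close> is orthogonal to the truncation and to every \<open>q\<close> in the span of
  the kernels with modes in \<open>F R\<close>; hence \<open>\<parallel>r\<parallel> \<le> \<parallel>f - q\<parallel>\<close>, and \<open>f\<close> can be approximated by such \<open>q\<close>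
  through smooth functions.\<close>

lemma trunc_tendsto:
  assumes h: "has_H1_gradient M f g" and mean: "(\<integral>x. f x \<partial>\<mu>) = 0"
  shows "(\<lambda>R. \<integral>x. (f x - trunc R f x)\<^sup>2 \<partial>\<mu>) \<longlonglongrightarrow> 0"
proof (rule LIMSEQ_I)
  fix e :: real assume e: "0 < e"
  from h obtain \<phi> G where sm: "\<And>n::nat. smooth_grad M (\<phi> n) (G n)"
    and l1: "(\<lambda>n. L2_norm \<mu> (\<lambda>x. \<phi> n x - f x)) \<longlonglongrightarrow> 0"
    and f: "f \<in> L2 \<mu>"
    unfolding has_H1_gradient_def by blast
  define V where "V = measure \<mu> (space \<mu>)"
  define d where "d = sqrt (e / (4 * (V + 1)))"
  have V: "0 \<le> V" by (simp add: V_def)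
  have d: "0 < d" using e V by (simp add: d_def)
  have d2: "d\<^sup>2 = e / (4 * (V + 1))" using e V by (simp add: d_def)
  obtain n where "norm (L2_norm \<mu> (\<lambda>x. \<phi> n x - f x) - 0) < d"
    using LIMSEQ_D[OF l1 d] by blast
  then have n: "L2_norm \<mu> (\<lambda>x. \<phi> n x - f x) < d" by (simp add: L2_norm_nonneg)
  obtain q where q: "kernel_span Z F (space \<mu>) q"
    and app: "\<And>y. y \<in> space \<mu> \<Longrightarrow> \<bar>\<phi> n y - q y\<bar> \<le> d"
    using dense[OF sm d] by blast
  note qL = kernel_span_orthogonal(2)[OF q]
  obtain R where R: "\<And>R' r. R \<le> R' \<Longrightarrow> r \<in> L2 \<mu> \<Longrightarrow> (\<integral>y. r y \<partial>\<mu>) = 0 \<Longrightarrow>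
      (\<And>i x. i \<in> F R' \<Longrightarrow> x \<in> space \<mu> \<Longrightarrow> proj i r x = 0) \<Longrightarrow> (\<integral>y. r y * q y \<partial>\<mu>) = 0"
    using kernel_span_orthogonal(1)[OF q] by blast
  have "norm ((\<integral>x. (f x - trunc R' f x)\<^sup>2 \<partial>\<mu>) - 0) < e" if R': "R \<le> R'" for R'
  proof -
    define r where "r y = f y - trunc R' f y" for y
    have r: "r \<in> L2 \<mu>" unfolding r_def by (intro L2_diff f trunc_L2)
    have pr: "proj i r x = 0" if "i \<in> F R'" "x \<in> space \<mu>" for i x
      unfolding r_def [abs_def] by (rule proj_residual[OF f that])
    have mr: "(\<integral>y. r y \<partial>\<mu>) = 0"
    proof -
      have "(\<integral>y. trunc R' f y \<partial>\<mu>) = (\<Sum>i\<in>F R'. \<integral>y. proj i f y \<partial>\<mu>)"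
        unfolding trunc_def by (intro Bochner_Integration.integral_sum L2_integrable proj_L2 f)
      also have "\<dots> = 0" using proj_mean_zero[OF f] by simp
      finally show ?thesis
        using L2_integrable[OF f] L2_integrable[OF trunc_L2[OF f]] mean by (simp add: r_def)
    qed
    have rq: "(\<integral>y. r y * q y \<partial>\<mu>) = 0" by (rule R[OF R' r mr pr])
    have rP: "(\<integral>y. r y * trunc R' f y \<partial>\<mu>) = 0"
    proof -
      have "(\<integral>y. r y * trunc R' f y \<partial>\<mu>) = (\<Sum>i\<in>F R'. \<integral>y. r y * proj i f y \<partial>\<mu>)"
        unfolding trunc_def sum_distrib_left
        by (intro Bochner_Integration.integral_sum L2_mult_integrable r f proj_L2)
      also have "\<dots> = (\<Sum>i\<in>F R'. \<integral>y. proj i r y * f y \<partial>\<mu>)"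
        by (intro sum.cong refl proj_symmetric r f)
      also have "\<dots> = (\<Sum>i\<in>F R'. \<integral>y. 0 \<partial>\<mu>)"
        by (intro sum.cong refl Bochner_Integration.integral_cong) (simp add: pr)
      finally show ?thesis by simp
    qed
    define w where "w y = trunc R' f y - q y" for y
    have w: "w \<in> L2 \<mu>" unfolding w_def by (intro L2_diff qL trunc_L2 f)
    have rw: "(\<integral>y. r y * w y \<partial>\<mu>) = 0"
      using L2_mult_integrable[OF r qL] L2_mult_integrable[OF r trunc_L2[OF f]] rP rq
      by (simp add: w_def right_diff_distrib)
    have sq: "integrable \<mu> (\<lambda>y. (u y)\<^sup>2)" if "u \<in> L2 \<mu>" for u :: "'a \<Rightarrow> real"
      using that by (simp add: L2_def)
    have "(\<integral>y. (r y)\<^sup>2 \<partial>\<mu>) \<le> (\<integral>y. (r y)\<^sup>2 \<partial>\<mu>) + 2 * (\<integral>y. r y * w y \<partial>\<mu>) + (\<integral>y. (w y)\<^sup>2 \<partial>\<mu>)"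
      using rw by simp
    also have "\<dots> = (\<integral>y. (r y)\<^sup>2 + 2 * (r y * w y) + (w y)\<^sup>2 \<partial>\<mu>)"
      using sq[OF r] sq[OF w] L2_mult_integrable[OF r w] by simp
    also have "\<dots> = (\<integral>y. (f y - q y)\<^sup>2 \<partial>\<mu>)"
      by (rule Bochner_Integration.integral_cong)
        (auto simp: r_def w_def power2_eq_square algebra_simps)
    also have "\<dots> \<le> (\<integral>y. 2 * (\<phi> n y - f y)\<^sup>2 + 2 * d\<^sup>2 \<partial>\<mu>)"
    proof (rule integral_mono)
      show "integrable \<mu> (\<lambda>y. (f y - q y)\<^sup>2)" by (intro sq L2_diff f qL)
      show "integrable \<mu> (\<lambda>y. 2 * (\<phi> n y - f y)\<^sup>2 + 2 * d\<^sup>2)"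
        using sq[OF L2_diff[OF smooth_L2(1)[OF sm] f]] by simp
      fix y assume y: "y \<in> space \<mu>"
      have "(\<phi> n y - q y)\<^sup>2 \<le> d\<^sup>2"
        using app[OF y] d by (intro abs_le_square_iff[THEN iffD1]) simp
      moreover have "(f y - q y)\<^sup>2 \<le> 2 * (\<phi> n y - f y)\<^sup>2 + 2 * (\<phi> n y - q y)\<^sup>2"
        using sum_squares_bound[of "f y - \<phi> n y" "\<phi> n y - q y"]
        by (simp add: power2_eq_square algebra_simps)
      ultimately show "(f y - q y)\<^sup>2 \<le> 2 * (\<phi> n y - f y)\<^sup>2 + 2 * d\<^sup>2" by linarith
    qed
    also have "\<dots> = 2 * (L2_norm \<mu> (\<lambda>x. \<phi> n x - f x))\<^sup>2 + 2 * d\<^sup>2 * V"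
      using sq[OF L2_diff[OF smooth_L2(1)[OF sm] f]] by (simp add: L2_norm_square V_def)
    also have "\<dots> < 2 * d\<^sup>2 + 2 * d\<^sup>2 * V"
      using n power_strict_mono[OF n L2_norm_nonneg, of 2] by simp
    also have "\<dots> = 2 * d\<^sup>2 * (V + 1)" by (simp add: algebra_simps)
    also have "\<dots> \<le> e" unfolding d2 using V e by (simp add: field_simps)
    finally show ?thesis by (simp add: r_def)
  qed
  then show "\<exists>no. \<forall>n\<ge>no. norm ((\<integral>x. (f x - trunc n f x)\<^sup>2 \<partial>\<mu>) - 0) < e" by blast
qed

subsection \<open>The Lieb--Thirring inequality\<close>

text \<open>The summands are the squared coefficients of \<open>h(y) = \<Sum>\<^sub>i m(\<lambda>\<^sub>i) Z\<^sub>i(x, y)\<close>, where \<open>m\<close> is the cutoff.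
  Bessel's inequality bounds their sum by \<open>\<parallel>h\<parallel>\<^sup>2 = \<Sum>\<^sub>i m(\<lambda>\<^sub>i)\<^sup>2 Z\<^sub>i(x, x)\<close>, and
  \<open>m(\<lambda>)\<^sup>2 = (e\<^sup>-\<^sup>2\<^sup>t\<^sup>\<lambda> + 2 e\<^sup>-\<^sup>4\<^sup>t\<^sup>\<lambda> + e\<^sup>-\<^sup>6\<^sup>t\<^sup>\<lambda>)/4\<close> leaves three heat kernels at times \<open>2t\<close>, \<open>4t\<close>, \<open>6t\<close>.\<close>

lemma low_energy_part:
  assumes on: "L2_orthonormal \<mu> J \<psi>" and J: "finite J" and x: "x \<in> space \<mu>" and t: "0 < t"
  shows "(\<Sum>j\<in>J. (\<Sum>i\<in>F R. heat_cutoff t (lam i) * proj i (\<psi> j) x)\<^sup>2) \<le> 7 * B / (96 * pi) / t"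
proof -
  let ?m = "\<lambda>i. heat_cutoff t (lam i)"
  define h where "h y = (\<Sum>i\<in>F R. ?m i * Z i x y)" for y
  have L: "\<psi> j \<in> L2 \<mu>" if "j \<in> J" for j using on that by (auto simp: L2_orthonormal_def)
  have h: "h \<in> L2 \<mu>" unfolding h_def by (intro L2_sum L2_mult_left Z_L2 x)
  have c: "(\<Sum>i\<in>F R. ?m i * proj i (\<psi> j) x) = (\<integral>y. \<psi> j y * h y \<partial>\<mu>)" if j: "j \<in> J" for j
  proof -
    have "(\<integral>y. \<psi> j y * h y \<partial>\<mu>) = (\<Sum>i\<in>F R. \<integral>y. \<psi> j y * (?m i * Z i x y) \<partial>\<mu>)"
      unfolding h_def sum_distrib_left
      by (intro Bochner_Integration.integral_sum L2_mult_integrable L2_mult_left L j Z_L2 x)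
    moreover have "(\<integral>y. \<psi> j y * (?m i * Z i x y) \<partial>\<mu>) = ?m i * proj i (\<psi> j) x" for i
    proof -
      have "(\<integral>y. \<psi> j y * (?m i * Z i x y) \<partial>\<mu>) = (\<integral>y. ?m i * (Z i x y * \<psi> j y) \<partial>\<mu>)"
        by (simp only: ac_simps)
      then show ?thesis by (simp add: proj_def)
    qed
    ultimately show ?thesis by simp
  qed
  have "(\<Sum>j\<in>J. (\<Sum>i\<in>F R. ?m i * proj i (\<psi> j) x)\<^sup>2) \<le> (\<integral>y. (h y)\<^sup>2 \<partial>\<mu>)"
    using Bessel_inequality[OF on J h] c by simp
  also have "\<dots> = (\<integral>y. (\<Sum>i\<in>F R. \<Sum>k\<in>F R. (?m i * Z i x y) * (?m k * Z k x y)) \<partial>\<mu>)"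
    by (simp add: h_def power2_eq_square sum_product)
  also have "\<dots> = (\<Sum>i\<in>F R. \<Sum>k\<in>F R. \<integral>y. (?m i * Z i x y) * (?m k * Z k x y) \<partial>\<mu>)"
    by (subst Bochner_Integration.integral_sum, intro Bochner_Integration.integrable_sum
        L2_mult_integrable L2_mult_left Z_L2 x, assumption+,
        intro sum.cong refl Bochner_Integration.integral_sum
        L2_mult_integrable L2_mult_left Z_L2 x)
  also have "\<dots> = (\<Sum>i\<in>F R. \<Sum>k\<in>F R. if i = k then (?m i)\<^sup>2 * Z i x x else 0)"
  proof (intro sum.cong refl)
    fix i k assume i: "i \<in> F R" and k: "k \<in> F R"
    have "(\<integral>y. (?m i * Z i x y) * (?m k * Z k x y) \<partial>\<mu>) = (\<integral>y. (?m i * ?m k) * (Z i x y * Z k x y) \<partial>\<mu>)"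
      by (simp add: ac_simps)
    then show "(\<integral>y. (?m i * Z i x y) * (?m k * Z k x y) \<partial>\<mu>) = (if i = k then (?m i)\<^sup>2 * Z i x x else 0)"
      using reproducing'[OF i k x x] by (simp add: power2_eq_square)
  qed
  also have "\<dots> = (\<Sum>i\<in>F R. (?m i)\<^sup>2 * Z i x x)" using finite_modes by simp
  also have "\<dots> = ((\<Sum>i\<in>F R. exp (- (2 * t) * lam i) * Z i x x)
      + 2 * (\<Sum>i\<in>F R. exp (- (4 * t) * lam i) * Z i x x)
      + (\<Sum>i\<in>F R. exp (- (6 * t) * lam i) * Z i x x)) / 4"
  proof -
    have "(heat_cutoff t l)\<^sup>2 = (exp (- (2 * t) * l) + 2 * exp (- (4 * t) * l) + exp (- (6 * t) * l)) / 4" for l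
      unfolding heat_cutoff_def
      by (simp add: power2_eq_square field_simps exp_add [symmetric])
    then show ?thesis
      by (simp add: sum.distrib [symmetric] sum_distrib_left sum_divide_distrib algebra_simps
          add_divide_distrib)
  qed
  also have "\<dots> \<le> (B / (4 * pi * (2 * t)) + 2 * (B / (4 * pi * (4 * t))) + B / (4 * pi * (6 * t))) / 4"
    using trace[OF x, of "2 * t" R] trace[OF x, of "4 * t" R] trace[OF x, of "6 * t" R] t
    by (intro divide_right_mono add_mono mult_left_mono) auto
  also have "\<dots> = 7 * B / (96 * pi) / t" using t by (simp add: field_simps)
  finally show ?thesis .
qed

definition energy_density :: "nat \<Rightarrow> 'j set \<Rightarrow> ('j \<Rightarrow> 'a \<Rightarrow> real) \<Rightarrow> 'a \<Rightarrow> real" where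
  "energy_density R J \<psi> x = (\<Sum>j\<in>J. heat_energy (F R) lam (\<lambda>i. proj i (\<psi> j) x) 0)"

text \<open>Minkowski's inequality over \<open>j\<close> combines the low and the high energies; the time is then
  chosen depending on the point.\<close>

lemma energy_density_bound:
  assumes on: "L2_orthonormal \<mu> J \<psi>" and J: "finite J" and x: "x \<in> space \<mu>"
  shows "(\<Sum>j\<in>J. (trunc R (\<psi> j) x)\<^sup>2)\<^sup>2 \<le> 7 * B / (4 * pi) * energy_density R J \<psi> x"
proof -
  let ?r = "\<Sum>j\<in>J. (trunc R (\<psi> j) x)\<^sup>2" and ?K = "energy_density R J \<psi> x"
  have K: "0 \<le> ?K"
    unfolding energy_density_def by (intro sum_nonneg heat_energy_nonneg lam_pos)
  have "?r\<^sup>2 \<le> 24 * (7 * B / (96 * pi)) * ?K"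
  proof (rule square_le_of_all_times[OF _ _ K])
    fix t :: real assume t: "0 < t"
    define low where "low j = (\<Sum>i\<in>F R. heat_cutoff t (lam i) * proj i (\<psi> j) x)" for j
    define high where "high j = trunc R (\<psi> j) x - low j" for j
    have "sqrt ?r = L2_set (\<lambda>j. low j + high j) J" by (simp add: L2_set_def high_def)
    also have "\<dots> \<le> L2_set low J + L2_set high J" by (rule L2_set_triangle_ineq)
    also have "L2_set low J \<le> sqrt (7 * B / (96 * pi) / t)"
      unfolding L2_set_def low_def by (rule real_sqrt_le_mono[OF low_energy_part[OF on J x t]])
    also have "L2_set high J \<le> sqrt (3/2 * t * ?K)"
      unfolding L2_set_def energy_density_def sum_distrib_left high_def low_def trunc_def
      by (intro real_sqrt_le_mono sum_mono high_energy_part lam_pos t)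
    finally show "sqrt ?r \<le> sqrt (7 * B / (96 * pi) / t) + sqrt (3/2 * t * ?K)" by simp
  qed (use B_pos in \<open>auto intro!: sum_nonneg\<close>)
  then show ?thesis by simp
qed

text \<open>Only the diagonal terms of the energy survive integration, by orthogonality of the spectral
  components, and there \<open>\<lambda>\<^sub>i \<lambda>\<^sub>k / (\<lambda>\<^sub>i + \<lambda>\<^sub>k)\<close> is \<open>\<lambda>\<^sub>i / 2\<close>.\<close>

lemma integral_energy_density:
  assumes L: "\<And>j. j \<in> J \<Longrightarrow> \<psi> j \<in> L2 \<mu>"
  shows "integrable \<mu> (energy_density R J \<psi>)"
    and "(\<integral>x. energy_density R J \<psi> x \<partial>\<mu>)
      = (\<Sum>j\<in>J. \<Sum>i\<in>F R. lam i * (\<integral>x. \<psi> j x * proj i (\<psi> j) x \<partial>\<mu>)) / 2"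
proof -
  let ?c = "\<lambda>i k. lam i * lam k / (lam i + lam k)"
  have e: "energy_density R J \<psi> x
      = (\<Sum>j\<in>J. \<Sum>i\<in>F R. \<Sum>k\<in>F R. ?c i k * (proj i (\<psi> j) x * proj k (\<psi> j) x))" for x
    unfolding energy_density_def heat_energy_def by (simp add: ac_simps)
  have int: "integrable \<mu> (\<lambda>x. ?c i k * (proj i (\<psi> j) x * proj k (\<psi> j) x))"
    if "j \<in> J" "i \<in> F R" "k \<in> F R" for i j k
    by (intro Bochner_Integration.integrable_mult_right L2_mult_integrable proj_L2[where R = R] that L)
  show "integrable \<mu> (energy_density R J \<psi>)"
    unfolding e [abs_def] by (intro Bochner_Integration.integrable_sum int)
  have "(\<integral>x. energy_density R J \<psi> x \<partial>\<mu>)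
      = (\<Sum>j\<in>J. \<integral>x. (\<Sum>i\<in>F R. \<Sum>k\<in>F R. ?c i k * (proj i (\<psi> j) x * proj k (\<psi> j) x)) \<partial>\<mu>)"
    unfolding e
    by (intro Bochner_Integration.integral_sum Bochner_Integration.integrable_sum int)
  also have "\<dots> = (\<Sum>j\<in>J. \<Sum>i\<in>F R. \<integral>x. (\<Sum>k\<in>F R. ?c i k * (proj i (\<psi> j) x * proj k (\<psi> j) x)) \<partial>\<mu>)"
    by (intro sum.cong refl Bochner_Integration.integral_sum Bochner_Integration.integrable_sum int)
  also have "\<dots> = (\<Sum>j\<in>J. \<Sum>i\<in>F R. \<Sum>k\<in>F R. \<integral>x. ?c i k * (proj i (\<psi> j) x * proj k (\<psi> j) x) \<partial>\<mu>)"
    by (intro sum.cong refl Bochner_Integration.integral_sum int)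
  also have "\<dots> = (\<Sum>j\<in>J. \<Sum>i\<in>F R. \<Sum>k\<in>F R. if i = k then
      lam i / 2 * (\<integral>x. \<psi> j x * proj i (\<psi> j) x \<partial>\<mu>) else 0)"
    by (intro sum.cong refl) (use lam_pos in \<open>force simp: proj_orthogonal[OF _ _ L L]\<close>)
  also have "\<dots> = (\<Sum>j\<in>J. \<Sum>i\<in>F R. lam i * (\<integral>x. \<psi> j x * proj i (\<psi> j) x \<partial>\<mu>)) / 2"
    using finite_modes by (simp add: sum_divide_distrib)
  finally show "(\<integral>x. energy_density R J \<psi> x \<partial>\<mu>)
      = (\<Sum>j\<in>J. \<Sum>i\<in>F R. lam i * (\<integral>x. \<psi> j x * proj i (\<psi> j) x \<partial>\<mu>)) / 2" .
qed

text \<open>The truncated densities satisfy the bound uniformly in \<open>R\<close>.  Along a subsequence they converge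
  almost everywhere, so Fatou's lemma applies; it also yields the integrability.\<close>

theorem lieb_thirring:
  assumes on: "L2_orthonormal \<mu> J \<psi>" and J: "finite J" and H: "\<And>j. j \<in> J \<Longrightarrow> \<psi> j \<in> H1_dot M"
  shows "integrable \<mu> (\<lambda>x. (\<Sum>j\<in>J. (\<psi> j x)\<^sup>2)\<^sup>2)"
    and "(\<integral>x. (\<Sum>j\<in>J. (\<psi> j x)\<^sup>2)\<^sup>2 \<partial>\<mu>) \<le> 7 * B / (8 * pi) * (\<Sum>j\<in>J. (L2_norm \<mu> (H1_grad M (\<psi> j)))\<^sup>2)"
proof -
  let ?E = "\<Sum>j\<in>J. (L2_norm \<mu> (H1_grad M (\<psi> j)))\<^sup>2"
  define C where "C = 7 * B / (8 * pi) * ?E"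
  have C: "0 \<le> C" using B_pos by (simp add: C_def sum_nonneg)
  have L: "\<psi> j \<in> L2 \<mu>" if "j \<in> J" for j using on that by (auto simp: L2_orthonormal_def)
  note [measurable] = L2_borel[OF L] L2_borel[OF trunc_L2[OF L]]
  have g: "has_H1_gradient M (\<psi> j) (H1_grad M (\<psi> j))" if "j \<in> J" for j
  proof -
    have "\<exists>g. has_H1_gradient M (\<psi> j) g" using H[OF that] by (simp add: H1_dot_def H1_def)
    then show ?thesis unfolding H1_grad_def by (rule someI_ex)
  qed
  have mean: "(\<integral>x. \<psi> j x \<partial>\<mu>) = 0" if "j \<in> J" for j
    using H[OF that] by (simp add: H1_dot_def)
  define \<rho> where "\<rho> x = (\<Sum>j\<in>J. (\<psi> j x)\<^sup>2)" for x
  define \<rho>' where "\<rho>' R x = (\<Sum>j\<in>J. (trunc R (\<psi> j) x)\<^sup>2)" for R x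
  have [measurable]: "\<rho> \<in> borel_measurable \<mu>" "\<rho>' R \<in> borel_measurable \<mu>" for R
    unfolding \<rho>_def [abs_def] \<rho>'_def [abs_def] by measurable
  have bd: "(\<integral>\<^sup>+x. ennreal ((\<rho>' R x)\<^sup>2) \<partial>\<mu>) \<le> ennreal C" for R
  proof -
    have "(\<integral>\<^sup>+x. ennreal ((\<rho>' R x)\<^sup>2) \<partial>\<mu>)
        \<le> (\<integral>\<^sup>+x. ennreal (7 * B / (4 * pi) * energy_density R J \<psi> x) \<partial>\<mu>)"
      unfolding \<rho>'_def by (intro nn_integral_mono ennreal_leI energy_density_bound[OF on J])
    also have "\<dots> = ennreal (\<integral>x. 7 * B / (4 * pi) * energy_density R J \<psi> x \<partial>\<mu>)"
    proof (rule nn_integral_eq_integral)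
      show "integrable \<mu> (\<lambda>x. 7 * B / (4 * pi) * energy_density R J \<psi> x)"
        by (intro Bochner_Integration.integrable_mult_right integral_energy_density(1) L)
      show "AE x in \<mu>. 0 \<le> 7 * B / (4 * pi) * energy_density R J \<psi> x"
        using B_pos unfolding energy_density_def
        by (intro AE_I2 mult_nonneg_nonneg sum_nonneg heat_energy_nonneg lam_pos) auto
    qed
    also have "(\<integral>x. 7 * B / (4 * pi) * energy_density R J \<psi> x \<partial>\<mu>) = 7 * B / (8 * pi) *
        (\<Sum>j\<in>J. \<Sum>i\<in>F R. lam i * (\<integral>x. \<psi> j x * proj i (\<psi> j) x \<partial>\<mu>))"
      using integral_energy_density(2)[of J \<psi> R, OF L] by (simp add: field_simps)
    also have "\<dots> \<le> C"
      unfolding C_def using B_pos by (intro mult_left_mono sum_mono spectral_energy_le g) auto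
    finally show ?thesis by (simp add: ennreal_leI)
  qed
  define e where "e R x = (\<Sum>j\<in>J. (\<psi> j x - trunc R (\<psi> j) x)\<^sup>2)" for R x
  have int_e: "integrable \<mu> (\<lambda>x. (\<psi> j x - trunc R (\<psi> j) x)\<^sup>2)" if "j \<in> J" for j R
    using L2_diff[OF L trunc_L2[OF L], OF that that] by (simp add: L2_def)
  have "(\<lambda>R. \<Sum>j\<in>J. \<integral>x. (\<psi> j x - trunc R (\<psi> j) x)\<^sup>2 \<partial>\<mu>) \<longlonglongrightarrow> 0"
    by (intro tendsto_null_sum trunc_tendsto[OF g mean])
  moreover have "(\<integral>x. norm (e R x) \<partial>\<mu>) = (\<Sum>j\<in>J. \<integral>x. (\<psi> j x - trunc R (\<psi> j) x)\<^sup>2 \<partial>\<mu>)" for R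
  proof -
    have "(\<integral>x. norm (e R x) \<partial>\<mu>) = (\<integral>x. e R x \<partial>\<mu>)" by (simp add: e_def sum_nonneg)
    then show ?thesis unfolding e_def using int_e by simp
  qed
  ultimately have "(\<lambda>R. \<integral>x. norm (e R x) \<partial>\<mu>) \<longlonglongrightarrow> 0" by simp
  moreover have "integrable \<mu> (e R)" for R unfolding e_def [abs_def] using int_e by simp
  ultimately obtain s where s: "AE x in \<mu>. (\<lambda>n. e (s n) x) \<longlonglongrightarrow> 0"
    using tendsto_L1_AE_subseq[of \<mu> e] by blast
  have lim: "AE x in \<mu>. (\<lambda>n. \<rho>' (s n) x) \<longlonglongrightarrow> \<rho> x"
    using s
  proof eventually_elim
    case (elim x)
    have "(\<lambda>n. trunc (s n) (\<psi> j) x) \<longlonglongrightarrow> \<psi> j x" if j: "j \<in> J" for j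
    proof -
      have "(\<lambda>n. (\<psi> j x - trunc (s n) (\<psi> j) x)\<^sup>2) \<longlonglongrightarrow> 0"
      proof (rule tendsto_sandwich[OF _ _ tendsto_const elim])
        show "\<forall>\<^sub>F n in sequentially. (\<psi> j x - trunc (s n) (\<psi> j) x)\<^sup>2 \<le> e (s n) x"
          unfolding e_def by (intro always_eventually allI member_le_sum) (use j J in auto)
      qed simp
      from tendsto_real_sqrt[OF this] have "(\<lambda>n. \<bar>\<psi> j x - trunc (s n) (\<psi> j) x\<bar>) \<longlonglongrightarrow> 0" by simp
      then have "(\<lambda>n. \<psi> j x - trunc (s n) (\<psi> j) x) \<longlonglongrightarrow> 0" by (rule tendsto_rabs_zero_cancel)
      from tendsto_diff[OF tendsto_const[of "\<psi> j x"] this] show ?thesis by simp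
    qed
    then show ?case unfolding \<rho>_def \<rho>'_def by (intro tendsto_sum tendsto_power)
  qed
  have "(\<integral>\<^sup>+x. ennreal ((\<rho> x)\<^sup>2) \<partial>\<mu>) = (\<integral>\<^sup>+x. liminf (\<lambda>n. ennreal ((\<rho>' (s n) x)\<^sup>2)) \<partial>\<mu>)"
  proof (rule nn_integral_cong_AE)
    show "AE x in \<mu>. ennreal ((\<rho> x)\<^sup>2) = liminf (\<lambda>n. ennreal ((\<rho>' (s n) x)\<^sup>2))"
      using lim
    proof eventually_elim
      case (elim x)
      have "(\<lambda>n. ennreal ((\<rho>' (s n) x)\<^sup>2)) \<longlonglongrightarrow> ennreal ((\<rho> x)\<^sup>2)"
        by (intro tendsto_ennrealI tendsto_power elim)
      then show ?case by (intro lim_imp_Liminf[symmetric]) auto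
    qed
  qed
  also have "\<dots> \<le> liminf (\<lambda>n. \<integral>\<^sup>+x. ennreal ((\<rho>' (s n) x)\<^sup>2) \<partial>\<mu>)"
    by (intro nn_integral_liminf) measurable
  also have "\<dots> \<le> ennreal C"
    using bd by (intro Liminf_le) auto
  finally have fin: "(\<integral>\<^sup>+x. ennreal ((\<rho> x)\<^sup>2) \<partial>\<mu>) \<le> ennreal C" .
  show int: "integrable \<mu> (\<lambda>x. (\<Sum>j\<in>J. (\<psi> j x)\<^sup>2)\<^sup>2)"
    unfolding \<rho>_def [symmetric]
    by (rule integrableI_nonneg) (use fin in \<open>auto simp: less_top[symmetric] top_unique\<close>)
  have "ennreal (\<integral>x. (\<rho> x)\<^sup>2 \<partial>\<mu>) \<le> ennreal C"
    using fin int by (subst nn_integral_eq_integral[symmetric]) (auto simp: \<rho>_def)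
  then show "(\<integral>x. (\<Sum>j\<in>J. (\<psi> j x)\<^sup>2)\<^sup>2 \<partial>\<mu>) \<le> 7 * B / (8 * pi) * ?E"
    using C by (simp add: \<rho>_def C_def)
qed

end

section \<open>Integration by parts on rectangles\<close>

lemma rectangle_integrable:
  fixes h :: "real \<times> real \<Rightarrow> real"
  assumes cont: "continuous_on UNIV h"
  shows "integrable lborel (\<lambda>p. indicator ({a..b} \<times> {c..d}) p * h p)"
proof -
  have "integrable lborel (\<lambda>p. indicator ({a..b} \<times> {c..d}) p *\<^sub>R h p)"
    by (rule borel_integrable_compact) (auto intro: compact_Times continuous_on_subset[OF cont])
  then show ?thesis by simp
qed

lemma rectangle_derivative_fst:
  fixes h H :: "real \<times> real \<Rightarrow> real"
  assumes ab: "a \<le> b" and cont: "continuous_on UNIV h"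
    and deriv: "\<And>x y. ((\<lambda>x. H (x, y)) has_real_derivative h (x, y)) (at x)"
    and eq: "\<And>y. H (b, y) = H (a, y)"
  shows "(\<integral>p. indicator ({a..b} \<times> {c..d}) p * h p \<partial>lborel) = 0"
proof -
  have c: "isCont (\<lambda>x. h (x, y)) x" for x y
    using continuous_on_compose2[OF cont, of UNIV "\<lambda>x. (x, y)"]
    by (simp add: continuous_on_eq_continuous_at continuous_intros)
  have int: "integrable (lborel \<Otimes>\<^sub>M lborel) (\<lambda>(x, y). indicator ({a..b} \<times> {c..d}) (x, y) * h (x, y))"
  proof -
    have "(\<lambda>(x, y). indicator ({a..b} \<times> {c..d}) (x, y) * h (x, y))
        = (\<lambda>p. indicator ({a..b} \<times> {c..d}) p * h p)" by auto
    then show ?thesis using rectangle_integrable[OF cont, of a b c d] by (simp only: lborel_prod)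
  qed
  have "(\<integral>p. indicator ({a..b} \<times> {c..d}) p * h p \<partial>lborel)
      = integral\<^sup>L (lborel \<Otimes>\<^sub>M lborel) (\<lambda>(x, y). indicator ({a..b} \<times> {c..d}) (x, y) * h (x, y))"
    unfolding lborel_prod by (rule Bochner_Integration.integral_cong) auto
  also have "\<dots> = (\<integral>y. (\<integral>x. indicator ({a..b} \<times> {c..d}) (x, y) * h (x, y) \<partial>lborel) \<partial>lborel)"
    by (rule lborel_pair.integral_snd[OF int, symmetric])
  also have "\<dots> = (\<integral>y. 0 \<partial>(lborel :: real measure))"
  proof (rule Bochner_Integration.integral_cong[OF refl])
    fix y
    have "(\<integral>x. indicator ({a..b} \<times> {c..d}) (x, y) * h (x, y) \<partial>lborel)
        = (\<integral>x. indicator {c..d} y * (h (x, y) * indicator {a..b} x) \<partial>lborel)"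
      by (rule Bochner_Integration.integral_cong) (auto simp: indicator_times)
    also have "\<dots> = indicator {c..d} y * (\<integral>x. h (x, y) * indicator {a..b} x \<partial>lborel)"
      by simp
    also have "(\<integral>x. h (x, y) * indicator {a..b} x \<partial>lborel) = H (b, y) - H (a, y)"
      by (rule integral_FTC_Icc_real) (use ab deriv c in auto)
    finally show "(\<integral>x. indicator ({a..b} \<times> {c..d}) (x, y) * h (x, y) \<partial>lborel) = 0"
      using eq by simp
  qed
  finally show ?thesis by simp
qed

lemma rectangle_derivative_snd:
  fixes h H :: "real \<times> real \<Rightarrow> real"
  assumes cd: "c \<le> d" and cont: "continuous_on UNIV h"
    and deriv: "\<And>x y. ((\<lambda>y. H (x, y)) has_real_derivative h (x, y)) (at y)"
    and eq: "\<And>x. H (x, d) = H (x, c)"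
  shows "(\<integral>p. indicator ({a..b} \<times> {c..d}) p * h p \<partial>lborel) = 0"
proof -
  let ?f = "\<lambda>p. indicator ({a..b} \<times> {c..d}) p * h p"
  have "continuous_on UNIV (\<lambda>p :: real \<times> real. (snd p, fst p))" by (intro continuous_intros)
  then have cont': "continuous_on UNIV (\<lambda>p. h (snd p, fst p))"
    by (rule continuous_on_compose2[OF cont]) simp
  have "integrable (lborel \<Otimes>\<^sub>M lborel) ?f"
    unfolding lborel_prod by (rule rectangle_integrable[OF cont])
  then have "(\<integral>p. ?f p \<partial>lborel) = (\<integral>(y, x). ?f (x, y) \<partial>(lborel \<Otimes>\<^sub>M lborel))"
    unfolding lborel_prod[symmetric] by (intro lborel_pair.integral_product_swap[symmetric]) simp
  also have "\<dots> = (\<integral>p. indicator ({c..d} \<times> {a..b}) p * h (snd p, fst p) \<partial>lborel)"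
    unfolding lborel_prod by (rule Bochner_Integration.integral_cong) (auto simp: indicator_def)
  also have "\<dots> = 0"
    by (rule rectangle_derivative_fst[where H = "\<lambda>p. H (snd p, fst p)"])
      (use cd deriv eq cont' in auto)
  finally show ?thesis .
qed

section \<open>Smooth functions\<close>

lemma gderiv_unique:
  assumes "GDERIV f x :> D" "GDERIV f x :> E"
  shows "D = E"
proof -
  have "(\<lambda>h. h \<bullet> D) = (\<lambda>h. h \<bullet> E)"
    using assms unfolding gderiv_def by (rule has_derivative_unique)
  then have "(D - E) \<bullet> D = (D - E) \<bullet> E" by metis
  then have "(D - E) \<bullet> (D - E) = 0" by (simp add: inner_diff_right)
  then show ?thesis by simp
qed

lemma smooth_on_gradient:
  fixes f :: "'a::euclidean_space \<Rightarrow> real"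
  assumes "smooth_on U f"
  obtains \<Gamma> where "\<And>x. x \<in> U \<Longrightarrow> GDERIV f x :> \<Gamma> x" "continuous_on U \<Gamma>"
proof -
  have "Ck_on (Suc 0) U f" using assms by (simp only: smooth_on_def)
  then obtain G where G: "\<forall>x\<in>U. GDERIV f x :> G x" "\<forall>b\<in>Basis. continuous_on U (\<lambda>x. G x \<bullet> b)"
    by auto
  have "continuous_on U (\<lambda>x. \<Sum>b\<in>Basis. (G x \<bullet> b) *\<^sub>R b)"
    using G(2) by (intro continuous_on_sum continuous_on_scaleR continuous_on_const) auto
  then have "continuous_on U G" by (simp add: euclidean_representation)
  with G that show ?thesis by blast
qed

lemma smooth_on_continuous:
  assumes "smooth_on U f"
  shows "continuous_on U f"
proof -
  have "Ck_on 0 U f" using assms by (simp only: smooth_on_def)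
  then show ?thesis by simp
qed

text \<open>The gradient of \<open>p (w \<bullet> y)\<close> has the components \<open>p' (w \<bullet> y) \<cdot> (w \<bullet> b)\<close>, which are again
  functions in the class \<open>P\<close> composed with the linear form; so all derivatives exist by induction.
  The class will be that of polynomials, or of combinations of sine and cosine.\<close>

lemma smooth_on_ridge:
  fixes w :: "'a::euclidean_space"
  assumes P: "P p" and closed: "\<And>p c. P p \<Longrightarrow> \<exists>p'. P p' \<and> P (\<lambda>s. p' s * c) \<and> (\<forall>s. (p has_real_derivative p' s) (at s))"
  shows "smooth_on UNIV (\<lambda>y. p (w \<bullet> y))"
proof -
  have "Ck_on n UNIV (\<lambda>y. p (w \<bullet> y))" for n
    using P
  proof (induction n arbitrary: p)
    case 0
    obtain p' where "\<And>s. (p has_real_derivative p' s) (at s)" using closed[OF 0] by blast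
    then have "continuous_on UNIV p"
      by (auto simp: continuous_on_eq_continuous_at intro: DERIV_isCont)
    then have "continuous_on UNIV (\<lambda>y. p (w \<bullet> y))"
      by (rule continuous_on_compose2) (auto intro!: continuous_intros)
    then show ?case by simp
  next
    case (Suc n)
    obtain p' where p': "\<And>s. (p has_real_derivative p' s) (at s)"
      using closed[OF Suc.prems] by blast
    have "GDERIV (\<lambda>y. p (w \<bullet> y)) y :> p' (w \<bullet> y) *\<^sub>R w" for y
    proof (rule GDERIV_DERIV_compose[OF _ p'])
      show "GDERIV (\<lambda>y. w \<bullet> y) y :> w"
        unfolding gderiv_def by (auto intro!: derivative_eq_intros simp: inner_commute)
    qed
    moreover have "Ck_on n UNIV (\<lambda>y. (p' (w \<bullet> y) *\<^sub>R w) \<bullet> b)" for b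
    proof -
      obtain q where "\<And>s. (p has_real_derivative q s) (at s)" "P (\<lambda>s. q s * (w \<bullet> b))"
        using closed[OF Suc.prems, of "w \<bullet> b"] by blast
      moreover from this(1) p' have "q = p'" by (auto intro: DERIV_unique)
      ultimately show ?thesis using Suc.IH[of "\<lambda>s. p' s * (w \<bullet> b)"] by simp
    qed
    ultimately show ?case by (auto intro!: exI[of _ "\<lambda>y. p' (w \<bullet> y) *\<^sub>R w"])
  qed
  then show ?thesis by (simp add: smooth_on_def)
qed

lemma continuous_on_componentwise_vec:
  fixes f :: "'a::topological_space \<Rightarrow> 'b::topological_space ^ 'n"
  assumes "\<And>i. continuous_on S (\<lambda>x. f x $ i)"
  shows "continuous_on S f"
  using continuous_on_vec_lambda[of S "\<lambda>i x. f x $ i", OF assms] by simp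

section \<open>Gaussian sums over the square lattice\<close>

definition gauss_sum :: "nat \<Rightarrow> real \<Rightarrow> real" where
  "gauss_sum R c = (\<Sum>k\<in>{- int R..int R}. exp (- c * (of_int k)\<^sup>2))"

lemma gauss_sum_nonneg: "0 \<le> gauss_sum R c"
  unfolding gauss_sum_def by (intro sum_nonneg) auto

lemma gauss_sum_square:
  "(gauss_sum R c)\<^sup>2 = (\<Sum>(k, l)\<in>{- int R..int R} \<times> {- int R..int R}.
      exp (- c * ((of_int k)\<^sup>2 + (of_int l)\<^sup>2)))"
  unfolding gauss_sum_def power2_eq_square sum_product sum.cartesian_product
  by (intro sum.cong refl) (auto simp: exp_add [symmetric] algebra_simps)

text \<open>Since \<open>(\<Sum> (-1)\<^sup>k e\<^sup>-\<^sup>c\<^sup>k\<^sup>2)\<^sup>2 \<ge> 0\<close>, at most half of the square of the Gaussian sum comes from the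
  points \<open>(k, l)\<close> of the lattice with \<open>k + l\<close> odd.  The others are the points \<open>(a + b, a - b)\<close>,
  with \<open>(a + b)\<^sup>2 + (a - b)\<^sup>2 = 2 (a\<^sup>2 + b\<^sup>2)\<close>: the same lattice at twice the parameter.  Both steps
  respect the truncation to a square.\<close>

lemma gauss_sum_double: "(gauss_sum R c)\<^sup>2 \<le> 2 * (gauss_sum R (2 * c))\<^sup>2"
proof -
  define Q where "Q = {- int R..int R} \<times> {- int R..int R}"
  define E where "E = {p \<in> Q. even (fst p + snd p)}"
  define g where "g c = (\<lambda>(k, l). exp (- c * ((of_int k)\<^sup>2 + (of_int l)\<^sup>2)))" for c :: real
  have fin: "finite Q" by (simp add: Q_def)
  have split: "sum f Q = sum f E + sum f (Q - E)" for f :: "int \<times> int \<Rightarrow> real"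
    using fin by (subst sum.subset_diff[of E Q]) (auto simp: E_def)
  have sg: "(gauss_sum R c)\<^sup>2 = sum (g c) Q" for c
    by (simp add: gauss_sum_square g_def Q_def)
  define s where "s k = (if even k then 1 else - 1 :: real)" for k :: int
  have "0 \<le> (\<Sum>k\<in>{- int R..int R}. s k * exp (- c * (of_int k)\<^sup>2))\<^sup>2" by simp
  also have "\<dots> = (\<Sum>p\<in>Q. s (fst p + snd p) * g c p)"
    unfolding power2_eq_square sum_product sum.cartesian_product Q_def
    by (intro sum.cong refl) (auto simp: s_def g_def exp_add [symmetric] power2_eq_square algebra_simps)
  also have "\<dots> = sum (g c) E - sum (g c) (Q - E)"
    unfolding split by (simp add: E_def s_def sum_negf [symmetric] flip: diff_conv_add_uminus)
  finally have "sum (g c) (Q - E) \<le> sum (g c) E" by simp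
  moreover have "sum (g c) E \<le> sum (g (2 * c)) Q"
  proof -
    define h where "h = (\<lambda>(a, b). (a + b, a - b :: int))"
    have inj: "inj_on h Q" by (auto simp: h_def inj_on_def)
    have "E \<subseteq> h ` Q"
    proof
      fix p assume p: "p \<in> E"
      then obtain k l where [simp]: "p = (k, l)" and "- int R \<le> k" "k \<le> int R" "- int R \<le> l" "l \<le> int R" "even (k + l)"
        by (cases p) (auto simp: E_def Q_def)
      then have "h ((k + l) div 2, (k - l) div 2) = p" "((k + l) div 2, (k - l) div 2) \<in> Q"
        by (auto simp: h_def Q_def) presburger+
      then show "p \<in> h ` Q" by (metis imageI)
    qed
    then have "sum (g c) E \<le> sum (g c) (h ` Q)"
      using fin by (intro sum_mono2) (auto simp: g_def)
    also have "\<dots> = (\<Sum>p\<in>Q. g c (h p))" by (simp add: sum.reindex[OF inj])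
    also have "\<dots> = sum (g (2 * c)) Q"
      by (intro sum.cong refl) (auto simp: g_def h_def power2_eq_square algebra_simps)
    finally show ?thesis .
  qed
  ultimately show ?thesis unfolding sg split[of "g c"] by linarith
qed

lemma gauss_sum_eq: "gauss_sum R c = 1 + 2 * (\<Sum>n=1..R. exp (- c * (real n)\<^sup>2))"
proof -
  have "{- int R..int R} = insert 0 (int ` {1..R} \<union> (\<lambda>n. - int n) ` {1..R})"
  proof (intro set_eqI iffI)
    fix k assume "k \<in> {- int R..int R}"
    then show "k \<in> insert 0 (int ` {1..R} \<union> (\<lambda>n. - int n) ` {1..R})"
    proof (cases "0 \<le> k")
      case True
      then show ?thesis using \<open>k \<in> _\<close> by (cases "k = 0") (auto intro!: image_eqI[of _ int "nat k"])
    next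
      case False
      then have "k \<in> (\<lambda>n. - int n) ` {1..R}"
        using \<open>k \<in> _\<close> by (intro image_eqI[of _ _ "nat (- k)"]) auto
      then show ?thesis by blast
    qed
  qed auto
  then have "gauss_sum R c = exp (- c * (of_int 0)\<^sup>2)
      + (\<Sum>k\<in>int ` {1..R} \<union> (\<lambda>n. - int n) ` {1..R}. exp (- c * (of_int k)\<^sup>2))"
    unfolding gauss_sum_def by (simp only:) (subst sum.insert; auto)
  also have "(\<Sum>k\<in>int ` {1..R} \<union> (\<lambda>n. - int n) ` {1..R}. exp (- c * (of_int k)\<^sup>2))
      = (\<Sum>k\<in>int ` {1..R}. exp (- c * (of_int k)\<^sup>2))
      + (\<Sum>k\<in>(\<lambda>n. - int n) ` {1..R}. exp (- c * (of_int k)\<^sup>2))"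
    by (intro sum.union_disjoint) auto
  also have "\<dots> = 2 * (\<Sum>n=1..R. exp (- c * (real n)\<^sup>2))"
    by (simp add: sum.reindex inj_on_def)
  finally show ?thesis by simp
qed

text \<open>From \<open>2.7182 \<le> e\<close>, the first eight terms of the exponential series.\<close>

lemma exp_bounds:
  shows "exp (-1) \<le> (3679/10000 :: real)" "exp (-3/2) \<le> (2232/10000 :: real)"
    "exp (-2) \<le> (1354/10000 :: real)" "exp (-4) \<le> (184/10000 :: real)"
    "exp (-6) \<le> (25/10000 :: real)" "exp (-8) \<le> (4/10000 :: real)" "exp (-5) \<le> (1/102 :: real)"
proof -
  have "(\<Sum>n<8. 1 ^ n /\<^sub>R fact n) \<le> exp (1::real)"
    unfolding exp_def by (rule sum_le_suminf[OF summable_exp_generic]) auto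
  then have e: "27182/10000 \<le> exp (1::real)"
    by (simp add: eval_nat_numeral field_simps)
  have p: "(27182/10000) ^ n \<le> exp (real n)" for n
    using power_mono[OF e, of n] by (simp add: exp_of_nat_mult[of n "1::real", symmetric])
  have inv: "exp (- x) \<le> a" if "1 \<le> a * exp x" for x a :: real
    using that by (simp add: exp_minus field_simps)
  show "exp (-1) \<le> (3679/10000 :: real)" by (rule inv) (use p[of 1] in simp)
  show "exp (-2) \<le> (1354/10000 :: real)" by (rule inv) (use p[of 2] in \<open>simp add: power2_eq_square\<close>)
  show "exp (-4) \<le> (184/10000 :: real)" by (rule inv) (use p[of 4] in \<open>simp add: eval_nat_numeral\<close>)
  show "exp (-5) \<le> (1/102 :: real)" by (rule inv) (use p[of 5] in \<open>simp add: eval_nat_numeral\<close>)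
  show "exp (-6) \<le> (25/10000 :: real)" by (rule inv) (use p[of 6] in \<open>simp add: eval_nat_numeral\<close>)
  show "exp (-8) \<le> (4/10000 :: real)" by (rule inv) (use p[of 8] in \<open>simp add: eval_nat_numeral\<close>)
  have "(exp (3/2 :: real))\<^sup>2 = exp 3" by (simp add: power2_eq_square exp_add [symmetric])
  then have "(10000/2232)\<^sup>2 \<le> (exp (3/2 :: real))\<^sup>2"
    using p[of 3] by (simp add: eval_nat_numeral)
  then have "10000/2232 \<le> exp (3/2 :: real)" by (rule power2_le_imp_le) simp
  then show "exp (-3/2) \<le> (2232/10000 :: real)" using inv[of "2232/10000" "3/2"] by simp
qed

text \<open>From the second term on the exponents grow at least by \<open>5c\<close> per step, so a geometric series with
  ratio at most \<open>e\<^sup>-\<^sup>5\<close> dominates the tail.\<close>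

lemma gauss_sum_le:
  assumes c: "1 \<le> c"
  shows "gauss_sum R c \<le> 1 + 2 * exp (- c) + 202/100 * exp (- 4 * c)"
proof -
  define q where "q = exp (- 5 * c)"
  have q: "0 < q" "q \<le> 1/102"
  proof -
    have "exp (- 5 * c) \<le> exp (-5)" using c by simp
    then show "q \<le> 1/102" using exp_bounds(7) unfolding q_def by linarith
  qed (simp add: q_def)
  have "(\<Sum>n=1..R. exp (- c * (real n)\<^sup>2)) \<le> exp (- c) + exp (- 4 * c) * (\<Sum>n<R. q ^ n)"
  proof (cases R)
    case (Suc m)
    have "(\<Sum>n=1..R. exp (- c * (real n)\<^sup>2)) = (\<Sum>n<R. exp (- c * (real (Suc n))\<^sup>2))"
      using Suc by (simp add: sum.atLeast1_atMost_eq)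
    also have "\<dots> = exp (- c) + (\<Sum>n<m. exp (- c * (real (Suc (Suc n)))\<^sup>2))"
      unfolding Suc sum.lessThan_Suc_shift by simp
    also have "(\<Sum>n<m. exp (- c * (real (Suc (Suc n)))\<^sup>2)) \<le> (\<Sum>n<m. exp (- 4 * c) * q ^ n)"
    proof (rule sum_mono)
      fix n
      have "4 + 5 * real n \<le> (real (Suc (Suc n)))\<^sup>2"
        by (cases n) (auto simp: power2_eq_square algebra_simps)
      then have "c * (4 + 5 * real n) \<le> c * (real (Suc (Suc n)))\<^sup>2"
        using c by (intro mult_left_mono) auto
      then have "exp (- c * (real (Suc (Suc n)))\<^sup>2) \<le> exp (- 4 * c + real n * (- 5 * c))"
        by (simp add: algebra_simps)
      also have "\<dots> = exp (- 4 * c) * q ^ n"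
        unfolding exp_add exp_of_nat_mult q_def by simp
      finally show "exp (- c * (real (Suc (Suc n)))\<^sup>2) \<le> exp (- 4 * c) * q ^ n" .
    qed
    also have "(\<Sum>n<m. exp (- 4 * c) * q ^ n) \<le> exp (- 4 * c) * (\<Sum>n<R. q ^ n)"
      using q Suc by (simp add: sum_distrib_left[symmetric])
    finally show ?thesis by simp
  qed simp
  also have "(\<Sum>n<R. q ^ n) \<le> 101/100"
  proof -
    have "(\<Sum>n<R. q ^ n) = (1 - q ^ R) / (1 - q)"
      using q by (subst sum_gp_strict) auto
    also have "\<dots> \<le> 1 / (1 - q)"
      using q by (intro divide_right_mono) auto
    also have "\<dots> \<le> 101/100" using q by (simp add: field_simps)
    finally show ?thesis .
  qed
  finally show ?thesis unfolding gauss_sum_eq by simp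
qed

text \<open>Convexity turns numerical bounds at the ends of an interval into a linear bound inside it.\<close>

lemma exp_chord:
  assumes "a \<le> c" "c \<le> b" "a < b" "0 \<le> n"
    and "exp (- n * a) \<le> u" "exp (- n * b) \<le> v"
  shows "exp (- n * c) \<le> ((b - c) * u + (c - a) * v) / (b - a :: real)"
proof -
  define t where "t = (c - a) / (b - a)"
  have t: "0 \<le> t" "t \<le> 1" using assms by (auto simp: t_def field_simps)
  have c: "c = a + t * (b - a)" using assms by (simp add: t_def)
  have "convex_on UNIV (exp :: real \<Rightarrow> real)" by (rule exp_convex)
  then have "exp ((1 - t) *\<^sub>R (- n * a) + t *\<^sub>R (- n * b)) \<le> (1 - t) * exp (- n * a) + t * exp (- n * b)"
    using t by (intro convex_onD) auto
  also have "\<dots> \<le> (1 - t) * u + t * v"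
    using t assms by (intro add_mono mult_left_mono) auto
  also have "(1 - t) *\<^sub>R (- n * a) + t *\<^sub>R (- n * b) = - n * c"
    unfolding c by (simp add: algebra_simps)
  also have "(1 - t) * u + t * v = ((b - c) * u + (c - a) * v) / (b - a)"
    using assms unfolding t_def by (simp add: divide_simps)
  finally show ?thesis .
qed

text \<open>The maximum of the cubic on the relevant range is at \<open>c = p/(3q)\<close>, a double root of the difference.\<close>

lemma cubic_le:
  fixes c p q :: real
  assumes "0 < q" "3 * q * c \<le> 4 * p"
  shows "c * (p - q * c)\<^sup>2 \<le> 4 * p ^ 3 / (27 * q)"
proof -
  have "4 * p ^ 3 - 27 * q * (c * (p - q * c)\<^sup>2) = (3 * q * c - p)\<^sup>2 * (4 * p - 3 * q * c)"
    by (simp add: power2_eq_square power3_eq_cube algebra_simps)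
  moreover have "0 \<le> (3 * q * c - p)\<^sup>2 * (4 * p - 3 * q * c)" using assms by simp
  ultimately have "27 * q * (c * (p - q * c)\<^sup>2) \<le> 4 * p ^ 3" by simp
  then show ?thesis using assms by (simp add: field_simps)
qed

text \<open>On each half of the interval the chord bounds give \<open>gauss_sum R c \<le> p - q c\<close>, and the maximum of
  \<open>c (p - q c)\<^sup>2\<close> is below \<open>3.29\<close>.  The true supremum is
  at least \<open>\<pi>\<close>, the limit for \<open>c \<rightarrow> 0\<close> of the full sums.\<close>

lemma gauss_sum_middle:
  assumes c: "1 \<le> c" "c \<le> 2"
  shows "c * (gauss_sum R c)\<^sup>2 \<le> 329/100"
proof (cases "c \<le> 3/2")
  case True
  have "exp (- 1 * c) \<le> ((3/2 - c) * (3679/10000) + (c - 1) * (2232/10000)) / (3/2 - 1)"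
    by (rule exp_chord) (use c True exp_bounds in auto)
  moreover have "exp (- 4 * c) \<le> ((3/2 - c) * (184/10000) + (c - 1) * (25/10000)) / (3/2 - 1)"
    by (rule exp_chord) (use c True exp_bounds in auto)
  ultimately have "gauss_sum R c \<le> 24161/10000 - 6430/10000 * c"
    using gauss_sum_le[OF c(1), of R] c True by (simp add: field_simps)
  then have "c * (gauss_sum R c)\<^sup>2 \<le> c * (24161/10000 - 6430/10000 * c)\<^sup>2"
    using c gauss_sum_nonneg[of R c] by (intro mult_left_mono power_mono) auto
  also have "\<dots> \<le> 4 * (24161/10000) ^ 3 / (27 * (6430/10000))"
    by (rule cubic_le) (use c True in auto)
  also have "\<dots> \<le> 329/100" by (simp add: power3_eq_cube)
  finally show ?thesis .
next
  case False
  have "exp (- 1 * c) \<le> ((2 - c) * (2232/10000) + (c - 3/2) * (1354/10000)) / (2 - 3/2)"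
    by (rule exp_chord) (use c False exp_bounds in auto)
  moreover have "exp (- 4 * c) \<le> ((2 - c) * (25/10000) + (c - 3/2) * (4/10000)) / (2 - 3/2)"
    by (rule exp_chord) (use c False exp_bounds in auto)
  ultimately have "gauss_sum R c \<le> 19911/10000 - 3596/10000 * c"
    using gauss_sum_le[OF c(1), of R] c False by (simp add: field_simps)
  then have "c * (gauss_sum R c)\<^sup>2 \<le> c * (19911/10000 - 3596/10000 * c)\<^sup>2"
    using c gauss_sum_nonneg[of R c] by (intro mult_left_mono power_mono) auto
  also have "\<dots> \<le> 4 * (19911/10000) ^ 3 / (27 * (3596/10000))"
    by (rule cubic_le) (use c False in auto)
  also have "\<dots> \<le> 329/100" by (simp add: power3_eq_cube)
  finally show ?thesis .
qed

text \<open>Doubling \<open>c\<close> does not decrease \<open>c \<cdot> (gauss_sum R c)\<^sup>2\<close>; double until \<open>c\<close> lies in \<open>[1, 2]\<close>.\<close>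

lemma gauss_sum_small:
  assumes "0 < c" "c \<le> 2"
  shows "c * (gauss_sum R c)\<^sup>2 \<le> 329/100"
proof -
  obtain n where n: "1 \<le> 2 ^ n * c"
    using real_arch_pow[of 2 "1 / c"] assms(1) by (auto simp: field_simps intro: less_imp_le)
  then show ?thesis using assms
  proof (induction n arbitrary: c)
    case 0
    then show ?case using gauss_sum_middle by simp
  next
    case (Suc n)
    show ?case
    proof (cases "c \<le> 1")
      case True
      have "2 * c * (gauss_sum R (2 * c))\<^sup>2 \<le> 329/100"
        by (rule Suc.IH) (use Suc.prems True in \<open>auto simp: ac_simps\<close>)
      moreover have "c * (gauss_sum R c)\<^sup>2 \<le> c * (2 * (gauss_sum R (2 * c))\<^sup>2)"
        using Suc.prems by (intro mult_left_mono gauss_sum_double) auto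
      ultimately show ?thesis by simp
    qed (use gauss_sum_middle Suc.prems in auto)
  qed
qed

text \<open>For \<open>c \<le> 2\<close> the origin may even be included in the sum.  For \<open>c > 2\<close> it may not, but then the
  sum is exponentially small.\<close>

proposition lattice_gauss_sum_le:
  assumes c: "0 < c"
  shows "(\<Sum>(k, l)\<in>{- int R..int R} \<times> {- int R..int R} - {(0, 0)}.
      exp (- c * ((of_int k)\<^sup>2 + (of_int l)\<^sup>2))) \<le> 21/20 * pi / c"
proof -
  let ?S = "\<Sum>(k, l)\<in>{- int R..int R} \<times> {- int R..int R} - {(0, 0)}.
      exp (- c * ((of_int k)\<^sup>2 + (of_int l)\<^sup>2))"
  have "?S = (gauss_sum R c)\<^sup>2 - 1"
    unfolding gauss_sum_square by (subst sum_diff1) auto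
  moreover have "c * ((gauss_sum R c)\<^sup>2 - 1) \<le> 329/100"
  proof (cases "c \<le> 2")
    case True
    then show ?thesis using gauss_sum_small[OF c True, of R] c by (simp add: right_diff_distrib)
  next
    case False
    define A where "A = gauss_sum R c - 1"
    have "exp (- 4 * c) \<le> exp (- 3) * exp (- c)"
      using False by (simp add: exp_add [symmetric])
    moreover have "exp (- 3) * exp (- c) \<le> exp (- 2) * exp (- c)" by simp
    moreover have "exp (- 2) * exp (- c) \<le> 1354/10000 * exp (- c)"
      using exp_bounds(3) by (intro mult_right_mono) auto
    ultimately have "exp (- 4 * c) \<le> 1354/10000 * exp (- c)" by linarith
    then have A: "A \<le> 23/10 * exp (- c)"
      using gauss_sum_le[of c R] False exp_ge_zero[of "- c"] unfolding A_def by linarith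
    have "exp (- c) \<le> exp (- 2)" using False by simp
    then have A2: "A \<le> 4/10" using A exp_bounds(3) by linarith
    have "2 * c \<le> exp c"
    proof -
      have "c \<le> exp (c - 1)" using exp_ge_add_one_self[of "c - 1"] by simp
      moreover have "exp c = exp 1 * exp (c - 1)" by (simp add: exp_add [symmetric])
      moreover have "2 \<le> exp (1::real)" using exp_ge_add_one_self[of "1::real"] by simp
      ultimately show ?thesis using mult_mono[of 2 "exp 1" c "exp (c - 1)"] c by simp
    qed
    then have ce: "c * exp (- c) \<le> 1/2" by (simp add: exp_minus field_simps)
    have A0: "0 \<le> A" unfolding A_def gauss_sum_eq by (simp add: sum_nonneg)
    have "c * ((gauss_sum R c)\<^sup>2 - 1) = c * A * (2 + A)"
      by (simp add: A_def power2_eq_square algebra_simps)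
    also have "\<dots> \<le> (23/10 * (c * exp (- c))) * (24/10)"
    proof (rule mult_mono)
      show "c * A \<le> 23/10 * (c * exp (- c))" using mult_left_mono[OF A, of c] c by simp
    qed (use A2 A0 c in auto)
    also have "\<dots> \<le> 329/100" using ce by simp
    finally show ?thesis .
  qed
  moreover have "329/100 \<le> 21/20 * pi" using pi_approx by simp
  ultimately have "?S * c \<le> 21/20 * pi" by (simp only: mult.commute)
  then show ?thesis using c by (simp only: pos_le_divide_eq)
qed

section \<open>The flat torus\<close>

lemma continuous_vec2: "continuous_on UNIV (\<lambda>p :: real \<times> real. vector [fst p, snd p] :: real^2)"
proof (rule continuous_on_componentwise_vec)
  fix i :: 2
  show "continuous_on UNIV (\<lambda>p :: real \<times> real. (vector [fst p, snd p] :: real^2) $ i)"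
    using exhaust_2[of i] by (elim disjE) (simp_all add: continuous_on_fst continuous_on_snd continuous_on_id)
qed

text \<open>Fubini's theorem and the fundamental theorem of calculus are applied on \<open>real \<times> real\<close>; this
  identifies its Lebesgue measure with that of \<open>real^2\<close>.\<close>

lemma lborel_vec2:
  "(lborel :: (real^2) measure) = distr lborel borel (\<lambda>p :: real \<times> real. vector [fst p, snd p])"
proof (rule lborel_eqI)
  fix l u :: "real^2"
  assume le: "\<And>b. b \<in> Basis \<Longrightarrow> l \<bullet> b \<le> u \<bullet> b"
  have l: "l $ 1 \<le> u $ 1" "l $ 2 \<le> u $ 2"
    using le[of "axis 1 1"] le[of "axis 2 1"] by (auto simp: inner_axis axis_in_Basis_iff)
  have "(\<lambda>p :: real \<times> real. vector [fst p, snd p]) -` box l u = box (l $ 1, l $ 2) (u $ 1, u $ 2)"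
  proof (intro set_eqI)
    fix p :: "real \<times> real"
    have "p \<in> box (l $ 1, l $ 2) (u $ 1, u $ 2) \<longleftrightarrow> l $ 1 < fst p \<and> fst p < u $ 1 \<and> l $ 2 < snd p \<and> snd p < u $ 2"
      by (cases p) (auto simp: mem_box Basis_prod_def)
    moreover have "vector [fst p, snd p] \<in> box l u \<longleftrightarrow>
        l $ 1 < fst p \<and> fst p < u $ 1 \<and> l $ 2 < snd p \<and> snd p < u $ 2"
      by (simp add: mem_box_cart forall_2 conj_assoc)
    ultimately show "p \<in> (\<lambda>p. vector [fst p, snd p]) -` box l u \<longleftrightarrow> p \<in> box (l $ 1, l $ 2) (u $ 1, u $ 2)"
      by simp
  qed
  then have "emeasure (distr lborel borel (\<lambda>p :: real \<times> real. vector [fst p, snd p])) (box l u)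
      = emeasure lborel (box (l $ 1, l $ 2) (u $ 1, u $ 2))"
    by (subst emeasure_distr) (auto intro: borel_measurable_continuous_onI continuous_vec2)
  also have "\<dots> = ennreal ((u $ 1 - l $ 1) * (u $ 2 - l $ 2))"
    using l by (subst emeasure_lborel_box) (auto simp: Basis_prod_def prod.union_disjoint algebra_simps)
  also have "(u $ 1 - l $ 1) * (u $ 2 - l $ 2) = (\<Prod>b\<in>Basis. (u - l) \<bullet> b)"
  proof -
    have B: "(Basis :: (real^2) set) = {axis 1 1, axis 2 1}"
      by (auto simp: Basis_vec_def UNIV_2)
    moreover have "(axis 1 1 :: real^2) \<noteq> axis 2 1" by (simp add: axis_eq_axis)
    ultimately show ?thesis
      unfolding B by (subst prod.insert) (auto simp: inner_axis)
  qed
  finally show "emeasure (distr lborel borel (\<lambda>p :: real \<times> real. vector [fst p, snd p])) (box l u)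
      = ennreal (\<Prod>b\<in>Basis. (u - l) \<bullet> b)" .
qed simp

lemma vol_T2: "vol (T2 L) = restrict_space lborel {x. \<forall>i. 0 \<le> x $ i \<and> x $ i < L}"
  by (simp add: T2_def)

lemma smooth_grad_T2:
  "smooth_grad (T2 L) f G \<longleftrightarrow> (\<forall>x i. f (x + axis i L) = f x) \<and> smooth_on UNIV f \<and> (\<forall>x. GDERIV f x :> G x)"
  by (simp add: T2_def)

context
  fixes L :: real
  assumes L: "0 < L"
begin

abbreviation "period_square \<equiv> {x :: real^2. \<forall>i. 0 \<le> x $ i \<and> x $ i < L}"

lemma period_square_subset_cbox: "period_square \<subseteq> cbox 0 (\<chi> i. L)"
  by (auto simp: mem_box_cart less_imp_le)

lemma period_square_borel: "period_square \<in> sets borel"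
proof -
  have "period_square = (\<Inter>i\<in>UNIV. {x. 0 \<le> x $ i} \<inter> {x. x $ i < L})" by auto
  also have "\<dots> \<in> sets borel"
    by (intro sets.finite_INT sets.Int)
      (auto intro!: borel_closed borel_open closed_Collect_le open_Collect_less continuous_intros)
  finally show ?thesis .
qed

lemma torus_space [simp]: "space (vol (T2 L)) = period_square"
  by (simp add: vol_T2 space_restrict_space)

lemma torus_borel:
  fixes f :: "real^2 \<Rightarrow> 'b::{second_countable_topology, topological_space}"
  assumes "continuous_on UNIV f" shows "f \<in> borel_measurable (vol (T2 L))"
  unfolding vol_T2
  by (intro measurable_restrict_space1) (use assms borel_measurable_continuous_onI in auto)

lemma torus_finite_measure: "finite_measure (vol (T2 L))"
proof
  have "emeasure (vol (T2 L)) period_square = emeasure lborel period_square"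
    unfolding vol_T2 using period_square_borel by (subst emeasure_restrict_space) auto
  also have "\<dots> \<le> emeasure lborel (cbox 0 (\<chi> i. L) :: (real^2) set)"
    by (intro emeasure_mono period_square_subset_cbox) auto
  also have "\<dots> < \<infinity>" by (rule emeasure_lborel_cbox_finite)
  finally show "emeasure (vol (T2 L)) (space (vol (T2 L))) \<noteq> \<infinity>" by simp
qed

text \<open>The half-open and the closed square differ by a null set.\<close>

lemma torus_integral:
  fixes h :: "real^2 \<Rightarrow> real"
  assumes h: "continuous_on UNIV h"
  shows "(\<integral>x. h x \<partial>vol (T2 L))
    = (\<integral>p. indicator ({0..L} \<times> {0..L}) p * h (vector [fst p, snd p]) \<partial>lborel)"
proof -
  let ?v = "\<lambda>p :: real \<times> real. vector [fst p, snd p] :: real^2"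
  have v: "?v \<in> borel_measurable borel" by (rule borel_measurable_continuous_onI[OF continuous_vec2])
  have hv [measurable]: "(\<lambda>p. h (?v p)) \<in> borel_measurable borel"
    by (rule measurable_compose[OF v borel_measurable_continuous_onI[OF h]])
  have Qv [measurable]: "(\<lambda>p. indicator period_square (?v p) :: real) \<in> borel_measurable borel"
    by (rule measurable_compose[OF v borel_measurable_indicator[OF period_square_borel]])
  have R [measurable]: "{0..L} \<times> {0..L} \<in> sets (borel :: (real \<times> real) measure)"
    by (intro borel_closed closed_Times) auto
  have "(\<integral>x. h x \<partial>vol (T2 L)) = (\<integral>x. indicator period_square x *\<^sub>R h x \<partial>lborel)"
    unfolding vol_T2 using period_square_borel by (subst integral_restrict_space) auto
  also have "\<dots> = (\<integral>p. indicator period_square (?v p) *\<^sub>R h (?v p) \<partial>lborel)"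
    unfolding lborel_vec2
    by (rule integral_distr) (use v period_square_borel borel_measurable_continuous_onI[OF h] in auto)
  also have "\<dots> = (\<integral>p. indicator ({0..L} \<times> {0..L}) p * h (?v p) \<partial>lborel)"
  proof (rule integral_cong_AE)
    have "{L} \<times> UNIV \<union> UNIV \<times> {L} \<in> null_sets (lborel :: (real \<times> real) measure)"
      unfolding lborel_prod[symmetric]
      by (intro null_sets.Un lborel.times_in_null_sets1 lborel.times_in_null_sets2) auto
    then have "AE p in lborel. p \<notin> {L} \<times> UNIV \<union> UNIV \<times> {L}"
      by (rule AE_not_in)
    then show "AE p in lborel. indicator period_square (?v p) *\<^sub>R h (?v p) = indicator ({0..L} \<times> {0..L}) p * h (?v p)"
      by eventually_elim (auto simp: indicator_def forall_2)
  qed (use hv Qv R in \<open>auto intro!: borel_measurable_times borel_measurable_indicator\<close>)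
  finally show ?thesis .
qed

text \<open>Periodicity cancels the boundary terms.\<close>

lemma torus_divergence:
  fixes u :: "real^2 \<Rightarrow> real"
  assumes per: "\<And>x i. u (x + axis i L) = u x"
    and grad: "\<And>x. GDERIV u x :> U x" and cont: "continuous_on UNIV U"
  shows "(\<integral>x. U x \<bullet> v \<partial>vol (T2 L)) = 0"
proof -
  interpret finite_measure "vol (T2 L)" by (rule torus_finite_measure)
  let ?v = "\<lambda>p :: real \<times> real. vector [fst p, snd p] :: real^2"
  have c: "continuous_on UNIV (\<lambda>x. U x $ i)" for i by (intro continuous_intros cont)
  have c': "continuous_on UNIV (\<lambda>p. U (?v p) $ i)" for i
    using continuous_on_compose2[OF c continuous_vec2] by simp
  have d1: "((\<lambda>x. u (?v (x, y))) has_real_derivative U (?v (x, y)) $ 1) (at x)" for x y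
  proof -
    define a :: "real^2" where "a = vector [0, y]"
    have e: "(vector [s, y] :: real^2) = a + s *\<^sub>R axis 1 1" for s
      by (simp add: a_def vec_eq_iff forall_2 axis_def)
    have "((\<lambda>s. a + s *\<^sub>R axis 1 1) has_derivative (\<lambda>s. s *\<^sub>R axis 1 1)) (at x)"
      by (auto intro!: derivative_eq_intros)
    from diff_chain_at[OF this grad[unfolded gderiv_def]]
    show ?thesis unfolding fst_conv snd_conv e
      by (simp add: o_def inner_axis' has_field_derivative_def mult.commute[of _ "U _ $ 1"])
  qed
  have d2: "((\<lambda>y. u (?v (x, y))) has_real_derivative U (?v (x, y)) $ 2) (at y)" for x y
  proof -
    define a :: "real^2" where "a = vector [x, 0]"
    have e: "(vector [x, s] :: real^2) = a + s *\<^sub>R axis 2 1" for s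
      by (simp add: a_def vec_eq_iff forall_2 axis_def)
    have "((\<lambda>s. a + s *\<^sub>R axis 2 1) has_derivative (\<lambda>s. s *\<^sub>R axis 2 1)) (at y)"
      by (auto intro!: derivative_eq_intros)
    from diff_chain_at[OF this grad[unfolded gderiv_def]]
    show ?thesis unfolding fst_conv snd_conv e
      by (simp add: o_def inner_axis' has_field_derivative_def mult.commute[of _ "U _ $ 2"])
  qed
  have "?v (L, y) = ?v (0, y) + axis 1 L" "?v (x, L) = ?v (x, 0) + axis 2 L" for x y
    by (simp_all add: vec_eq_iff forall_2 axis_def)
  then have eq: "u (?v (L, y)) = u (?v (0, y))" "u (?v (x, L)) = u (?v (x, 0))" for x y
    using per by simp_all
  have "(\<integral>x. U x $ 1 \<partial>vol (T2 L)) = 0"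
    unfolding torus_integral[OF c]
    by (rule rectangle_derivative_fst[where H = "\<lambda>p. u (?v p)"]) (use L c' d1 eq in auto)
  moreover have "(\<integral>x. U x $ 2 \<partial>vol (T2 L)) = 0"
    unfolding torus_integral[OF c]
    by (rule rectangle_derivative_snd[where H = "\<lambda>p. u (?v p)"]) (use L c' d2 eq in auto)
  moreover have "integrable (vol (T2 L)) (\<lambda>x. U x $ i)" for i
  proof -
    have "bounded ((\<lambda>x. U x $ i) ` cbox 0 (\<chi> i. L))"
      using compact_continuous_image[OF continuous_on_subset[OF c subset_UNIV] compact_cbox]
      by (rule compact_imp_bounded)
    then obtain C where "\<And>x. x \<in> cbox 0 (\<chi> i. L) \<Longrightarrow> norm (U x $ i) \<le> C"
      unfolding bounded_iff by blast
    then show ?thesis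
      using period_square_subset_cbox by (intro integrable_const_bound[where B = C] torus_borel c AE_I2) auto
  qed
  ultimately show ?thesis
    by (simp add: inner_vec_def sum_2)
qed

lemma smooth_torus:
  assumes "smooth_grad (T2 L) f G"
  shows "continuous_on UNIV f" "continuous_on UNIV G"
proof -
  have s: "smooth_on UNIV f" and G: "\<And>x. GDERIV f x :> G x"
    using assms by (auto simp: smooth_grad_T2)
  show "continuous_on UNIV f" by (rule smooth_on_continuous[OF s])
  obtain \<Gamma> where "\<And>x. GDERIV f x :> \<Gamma> x" "continuous_on UNIV \<Gamma>"
    using smooth_on_gradient[OF s] by auto
  moreover from this(1) G have "G = \<Gamma>" by (auto intro: gderiv_unique)
  ultimately show "continuous_on UNIV G" by simp
qed

lemma torus_bounded:
  fixes f :: "real^2 \<Rightarrow> 'b::real_normed_vector"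
  assumes "continuous_on UNIV f"
  shows "\<exists>C. \<forall>x\<in>period_square. norm (f x) \<le> C"
proof -
  have "bounded (f ` cbox 0 (\<chi> i. L))"
    using compact_continuous_image[OF continuous_on_subset[OF assms subset_UNIV] compact_cbox]
    by (rule compact_imp_bounded)
  then obtain C where "\<And>x. x \<in> cbox 0 (\<chi> i. L) \<Longrightarrow> norm (f x) \<le> C"
    unfolding bounded_iff by blast
  then show ?thesis using period_square_subset_cbox by blast
qed

lemma torus_integrable:
  fixes f :: "real^2 \<Rightarrow> real"
  assumes "continuous_on UNIV f"
  shows "integrable (vol (T2 L)) f"
proof -
  interpret finite_measure "vol (T2 L)" by (rule torus_finite_measure)
  obtain C where "\<And>x. x \<in> period_square \<Longrightarrow> norm (f x) \<le> C" using torus_bounded[OF assms] by blast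
  then show ?thesis
    by (intro integrable_const_bound[where B = C] torus_borel assms AE_I2) auto
qed

subsection \<open>The Hartley basis\<close>

text \<open>Hartley's function.  Because \<open>cas a \<cdot> cas b = cos (a - b) + sin (a + b)\<close>, the functions
  \<open>cas (wave k \<bullet> y)\<close> with \<open>k\<close> in the whole lattice are orthogonal, which gives a real eigenbasis
  without choosing representatives of the pairs \<open>{k, -k}\<close>.\<close>

definition cas :: "real \<Rightarrow> real" where "cas s = cos s + sin s"
definition cas' :: "real \<Rightarrow> real" where "cas' s = cos s - sin s"

definition wave :: "int \<times> int \<Rightarrow> real^2" where
  "wave k = (2 * pi / L) *\<^sub>R vector [of_int (fst k), of_int (snd k)]"

lemma wave_axis: "wave k \<bullet> axis i L = 2 * pi * of_int (if i = 1 then fst k else snd k)"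
  using L exhaust_2[of i] by (elim disjE) (simp_all add: wave_def inner_axis)

lemma wave_add: "wave (fst k + fst l, snd k + snd l) = wave k + wave l"
  and wave_diff: "wave (fst k - fst l, snd k - snd l) = wave k - wave l"
  and wave_minus: "wave (- fst k, - snd k) = - wave k"
  and wave_0: "wave (0, 0) = 0"
  by (simp_all add: wave_def vec_eq_iff forall_2 ring_distribs diff_divide_distrib add_divide_distrib)

lemma wave_square: "wave k \<bullet> wave k = (2 * pi / L)\<^sup>2 * ((of_int (fst k))\<^sup>2 + (of_int (snd k))\<^sup>2)"
  by (simp add: wave_def inner_vec_def sum_2 power2_eq_square algebra_simps)

lemma wave_eq_0_iff: "wave k = 0 \<longleftrightarrow> k = (0, 0)"
  using L by (cases k) (auto simp: wave_def vec_eq_iff forall_2)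

lemma wave_smooth:
  "smooth_on UNIV (\<lambda>y. a * cos (w \<bullet> y) + b * sin (w \<bullet> y))" for w :: "real^2"
proof (rule smooth_on_ridge[where P = "\<lambda>p. \<exists>a b. p = (\<lambda>s. a * cos s + b * sin s)"
      and p = "\<lambda>s. a * cos s + b * sin s"])
  fix p :: "real \<Rightarrow> real" and c :: real
  assume "\<exists>a b. p = (\<lambda>s. a * cos s + b * sin s)"
  then obtain a b where p: "p = (\<lambda>s. a * cos s + b * sin s)" by blast
  show "\<exists>p'. (\<exists>a b. p' = (\<lambda>s. a * cos s + b * sin s)) \<and>
      (\<exists>a b. (\<lambda>s. p' s * c) = (\<lambda>s. a * cos s + b * sin s)) \<and> (\<forall>s. (p has_real_derivative p' s) (at s))"
  proof (intro exI[of _ "\<lambda>s. b * cos s + (- a) * sin s"] conjI allI)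
    show "\<exists>a' b'. (\<lambda>s. (b * cos s + - a * sin s) * c) = (\<lambda>s. a' * cos s + b' * sin s)"
      by (intro exI[of _ "b * c"] exI[of _ "- a * c"]) (auto simp: algebra_simps)
    show "(p has_real_derivative b * cos s + - a * sin s) (at s)" for s
      unfolding p by (auto intro!: derivative_eq_intros)
  qed blast
qed blast

lemma wave_periodic:
  "cos (wave k \<bullet> (x + axis i L)) = cos (wave k \<bullet> x)"
  "sin (wave k \<bullet> (x + axis i L)) = sin (wave k \<bullet> x)"
  unfolding inner_add_right wave_axis
  by (simp_all add: cos_add sin_add cos_integer_2pi sin_integer_2pi)

lemma wave_gderiv: "GDERIV (\<lambda>y. p (w \<bullet> y)) y :> p' *\<^sub>R w" if "(p has_real_derivative p') (at (w \<bullet> y))"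
  for w :: "real^2"
proof (rule GDERIV_DERIV_compose[where f = "\<lambda>y. w \<bullet> y" and g = p, OF _ that])
  show "GDERIV (\<lambda>y. w \<bullet> y) y :> w"
    unfolding gderiv_def by (auto intro!: derivative_eq_intros simp: inner_commute)
qed

lemma cas_deriv: "(cas has_real_derivative cas' s) (at s)" "(cas' has_real_derivative - cas s) (at s)"
  unfolding cas_def [abs_def] cas'_def [abs_def] by (auto intro!: derivative_eq_intros)

lemma cas_continuous: "continuous_on S cas" "continuous_on S cas'"
  unfolding cas_def [abs_def] cas'_def [abs_def] by (auto intro!: continuous_intros)

lemma cas_bounds: "\<bar>cas s\<bar> \<le> 2" "\<bar>cas' s\<bar> \<le> 2"
  using sin_le_one[of s] sin_ge_minus_one[of s] cos_le_one[of s] cos_ge_minus_one[of s]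
  unfolding cas_def cas'_def abs_le_iff by linarith+

lemma smooth_grad_cas:
  "smooth_grad (T2 L) (\<lambda>y. c * cas (wave k \<bullet> y)) (\<lambda>y. (c * cas' (wave k \<bullet> y)) *\<^sub>R wave k)"
  unfolding smooth_grad_T2
proof (intro conjI allI)
  show "c * cas (wave k \<bullet> (x + axis i L)) = c * cas (wave k \<bullet> x)" for x i
    by (simp add: cas_def wave_periodic)
  show "smooth_on UNIV (\<lambda>y. c * cas (wave k \<bullet> y))"
    using wave_smooth[of c "wave k" c] by (simp add: cas_def distrib_left)
  show "GDERIV (\<lambda>y. c * cas (wave k \<bullet> y)) x :> (c * cas' (wave k \<bullet> x)) *\<^sub>R wave k" for x
    by (rule wave_gderiv) (intro DERIV_cmult cas_deriv)
qed

text \<open>The divergence theorem for \<open>\<phi>\<close> times the derivative of the wave, in the direction of the wave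
  vector.\<close>

lemma torus_green:
  assumes sm: "smooth_grad (T2 L) \<phi> G"
  shows "(\<integral>y. G y \<bullet> ((c * cas' (wave k \<bullet> y)) *\<^sub>R wave k) \<partial>vol (T2 L))
    = (wave k \<bullet> wave k) * (\<integral>y. \<phi> y * (c * cas (wave k \<bullet> y)) \<partial>vol (T2 L))"
proof -
  note cont = smooth_torus[OF sm]
  have cw: "continuous_on UNIV (\<lambda>y. cas (wave k \<bullet> y))" "continuous_on UNIV (\<lambda>y. cas' (wave k \<bullet> y))"
    by (rule continuous_on_compose2[OF cas_continuous(1)[of UNIV]] continuous_on_compose2[OF cas_continuous(2)[of UNIV]];
        auto intro!: continuous_intros)+
  let ?U = "\<lambda>y. \<phi> y *\<^sub>R ((- cas (wave k \<bullet> y)) *\<^sub>R wave k) + cas' (wave k \<bullet> y) *\<^sub>R G y"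
  have "(\<integral>y. ?U y \<bullet> wave k \<partial>vol (T2 L)) = 0"
  proof (rule torus_divergence)
    show "\<phi> (x + axis i L) * cas' (wave k \<bullet> (x + axis i L)) = \<phi> x * cas' (wave k \<bullet> x)" for x i
      using sm by (simp add: cas'_def wave_periodic smooth_grad_T2)
    show "GDERIV (\<lambda>y. \<phi> y * cas' (wave k \<bullet> y)) x :> ?U x" for x
      using sm by (intro GDERIV_mult wave_gderiv cas_deriv) (auto simp: smooth_grad_T2)
    show "continuous_on UNIV ?U" by (intro continuous_intros cont cw)
  qed
  also have "(\<lambda>y. ?U y \<bullet> wave k) = (\<lambda>y. G y \<bullet> (cas' (wave k \<bullet> y) *\<^sub>R wave k)
      - (wave k \<bullet> wave k) * (\<phi> y * cas (wave k \<bullet> y)))"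
    by (auto simp: inner_add_left algebra_simps)
  also have "integral\<^sup>L (vol (T2 L)) \<dots> = (\<integral>y. G y \<bullet> (cas' (wave k \<bullet> y) *\<^sub>R wave k) \<partial>vol (T2 L))
      - (wave k \<bullet> wave k) * (\<integral>y. \<phi> y * cas (wave k \<bullet> y) \<partial>vol (T2 L))"
  proof (subst Bochner_Integration.integral_diff)
    show "integrable (vol (T2 L)) (\<lambda>y. G y \<bullet> (cas' (wave k \<bullet> y) *\<^sub>R wave k))"
      by (intro torus_integrable continuous_intros cont cw)
    show "integrable (vol (T2 L)) (\<lambda>y. (wave k \<bullet> wave k) * (\<phi> y * cas (wave k \<bullet> y)))"
      by (intro torus_integrable continuous_intros cont cw)
  qed simp
  finally have e: "(\<integral>y. cas' (wave k \<bullet> y) * (G y \<bullet> wave k) \<partial>vol (T2 L))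
      = (wave k \<bullet> wave k) * (\<integral>y. \<phi> y * cas (wave k \<bullet> y) \<partial>vol (T2 L))" by simp
  have "(\<integral>y. G y \<bullet> ((c * cas' (wave k \<bullet> y)) *\<^sub>R wave k) \<partial>vol (T2 L))
      = (\<integral>y. c * (cas' (wave k \<bullet> y) * (G y \<bullet> wave k)) \<partial>vol (T2 L))"
    by (simp add: mult.assoc)
  also have "\<dots> = c * (wave k \<bullet> wave k) * (\<integral>y. \<phi> y * cas (wave k \<bullet> y) \<partial>vol (T2 L))"
    by (simp add: e)
  also have "\<dots> = (wave k \<bullet> wave k) * (\<integral>y. c * (\<phi> y * cas (wave k \<bullet> y)) \<partial>vol (T2 L))"
    by simp
  finally show ?thesis by (simp add: ac_simps)
qed

text \<open>A nonconstant wave is, up to a factor, a derivative of a periodic function.\<close>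

lemma integral_wave:
  "k \<noteq> (0, 0) \<Longrightarrow> (\<integral>y. cos (wave k \<bullet> y) \<partial>vol (T2 L)) = 0"
  "(\<integral>y. sin (wave k \<bullet> y) \<partial>vol (T2 L)) = 0"
proof -
  have "(\<integral>y. (cos (wave k \<bullet> y) *\<^sub>R wave k) \<bullet> wave k \<partial>vol (T2 L)) = 0"
    by (rule torus_divergence[where u = "\<lambda>y. sin (wave k \<bullet> y)"])
      (auto intro!: wave_gderiv derivative_eq_intros continuous_intros simp: wave_periodic)
  then have "(wave k \<bullet> wave k) * (\<integral>y. cos (wave k \<bullet> y) \<partial>vol (T2 L)) = 0"
    by (simp add: mult.commute)
  then show "k \<noteq> (0, 0) \<Longrightarrow> (\<integral>y. cos (wave k \<bullet> y) \<partial>vol (T2 L)) = 0"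
    by (simp add: wave_eq_0_iff)
  have "(\<integral>y. (sin (wave k \<bullet> y) *\<^sub>R wave k) \<bullet> wave k \<partial>vol (T2 L)) = 0"
    by (rule torus_divergence[where u = "\<lambda>y. - cos (wave k \<bullet> y)"])
      (auto intro!: wave_gderiv derivative_eq_intros continuous_intros simp: wave_periodic)
  then have "(wave k \<bullet> wave k) * (\<integral>y. sin (wave k \<bullet> y) \<partial>vol (T2 L)) = 0"
    by (simp add: mult.commute)
  then show "(\<integral>y. sin (wave k \<bullet> y) \<partial>vol (T2 L)) = 0"
    by (cases "wave k = 0") auto
qed

lemma torus_volume: "(\<integral>x. (1::real) \<partial>vol (T2 L)) = L\<^sup>2"
proof -
  have "(\<integral>x. (1::real) \<partial>vol (T2 L)) = (\<integral>p. indicator ({0..L} \<times> {0..L}) p * 1 \<partial>lborel)"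
    by (rule torus_integral) (intro continuous_intros)
  also have "\<dots> = measure lborel ({0..L} \<times> {0..L})"
    by simp
  also have "{0..L} \<times> {0..L} = cbox (0, 0) (L, L)" by (simp add: cbox_Pair_eq)
  also have "measure lborel (cbox (0, 0) (L, L)) = L\<^sup>2"
    using L by (simp add: measure_lborel_cbox_eq Basis_prod_def prod.union_disjoint power2_eq_square)
  finally show ?thesis .
qed

lemma cas_orthogonal:
  "(\<integral>y. cas (wave k \<bullet> y) * cas (wave l \<bullet> y) \<partial>vol (T2 L)) = (if k = l then L\<^sup>2 else 0)"
proof -
  let ?d = "(fst k - fst l, snd k - snd l)" and ?s = "(fst k + fst l, snd k + snd l)"
  have "cas (wave k \<bullet> y) * cas (wave l \<bullet> y) = cos (wave ?d \<bullet> y) + sin (wave ?s \<bullet> y)" for y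
    unfolding wave_diff wave_add inner_diff_left inner_add_left cas_def
    by (simp add: cos_diff sin_add algebra_simps)
  then have "(\<integral>y. cas (wave k \<bullet> y) * cas (wave l \<bullet> y) \<partial>vol (T2 L))
      = (\<integral>y. cos (wave ?d \<bullet> y) + sin (wave ?s \<bullet> y) \<partial>vol (T2 L))" by simp
  also have "\<dots> = (\<integral>y. cos (wave ?d \<bullet> y) \<partial>vol (T2 L)) + (\<integral>y. sin (wave ?s \<bullet> y) \<partial>vol (T2 L))"
    by (intro Bochner_Integration.integral_add torus_integrable continuous_intros)
  also have "\<dots> = (if k = l then L\<^sup>2 else 0)"
  proof (cases "k = l")
    case True
    then show ?thesis using torus_volume by (simp add: integral_wave wave_0)
  next
    case False
    then have "?d \<noteq> (0, 0)" by (auto simp: prod_eq_iff)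
    then show ?thesis using False integral_wave(1)[of ?d] integral_wave(2)[of ?s] by simp
  qed
  finally show ?thesis .
qed


subsection \<open>Trigonometric polynomials are dense\<close>

definition torus_kernel :: "int \<times> int \<Rightarrow> real^2 \<Rightarrow> real^2 \<Rightarrow> real" where
  "torus_kernel k x y = cas (wave k \<bullet> x) / L\<^sup>2 * cas (wave k \<bullet> y)"

definition torus_modes :: "nat \<Rightarrow> (int \<times> int) set" where
  "torus_modes R = {- int R..int R} \<times> {- int R..int R} - {(0, 0)}"

lemma torus_modes_mono: "mono torus_modes"
  by (auto simp: mono_def torus_modes_def)

lemma in_torus_modes:
  assumes "k \<noteq> (0, 0)" obtains R where "k \<in> torus_modes R" "(- fst k, - snd k) \<in> torus_modes R"
proof
  show "k \<in> torus_modes (nat (\<bar>fst k\<bar> + \<bar>snd k\<bar>))" "(- fst k, - snd k) \<in> torus_modes (nat (\<bar>fst k\<bar> + \<bar>snd k\<bar>))"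
    using assms by (cases k; auto simp: torus_modes_def)+
qed

inductive trig_poly :: "(real^2 \<Rightarrow> real) \<Rightarrow> bool" where
  trig_cos: "trig_poly (\<lambda>y. cos (wave k \<bullet> y))"
| trig_sin: "trig_poly (\<lambda>y. sin (wave k \<bullet> y))"
| trig_scale: "trig_poly f \<Longrightarrow> trig_poly (\<lambda>y. c * f y)"
| trig_add: "trig_poly f \<Longrightarrow> trig_poly g \<Longrightarrow> trig_poly (\<lambda>y. f y + g y)"

lemma trig_poly_const: "trig_poly (\<lambda>y. c)"
  using trig_scale[OF trig_cos[of "(0, 0)"], of c] by (simp add: wave_0)

lemma trig_poly_product:
  shows "trig_poly (\<lambda>y. cos (wave k \<bullet> y) * cos (wave l \<bullet> y))"
    and "trig_poly (\<lambda>y. sin (wave k \<bullet> y) * cos (wave l \<bullet> y))"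
    and "trig_poly (\<lambda>y. sin (wave k \<bullet> y) * sin (wave l \<bullet> y))"
proof -
  let ?d = "(fst k - fst l, snd k - snd l)" and ?s = "(fst k + fst l, snd k + snd l)"
  have "trig_poly (\<lambda>y. 1/2 * cos (wave ?d \<bullet> y) + 1/2 * cos (wave ?s \<bullet> y))"
    by (intro trig_poly.intros)
  then show "trig_poly (\<lambda>y. cos (wave k \<bullet> y) * cos (wave l \<bullet> y))"
    unfolding wave_add wave_diff by (simp add: inner_add_left inner_diff_left cos_add cos_diff field_simps)
  have "trig_poly (\<lambda>y. 1/2 * sin (wave ?d \<bullet> y) + 1/2 * sin (wave ?s \<bullet> y))"
    by (intro trig_poly.intros)
  then show "trig_poly (\<lambda>y. sin (wave k \<bullet> y) * cos (wave l \<bullet> y))"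
    unfolding wave_add wave_diff by (simp add: inner_add_left inner_diff_left sin_add sin_diff field_simps)
  have "trig_poly (\<lambda>y. 1/2 * cos (wave ?d \<bullet> y) + (- (1/2)) * cos (wave ?s \<bullet> y))"
    by (intro trig_poly.intros)
  then show "trig_poly (\<lambda>y. sin (wave k \<bullet> y) * sin (wave l \<bullet> y))"
    unfolding wave_add wave_diff by (simp add: inner_add_left inner_diff_left cos_add cos_diff field_simps)
qed

lemma trig_poly_mult:
  assumes "trig_poly f" and g: "trig_poly g"
  shows "trig_poly (\<lambda>y. f y * g y)"
  using assms(1)
proof induction
  case (trig_cos k)
  show ?case using g
  proof induction
    case (trig_sin l)
    show ?case using trig_poly_product(2)[of l k] by (simp add: mult.commute)
  next
    case (trig_scale g c)
    from trig_poly.trig_scale[OF trig_scale.IH, of c] show ?case by (simp add: ac_simps)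
  next
    case (trig_add g h)
    from trig_poly.trig_add[OF trig_add.IH] show ?case by (simp add: distrib_left)
  qed (rule trig_poly_product)
next
  case (trig_sin k)
  show ?case using g
  proof induction
    case (trig_scale g c)
    from trig_poly.trig_scale[OF trig_scale.IH, of c] show ?case by (simp add: ac_simps)
  next
    case (trig_add g h)
    from trig_poly.trig_add[OF trig_add.IH] show ?case by (simp add: distrib_left)
  qed (rule trig_poly_product)+
next
  case (trig_scale f c)
  from trig_poly.trig_scale[OF trig_scale.IH, of c] show ?case by (simp add: ac_simps)
next
  case (trig_add f h)
  from trig_poly.trig_add[OF trig_add.IH] show ?case by (simp add: distrib_right)
qed

text \<open>Cosine and sine of a wave are the even and the odd part of its \<open>cas\<close>, hence combinations of the
  kernels at the origin for \<open>k\<close> and \<open>-k\<close>.\<close>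

lemma trig_poly_kernel_span:
  assumes "trig_poly p"
  shows "kernel_span torus_kernel torus_modes period_square p"
  using assms
proof induction
  have zero: "(0 :: real^2) \<in> period_square" using L by simp
  {
    case (trig_cos k)
    show ?case
    proof (cases "k = (0, 0)")
      case False
      then obtain R where "k \<in> torus_modes R" "(- fst k, - snd k) \<in> torus_modes R" by (rule in_torus_modes)
      then have "kernel_span torus_kernel torus_modes period_square
          (\<lambda>y. L\<^sup>2 / 2 * torus_kernel k 0 y + L\<^sup>2 / 2 * torus_kernel (- fst k, - snd k) 0 y)"
        using zero by (intro kernel_span.add kernel_span.scale kernel_span.kernel)
      also have "(\<lambda>y. L\<^sup>2 / 2 * torus_kernel k 0 y + L\<^sup>2 / 2 * torus_kernel (- fst k, - snd k) 0 y)
          = (\<lambda>y. cos (wave k \<bullet> y))"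
        using L by (auto simp: torus_kernel_def wave_minus cas_def field_simps)
      finally show ?thesis .
    qed (simp add: wave_0 kernel_span.const)
  next
    case (trig_sin k)
    show ?case
    proof (cases "k = (0, 0)")
      case False
      then obtain R where "k \<in> torus_modes R" "(- fst k, - snd k) \<in> torus_modes R" by (rule in_torus_modes)
      then have "kernel_span torus_kernel torus_modes period_square
          (\<lambda>y. L\<^sup>2 / 2 * torus_kernel k 0 y + (- L\<^sup>2 / 2) * torus_kernel (- fst k, - snd k) 0 y)"
        using zero by (intro kernel_span.add kernel_span.scale kernel_span.kernel)
      also have "(\<lambda>y. L\<^sup>2 / 2 * torus_kernel k 0 y + (- L\<^sup>2 / 2) * torus_kernel (- fst k, - snd k) 0 y)
          = (\<lambda>y. sin (wave k \<bullet> y))"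
        using L by (auto simp: torus_kernel_def wave_minus cas_def field_simps)
      finally show ?thesis .
    qed (simp add: wave_0 kernel_span.const)
  }
qed (auto intro: kernel_span.intros)

text \<open>Functions with period \<open>L\<close> are functions on the compact set \<open>S\<^sup>1 \<times> S\<^sup>1\<close>, where points are
  separated by trigonometric polynomials; on the closed square they would not be.\<close>

definition torus_embedding :: "real^2 \<Rightarrow> complex \<times> complex" where
  "torus_embedding x = (cis (wave (1, 0) \<bullet> x), cis (wave (0, 1) \<bullet> x))"

lemma periodic_multiple:
  fixes f :: "real^2 \<Rightarrow> real"
  assumes per: "\<And>x i. f (x + axis i L) = f x"
  shows "f (x + axis i (of_int n * L)) = f x"
proof -
  have nat: "f (x + axis i (of_nat m * L)) = f x" for x and m :: nat
  proof (induction m)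
    case (Suc m)
    have "x + axis i (of_nat (Suc m) * L) = (x + axis i (of_nat m * L)) + axis i L"
      by (simp add: vec_eq_iff axis_def algebra_simps)
    then have "f (x + axis i (of_nat (Suc m) * L)) = f (x + axis i (of_nat m * L))"
      by (simp only: per)
    then show ?case by (simp only: Suc)
  qed (simp add: axis_def vec_eq_iff flip: zero_vec_def)
  show ?thesis
  proof (cases "0 \<le> n")
    case True
    then show ?thesis using nat[of x "nat n"] by simp
  next
    case False
    have "(x + axis i (of_int n * L)) + axis i (of_nat (nat (- n)) * L) = x"
      using False by (simp add: vec_eq_iff axis_def algebra_simps)
    then show ?thesis using nat[of "x + axis i (of_int n * L)" "nat (- n)"] by (simp only:)
  qed
qed

lemma periodic_torus_embedding:
  fixes f :: "real^2 \<Rightarrow> real"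
  assumes per: "\<And>x i. f (x + axis i L) = f x" and eq: "torus_embedding x = torus_embedding y"
  shows "f x = f y"
proof -
  have "sin (wave (1, 0) \<bullet> x) = sin (wave (1, 0) \<bullet> y) \<and> cos (wave (1, 0) \<bullet> x) = cos (wave (1, 0) \<bullet> y)"
    and "sin (wave (0, 1) \<bullet> x) = sin (wave (0, 1) \<bullet> y) \<and> cos (wave (0, 1) \<bullet> x) = cos (wave (0, 1) \<bullet> y)"
    using eq by (auto simp: torus_embedding_def complex_eq_iff)
  then obtain m n :: int where "wave (1, 0) \<bullet> x = wave (1, 0) \<bullet> y + 2 * pi * m"
      "wave (0, 1) \<bullet> x = wave (0, 1) \<bullet> y + 2 * pi * n"
    unfolding sin_cos_eq_iff by blast
  then have "2 * pi * (x $ 1 / L) = 2 * pi * (y $ 1 / L + m)" "2 * pi * (x $ 2 / L) = 2 * pi * (y $ 2 / L + n)"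
    by (simp_all add: wave_def inner_vec_def sum_2 algebra_simps)
  then have "x $ 1 / L = y $ 1 / L + m" "x $ 2 / L = y $ 2 / L + n" by (simp_all only: mult_cancel_left) simp_all
  then have "x $ 1 = y $ 1 + m * L" "x $ 2 = y $ 2 + n * L"
    using L by (simp_all add: field_simps)
  then have "x = (y + axis 1 (m * L)) + axis 2 (n * L)"
    by (simp add: vec_eq_iff forall_2 axis_def)
  then show ?thesis by (simp only: periodic_multiple[of f, OF per])
qed

text \<open>A periodic function factors through the embedding into \<open>S\<^sup>1 \<times> S\<^sup>1\<close>, and the factor is continuous
  because the embedding maps compact sets to compact sets.\<close>

lemma torus_dense:
  fixes f :: "real^2 \<Rightarrow> real"
  assumes per: "\<And>x i. f (x + axis i L) = f x" and cont: "continuous_on UNIV f" and e: "0 < e"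
  shows "\<exists>p. trig_poly p \<and> (\<forall>y\<in>period_square. \<bar>f y - p y\<bar> \<le> e)"
proof -
  define C :: "(real^2) set" where "C = cbox 0 (\<chi> i. L)"
  define S where "S = torus_embedding ` C"
  have emb: "continuous_on X torus_embedding" for X
    unfolding torus_embedding_def [abs_def] by (intro continuous_intros)
  have C: "compact C" by (simp add: C_def)
  have S: "compact S" unfolding S_def by (intro compact_continuous_image emb C)
  define F where "F z = f (SOME x. x \<in> C \<and> torus_embedding x = z)" for z
  have F: "F (torus_embedding x) = f x" if "x \<in> C" for x
  proof -
    have "(SOME x'. x' \<in> C \<and> torus_embedding x' = torus_embedding x) \<in> C \<and>
        torus_embedding (SOME x'. x' \<in> C \<and> torus_embedding x' = torus_embedding x) = torus_embedding x"
      by (rule someI[of _ x]) (use that in simp)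
    then show ?thesis unfolding F_def by (intro periodic_torus_embedding[of f, OF per]) (rule conjunct2)
  qed
  have contF: "continuous_on S F"
    unfolding continuous_on_closed_vimage[OF compact_imp_closed[OF S]]
  proof (intro allI impI)
    fix B :: "real set" assume "closed B"
    then have "closed (f -` B \<inter> C)"
      using continuous_on_closed_vimage[of C f] continuous_on_subset[OF cont] compact_imp_closed[OF C] by blast
    then have "compact (C \<inter> (f -` B \<inter> C))" by (intro compact_Int_closed C)
    then have "compact (torus_embedding ` (C \<inter> (f -` B \<inter> C)))"
      by (intro compact_continuous_image emb)
    moreover have "F -` B \<inter> S = torus_embedding ` (C \<inter> (f -` B \<inter> C))"
      unfolding S_def using F by auto
    ultimately show "closed (F -` B \<inter> S)" by (simp add: compact_imp_closed)
  qed
  have "\<exists>g. (continuous_on S g \<and> trig_poly (\<lambda>x. g (torus_embedding x))) \<and> (\<forall>z\<in>S. \<bar>F z - g z\<bar> < e)"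
  proof (rule Stone_Weierstrass_HOL[OF S, where P = "\<lambda>g. continuous_on S g \<and> trig_poly (\<lambda>x. g (torus_embedding x))"])
    fix z w assume zw: "z \<in> S \<and> w \<in> S \<and> z \<noteq> w"
    have tr: "trig_poly (\<lambda>x. Re (fst (torus_embedding x)))" "trig_poly (\<lambda>x. Im (fst (torus_embedding x)))"
      "trig_poly (\<lambda>x. Re (snd (torus_embedding x)))" "trig_poly (\<lambda>x. Im (snd (torus_embedding x)))"
      by (simp_all add: torus_embedding_def trig_cos trig_sin)
    from zw have "Re (fst z) \<noteq> Re (fst w) \<or> Im (fst z) \<noteq> Im (fst w) \<or> Re (snd z) \<noteq> Re (snd w) \<or> Im (snd z) \<noteq> Im (snd w)"
      by (auto simp: prod_eq_iff complex_eq_iff)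
    moreover have sep: "\<exists>g. (continuous_on S g \<and> trig_poly (\<lambda>x. g (torus_embedding x))) \<and> g z \<noteq> g w"
      if "continuous_on S g" "trig_poly (\<lambda>x. g (torus_embedding x))" "g z \<noteq> g w" for g
      using that by blast
    ultimately show "\<exists>g. (continuous_on S g \<and> trig_poly (\<lambda>x. g (torus_embedding x))) \<and> g z \<noteq> g w"
    proof (elim disjE)
      assume "Re (fst z) \<noteq> Re (fst w)"
      then show ?thesis by (intro sep[of "\<lambda>z. Re (fst z)"] tr continuous_intros)
    next
      assume "Im (fst z) \<noteq> Im (fst w)"
      then show ?thesis by (intro sep[of "\<lambda>z. Im (fst z)"] tr continuous_intros)
    next
      assume "Re (snd z) \<noteq> Re (snd w)"
      then show ?thesis by (intro sep[of "\<lambda>z. Re (snd z)"] tr continuous_intros)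
    next
      assume "Im (snd z) \<noteq> Im (snd w)"
      then show ?thesis by (intro sep[of "\<lambda>z. Im (snd z)"] tr continuous_intros)
    qed
  next
    show "continuous_on S (\<lambda>x. c) \<and> trig_poly (\<lambda>x. c)" for c
      by (simp add: trig_poly_const)
    show "continuous_on S (\<lambda>x. g x + h x) \<and> trig_poly (\<lambda>x. g (torus_embedding x) + h (torus_embedding x))"
      if "(continuous_on S g \<and> trig_poly (\<lambda>x. g (torus_embedding x))) \<and>
          (continuous_on S h \<and> trig_poly (\<lambda>x. h (torus_embedding x)))" for g h
      using that by (simp add: trig_add continuous_on_add)
    show "continuous_on S (\<lambda>x. g x * h x) \<and> trig_poly (\<lambda>x. g (torus_embedding x) * h (torus_embedding x))"
      if "(continuous_on S g \<and> trig_poly (\<lambda>x. g (torus_embedding x))) \<and>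
          (continuous_on S h \<and> trig_poly (\<lambda>x. h (torus_embedding x)))" for g h
      using that by (simp add: trig_poly_mult continuous_on_mult)
  qed (use contF e in auto)
  then obtain g where g: "trig_poly (\<lambda>x. g (torus_embedding x))" and app: "\<And>z. z \<in> S \<Longrightarrow> \<bar>F z - g z\<bar> < e"
    by blast
  have "\<bar>f y - g (torus_embedding y)\<bar> \<le> e" if "y \<in> period_square" for y
  proof -
    have y: "y \<in> C" using that period_square_subset_cbox by (auto simp: C_def)
    then have "torus_embedding y \<in> S" by (simp add: S_def)
    from app[OF this] F[OF y] show ?thesis by simp
  qed
  with g show ?thesis by blast
qed

subsection \<open>The spectral decomposition of the torus\<close>

text \<open>The contributions of \<open>k\<close> and \<open>-k\<close> add up to a constant, since \<open>cas(s)\<^sup>2 + cas(-s)\<^sup>2 = 2\<close>.  What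
  remains is the Gaussian sum over the frequency lattice with \<open>c = \<tau> (2\<pi>/L)\<^sup>2\<close>.\<close>

lemma torus_trace:
  assumes "0 < \<tau>"
  shows "(\<Sum>k\<in>torus_modes R. exp (- \<tau> * (wave k \<bullet> wave k)) * torus_kernel k x x) \<le> 21/20 / (4 * pi * \<tau>)"
proof -
  define g where "g k = exp (- \<tau> * (wave k \<bullet> wave k)) * (cas (wave k \<bullet> x))\<^sup>2" for k
  define n where "n k = (- fst k, - snd k)" for k :: "int \<times> int"
  have "sum g (torus_modes R) = (\<Sum>k\<in>torus_modes R. g (n k))"
    by (rule sum.reindex_bij_witness[of _ n n]) (auto simp: n_def torus_modes_def)
  then have "sum g (torus_modes R) = (\<Sum>k\<in>torus_modes R. (g k + g (n k)) / 2)"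
    by (simp add: sum.distrib sum_divide_distrib[symmetric])
  also have "\<dots> = (\<Sum>k\<in>torus_modes R. exp (- \<tau> * (wave k \<bullet> wave k)))"
  proof (rule sum.cong[OF refl])
    fix k
    have "(cas s)\<^sup>2 + (cas (- s))\<^sup>2 = 2" for s
      using sin_cos_squared_add[of s] by (simp add: cas_def power2_eq_square algebra_simps)
    then have "(cas (wave k \<bullet> x))\<^sup>2 + (cas (- (wave k \<bullet> x)))\<^sup>2 = 2" .
    then show "(g k + g (n k)) / 2 = exp (- \<tau> * (wave k \<bullet> wave k))"
      by (simp add: g_def n_def wave_minus distrib_left[symmetric])
  qed
  also have "\<dots> = (\<Sum>(k, l)\<in>torus_modes R. exp (- (\<tau> * (2 * pi / L)\<^sup>2) * ((of_int k)\<^sup>2 + (of_int l)\<^sup>2)))"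
    by (intro sum.cong) (auto simp: wave_square)
  also have "\<dots> \<le> 21/20 * pi / (\<tau> * (2 * pi / L)\<^sup>2)"
    unfolding torus_modes_def by (rule lattice_gauss_sum_le) (use assms L in simp)
  finally have "sum g (torus_modes R) / L\<^sup>2 \<le> 21/20 * pi / (\<tau> * (2 * pi / L)\<^sup>2) / L\<^sup>2"
    by (rule divide_right_mono) simp
  also have "\<dots> = 21/20 / (4 * pi * \<tau>)"
    using L assms by (simp add: field_simps power2_eq_square)
  also have "sum g (torus_modes R) / L\<^sup>2 = (\<Sum>k\<in>torus_modes R. exp (- \<tau> * (wave k \<bullet> wave k)) * torus_kernel k x x)"
    by (simp add: sum_divide_distrib g_def torus_kernel_def power2_eq_square)
  finally show ?thesis .
qed

lemma torus_spectral_surface: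
  "spectral_surface (T2 L) torus_kernel
    (\<lambda>k x y. (cas (wave k \<bullet> x) / L\<^sup>2 * cas' (wave k \<bullet> y)) *\<^sub>R wave k)
    (\<lambda>k. wave k \<bullet> wave k) torus_modes (21/20)"
proof (rule spectral_surface.intro)
  have cw: "continuous_on UNIV (\<lambda>y. cas (wave k \<bullet> y))" "continuous_on UNIV (\<lambda>y. cas' (wave k \<bullet> y))" for k
    by (rule continuous_on_compose2[OF cas_continuous(1)[of UNIV]] continuous_on_compose2[OF cas_continuous(2)[of UNIV]];
        auto intro!: continuous_intros)+
  note [measurable] = torus_borel[OF cw(1)] torus_borel[OF cw(2)]
  show "finite_measure (vol (T2 L))" by (rule torus_finite_measure)
  show "\<phi> \<in> borel_measurable (vol (T2 L)) \<and> G \<in> borel_measurable (vol (T2 L))"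
    if "smooth_grad (T2 L) \<phi> G" for \<phi> G
    using smooth_torus[OF that] by (auto intro: torus_borel)
  show "\<exists>C. \<forall>x\<in>space (vol (T2 L)). \<bar>\<phi> x\<bar> \<le> C \<and> norm (G x) \<le> C" if sm: "smooth_grad (T2 L) \<phi> G" for \<phi> G
  proof -
    obtain C C' where C: "\<And>x. x \<in> period_square \<Longrightarrow> norm (\<phi> x) \<le> C" "\<And>x. x \<in> period_square \<Longrightarrow> norm (G x) \<le> C'"
      using torus_bounded[OF smooth_torus(1)[OF sm]] torus_bounded[OF smooth_torus(2)[OF sm]] by blast
    then show ?thesis by (intro exI[of _ "max C C'"]) (force simp: le_max_iff_disj)
  qed
  show "finite (torus_modes R)" for R by (simp add: torus_modes_def)
  show "mono torus_modes" by (rule torus_modes_mono)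
  show "0 < wave k \<bullet> wave k" if "k \<in> torus_modes R" for k R
    using that by (simp add: torus_modes_def wave_eq_0_iff)
  show "case_prod (torus_kernel k) \<in> borel_measurable (vol (T2 L) \<Otimes>\<^sub>M vol (T2 L))" for k
    unfolding torus_kernel_def [abs_def] by measurable
  show "(\<lambda>(x, y). (cas (wave k \<bullet> x) / L\<^sup>2 * cas' (wave k \<bullet> y)) *\<^sub>R wave k)
      \<in> borel_measurable (vol (T2 L) \<Otimes>\<^sub>M vol (T2 L))" for k
    by measurable
  show "\<exists>C. \<forall>x\<in>space (vol (T2 L)). \<forall>y\<in>space (vol (T2 L)). \<bar>torus_kernel k x y\<bar> \<le> C \<and>
      norm ((cas (wave k \<bullet> x) / L\<^sup>2 * cas' (wave k \<bullet> y)) *\<^sub>R wave k) \<le> C" for k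
  proof (intro exI[of _ "2 / L\<^sup>2 * 2 * (1 + norm (wave k))"] ballI conjI)
    fix x y
    have "\<bar>torus_kernel k x y\<bar> \<le> 2 / L\<^sup>2 * 2"
      unfolding torus_kernel_def abs_mult abs_divide
      by (intro mult_mono) (auto intro!: divide_right_mono cas_bounds)
    also have "\<dots> \<le> 2 / L\<^sup>2 * 2 * (1 + norm (wave k))"
      using L by (simp add: field_simps)
    finally show "\<bar>torus_kernel k x y\<bar> \<le> 2 / L\<^sup>2 * 2 * (1 + norm (wave k))" .
    show "norm ((cas (wave k \<bullet> x) / L\<^sup>2 * cas' (wave k \<bullet> y)) *\<^sub>R wave k) \<le> 2 / L\<^sup>2 * 2 * (1 + norm (wave k))"
      unfolding norm_scaleR abs_mult abs_divide
      by (intro mult_mono) (auto intro!: divide_right_mono cas_bounds)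
  qed
  show "torus_kernel k x y = torus_kernel k y x" for k x y
    by (simp add: torus_kernel_def)
  show "(\<integral>y. torus_kernel i x y * torus_kernel j y z \<partial>vol (T2 L)) = (if i = j then torus_kernel i x z else 0)"
    for i j x z
  proof -
    have "(\<integral>y. torus_kernel i x y * torus_kernel j y z \<partial>vol (T2 L))
        = (\<integral>y. (cas (wave i \<bullet> x) / L\<^sup>2 * (cas (wave j \<bullet> z) / L\<^sup>2)) * (cas (wave i \<bullet> y) * cas (wave j \<bullet> y)) \<partial>vol (T2 L))"
      by (simp add: torus_kernel_def ac_simps)
    also have "\<dots> = (if i = j then torus_kernel i x z else 0)"
      using L by (simp add: cas_orthogonal torus_kernel_def power2_eq_square)
    finally show ?thesis .
  qed
  show "smooth_grad (T2 L) (torus_kernel k x) (\<lambda>y. (cas (wave k \<bullet> x) / L\<^sup>2 * cas' (wave k \<bullet> y)) *\<^sub>R wave k)" for k x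
    unfolding torus_kernel_def [abs_def] by (rule smooth_grad_cas)
  show "(\<integral>y. G y \<bullet> ((cas (wave k \<bullet> x) / L\<^sup>2 * cas' (wave k \<bullet> y)) *\<^sub>R wave k) \<partial>vol (T2 L))
      = (wave k \<bullet> wave k) * (\<integral>y. \<phi> y * torus_kernel k x y \<partial>vol (T2 L))"
    if "smooth_grad (T2 L) \<phi> G" for \<phi> G k x
    unfolding torus_kernel_def by (rule torus_green[OF that])
  show "\<exists>q. kernel_span torus_kernel torus_modes (space (vol (T2 L))) q \<and>
      (\<forall>y\<in>space (vol (T2 L)). \<bar>\<phi> y - q y\<bar> \<le> \<epsilon>)"
    if sm: "smooth_grad (T2 L) \<phi> G" and e: "0 < \<epsilon>" for \<phi> G \<epsilon>
  proof -
    have "\<And>x i. \<phi> (x + axis i L) = \<phi> x" using sm by (simp add: smooth_grad_T2)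
    from torus_dense[OF this smooth_torus(1)[OF sm] e] show ?thesis
      unfolding torus_space using trig_poly_kernel_span by blast
  qed
  show "(\<Sum>k\<in>torus_modes R. exp (- \<tau> * (wave k \<bullet> wave k)) * torus_kernel k x x) \<le> 21/20 / (4 * pi * \<tau>)"
    if "0 < \<tau>" for R x \<tau> by (rule torus_trace[OF that])
  show "smooth_grad (T2 L) (\<lambda>_. 1) (\<lambda>_. 0)"
    using smooth_grad_cas[of 1 "(0, 0)"] by (simp add: wave_0 cas_def)
qed simp

end

section \<open>The round sphere\<close>

abbreviation "sph \<equiv> (sphere 0 1 :: (real^3) set)"

lemma vol_S2: "vol S2 = sphere_measure"
  by (simp add: S2_def)

lemma smooth_grad_S2:
  "smooth_grad S2 f G \<longleftrightarrow> (\<exists>U. open U \<and> sph \<subseteq> U \<and> smooth_on U f) \<and>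
    (\<forall>x\<in>sph. G x \<bullet> x = 0 \<and> (f has_derivative (\<lambda>h. G x \<bullet> h)) (at x within sph))"
  by (simp add: S2_def)

subsection \<open>Spherical coordinates\<close>

lemma spherical_coords_continuous: "continuous_on X spherical_coords"
proof (rule continuous_on_componentwise_vec)
  fix i :: 3
  show "continuous_on X (\<lambda>p. spherical_coords p $ i)"
    using exhaust_3[of i]
    by (elim disjE) (auto simp: spherical_coords_def case_prod_beta intro!: continuous_intros)
qed

lemma spherical_coords_sphere: "spherical_coords p \<in> sph"
proof -
  have "(sin a * cos b)\<^sup>2 + (sin a * sin b)\<^sup>2 + (cos a)\<^sup>2 = 1" for a b :: real
  proof -
    have "(sin a * cos b)\<^sup>2 + (sin a * sin b)\<^sup>2 = (sin a)\<^sup>2 * ((sin b)\<^sup>2 + (cos b)\<^sup>2)"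
      by algebra
    then show ?thesis by simp
  qed
  then have "spherical_coords p \<bullet> spherical_coords p = 1"
    by (simp only: inner_vec_def sum_3 spherical_coords_def case_prod_beta inner_real_def vector_3 power2_eq_square)
  then show ?thesis by (simp only: mem_sphere_0 norm_eq_1)
qed

abbreviation "coord_domain \<equiv> {0..pi} \<times> {0..2 * pi}"

lemma coord_domain_borel [measurable]: "coord_domain \<in> sets (borel :: (real \<times> real) measure)"
  by (intro borel_closed closed_Times) auto

lemma sphere_space [simp]: "space sphere_measure = sph"
  by (simp add: sphere_measure_def space_restrict_space)

lemma sphere_sets: "sets sphere_measure = sets (restrict_space borel sph)"
  by (simp add: sphere_measure_def)

lemma sphere_borel:
  fixes h :: "real^3 \<Rightarrow> 'b::{second_countable_topology, topological_space}"
  assumes "continuous_on sph h"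
  shows "h \<in> borel_measurable sphere_measure"
  using borel_measurable_continuous_on_restrict[OF assms] measurable_cong_sets[OF sphere_sets refl] by blast

lemma spherical_coords_measurable:
  "spherical_coords \<in> restrict_space lborel coord_domain \<rightarrow>\<^sub>M restrict_space borel sph"
proof (rule measurable_restrict_space2)
  show "spherical_coords \<in> borel_measurable (restrict_space lborel coord_domain)"
    by (rule measurable_restrict_space1) (simp add: borel_measurable_continuous_onI spherical_coords_continuous)
  show "spherical_coords \<in> space (restrict_space lborel coord_domain) \<rightarrow> sph"
    by (rule Pi_I) (rule spherical_coords_sphere)
qed

lemma area_density_borel: "(\<lambda>p :: real \<times> real. sin (fst p)) \<in> borel_measurable borel"
  by (intro borel_measurable_continuous_onI continuous_intros)

lemma sphere_finite_measure: "finite_measure sphere_measure"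
proof -
  let ?M = "restrict_space lborel coord_domain :: (real \<times> real) measure"
  have d: "(\<lambda>(\<theta>, \<phi>). ennreal (sin \<theta>)) \<in> borel_measurable ?M"
  proof -
    have "(\<lambda>p. sin (fst p)) \<in> borel_measurable ?M"
      by (rule measurable_restrict_space1) (simp add: area_density_borel)
    then have "(\<lambda>p. ennreal (sin (fst p))) \<in> borel_measurable ?M" by measurable
    then show ?thesis by (simp add: case_prod_beta')
  qed
  have "emeasure (density ?M (\<lambda>(\<theta>, \<phi>). ennreal (sin \<theta>))) (space ?M)
      = (\<integral>\<^sup>+p. (\<lambda>(\<theta>, \<phi>). ennreal (sin \<theta>)) p * indicator (space ?M) p \<partial>?M)"
    by (rule emeasure_density[OF d sets.top])
  also have "\<dots> \<le> (\<integral>\<^sup>+p. 1 \<partial>?M)"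
    by (intro nn_integral_mono) (auto simp: case_prod_beta indicator_def split: if_splits)
  also have "\<dots> = emeasure ?M (space ?M)" by simp
  also have "\<dots> = emeasure lborel coord_domain"
    by (subst emeasure_restrict_space) (auto simp: space_restrict_space)
  also have "\<dots> < \<infinity>"
    using emeasure_lborel_cbox_finite[of "(0, 0)" "(pi, 2 * pi)"] by (simp add: cbox_Pair_eq)
  finally have fin: "emeasure (density ?M (\<lambda>(\<theta>, \<phi>). ennreal (sin \<theta>))) (space ?M) < \<infinity>" .
  have "finite_measure (density ?M (\<lambda>(\<theta>, \<phi>). ennreal (sin \<theta>)))"
    by (rule finite_measureI) (use fin in auto)
  then show ?thesis
    unfolding sphere_measure_def
    by (rule finite_measure.finite_measure_distr) (use spherical_coords_measurable in simp)
qed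

lemma sphere_integral:
  fixes h :: "real^3 \<Rightarrow> real"
  assumes h: "continuous_on sph h"
  shows "(\<integral>x. h x \<partial>sphere_measure)
    = (\<integral>p. indicator coord_domain p * (sin (fst p) * h (spherical_coords p)) \<partial>lborel)"
proof -
  let ?M = "restrict_space lborel coord_domain :: (real \<times> real) measure"
  have hb: "h \<in> borel_measurable (restrict_space borel sph)"
    by (rule borel_measurable_continuous_on_restrict[OF h])
  have hX: "(\<lambda>p. h (spherical_coords p)) \<in> borel_measurable ?M"
    by (rule measurable_compose[OF spherical_coords_measurable hb])
  have d: "(\<lambda>p. sin (fst p)) \<in> borel_measurable ?M"
    using measurable_restrict_space1[of _ lborel borel] area_density_borel by simp
  have pos: "AE p in ?M. 0 \<le> sin (fst p)"
    by (rule AE_I2) (auto simp: space_restrict_space intro: sin_ge_zero)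
  have "(\<integral>x. h x \<partial>sphere_measure) = (\<integral>p. h (spherical_coords p) \<partial>density ?M (\<lambda>p. ennreal (sin (fst p))))"
    unfolding sphere_measure_def case_prod_beta
    by (rule integral_distr) (use spherical_coords_measurable hb in simp_all)
  also have "\<dots> = (\<integral>p. sin (fst p) *\<^sub>R h (spherical_coords p) \<partial>?M)"
    by (rule integral_density[OF hX d pos])
  also have "\<dots> = (\<integral>p. indicator coord_domain p *\<^sub>R (sin (fst p) *\<^sub>R h (spherical_coords p)) \<partial>lborel)"
    by (rule integral_restrict_space) simp
  finally show ?thesis by simp
qed

lemma sphere_bounded:
  fixes h :: "real^3 \<Rightarrow> 'b::real_normed_vector"
  assumes "continuous_on sph h"
  shows "\<exists>C. \<forall>x\<in>sph. norm (h x) \<le> C"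
  using compact_imp_bounded[OF compact_continuous_image[OF assms compact_sphere]]
  unfolding bounded_iff by blast

lemma sphere_integrable:
  fixes h :: "real^3 \<Rightarrow> real"
  assumes "continuous_on sph h"
  shows "integrable sphere_measure h"
proof -
  interpret finite_measure sphere_measure by (rule sphere_finite_measure)
  obtain C where "\<And>x. x \<in> sph \<Longrightarrow> norm (h x) \<le> C" using sphere_bounded[OF assms] by blast
  then show ?thesis
    by (intro integrable_const_bound[where B = C] sphere_borel assms AE_I2) auto
qed

lemma sphere_area: "(\<integral>x. (1::real) \<partial>sphere_measure) = 4 * pi"
proof -
  have "(\<integral>x. (1::real) \<partial>sphere_measure)
      = (\<integral>p. indicator coord_domain p * (sin (fst p) * 1) \<partial>lborel)"
    by (rule sphere_integral) (rule continuous_on_const)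
  also have "\<dots> = (\<integral>p. indicator coord_domain p * sin (fst p) \<partial>(lborel \<Otimes>\<^sub>M lborel))"
    unfolding lborel_prod by simp
  also have "\<dots> = (\<integral>x. (\<integral>y. indicator coord_domain (x, y) * sin (fst (x, y)) \<partial>lborel) \<partial>lborel)"
  proof (rule lborel_pair.integral_fst'[symmetric])
    show "integrable (lborel \<Otimes>\<^sub>M lborel) (\<lambda>p. indicator coord_domain p * sin (fst p) :: real)"
      unfolding lborel_prod by (rule rectangle_integrable) (intro continuous_intros)
  qed
  also have "\<dots> = (\<integral>x. 2 * pi * (sin x * indicator {0..pi} x) \<partial>(lborel :: real measure))"
  proof (rule Bochner_Integration.integral_cong[OF refl])
    fix x :: real
    have "(\<integral>y. indicator coord_domain (x, y) * sin (fst (x, y)) \<partial>lborel)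
        = (\<integral>y. (sin x * indicator {0..pi} x) * indicator {0..2 * pi} y \<partial>(lborel :: real measure))"
      by (rule Bochner_Integration.integral_cong) (auto simp: indicator_times)
    also have "\<dots> = (sin x * indicator {0..pi} x) * (2 * pi)" by simp
    finally show "(\<integral>y. indicator coord_domain (x, y) * sin (fst (x, y)) \<partial>lborel)
        = 2 * pi * (sin x * indicator {0..pi} x)" by (simp only: mult.commute)
  qed
  also have "\<dots> = 2 * pi * (\<integral>x. sin x * indicator {0..pi} x \<partial>(lborel :: real measure))"
    by simp
  also have "(\<integral>x. sin x * indicator {0..pi} x \<partial>(lborel :: real measure)) = (- cos pi) - (- cos 0)"
    by (rule integral_FTC_Icc_real) (auto intro!: derivative_eq_intros)
  finally show ?thesis by simp
qed

subsection \<open>Tangential gradients\<close>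

text \<open>The divergence theorem is applied to products of functions.  One continuous derivative suffices for
  it, and products of such functions are covered by the product rule.\<close>

definition C1_sphere :: "(real^3 \<Rightarrow> real) \<Rightarrow> (real^3 \<Rightarrow> real^3) \<Rightarrow> bool" where
  "C1_sphere f G \<longleftrightarrow> continuous_on sph f \<and> continuous_on sph G \<and>
    (\<forall>x\<in>sph. G x \<bullet> x = 0 \<and> (f has_derivative (\<lambda>h. G x \<bullet> h)) (at x within sph))"

lemma C1_sphere_curve:
  assumes f: "(f has_derivative (\<lambda>h. g \<bullet> h)) (at (c s) within sph)"
    and c: "\<And>s. c s \<in> sph" "(c has_vector_derivative c') (at s)"
  shows "((\<lambda>s. f (c s)) has_real_derivative g \<bullet> c') (at s)"
proof -
  have "(f has_derivative (\<lambda>h. g \<bullet> h)) (at (c s) within c ` UNIV)"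
    by (rule has_derivative_subset[OF f]) (use c(1) in auto)
  moreover have "(c has_derivative (\<lambda>h. h *\<^sub>R c')) (at s)"
    using c(2) by (simp add: has_vector_derivative_def)
  ultimately have "((\<lambda>s. f (c s)) has_derivative (\<lambda>h. g \<bullet> (h *\<^sub>R c'))) (at s)"
    by (intro has_derivative_in_compose[of c _ s UNIV f]) auto
  then show ?thesis by (simp add: has_field_derivative_def mult.commute[of _ "g \<bullet> c'"])
qed

text \<open>On the sphere \<open>|y|\<^sup>2\<close> is constant, so the normal part of the gradient does not contribute to
  the derivative along the sphere.\<close>

lemma tangential_derivative:
  assumes f: "GDERIV f x :> \<Gamma>" and x: "x \<in> sph"
  shows "(f has_derivative (\<lambda>h. (\<Gamma> - (\<Gamma> \<bullet> x) *\<^sub>R x) \<bullet> h)) (at x within sph)"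
proof -
  let ?g = "\<lambda>y. f y - (\<Gamma> \<bullet> x) / 2 * (y \<bullet> y - 1)"
  have f': "(f has_derivative (\<lambda>h. h \<bullet> \<Gamma>)) (at x)" using f by (simp add: gderiv_def)
  have d: "(?g has_derivative (\<lambda>h. h \<bullet> \<Gamma> - (\<Gamma> \<bullet> x) / 2 * (x \<bullet> h + h \<bullet> x))) (at x)"
    by (auto intro!: derivative_eq_intros f')
  have eq: "(\<lambda>h. h \<bullet> \<Gamma> - (\<Gamma> \<bullet> x) / 2 * (x \<bullet> h + h \<bullet> x)) = (\<lambda>h. (\<Gamma> - (\<Gamma> \<bullet> x) *\<^sub>R x) \<bullet> h)"
  proof
    fix h
    show "h \<bullet> \<Gamma> - (\<Gamma> \<bullet> x) / 2 * (x \<bullet> h + h \<bullet> x) = (\<Gamma> - (\<Gamma> \<bullet> x) *\<^sub>R x) \<bullet> h"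
      by (simp add: inner_diff_left inner_commute[of h \<Gamma>] inner_commute[of h x])
  qed
  have "(?g has_derivative (\<lambda>h. (\<Gamma> - (\<Gamma> \<bullet> x) *\<^sub>R x) \<bullet> h)) (at x within sph)"
    by (rule has_derivative_at_withinI[OF d[unfolded eq]])
  then show ?thesis
    by (rule has_derivative_transform_within[OF _ zero_less_one x])
      (simp add: norm_eq_1)
qed

text \<open>Differentiate along the great circle through \<open>x\<close> in the direction of \<open>g - k\<close>.\<close>

lemma tangential_gradient_unique:
  assumes x: "x \<in> sph" and g: "g \<bullet> x = 0" and k: "k \<bullet> x = 0"
    and dg: "(f has_derivative (\<lambda>h. g \<bullet> h)) (at x within sph)"
    and dk: "(f has_derivative (\<lambda>h. k \<bullet> h)) (at x within sph)"
  shows "g = k"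
proof (rule ccontr)
  assume ne: "g \<noteq> k"
  define u where "u = (g - k) /\<^sub>R norm (g - k)"
  define c where "c s = cos s *\<^sub>R x + sin s *\<^sub>R u" for s
  have xx: "x \<bullet> x = 1" using x by (simp add: norm_eq_1)
  have uu: "u \<bullet> u = 1" using ne by (simp add: u_def dot_square_norm power2_eq_square)
  have ux: "u \<bullet> x = 0" using g k by (simp add: u_def inner_diff_left)
  have c: "c s \<in> sph" for s
  proof -
    have "c s \<bullet> c s = cos s * cos s + sin s * sin s"
      using xx uu ux by (simp add: c_def inner_add_left inner_add_right inner_commute)
    then have "c s \<bullet> c s = 1" using sin_cos_squared_add3[of s] by simp
    then show ?thesis by (simp add: norm_eq_1)
  qed
  have c': "(c has_vector_derivative u) (at 0)"
    unfolding c_def [abs_def]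
    by (auto intro!: derivative_eq_intros simp: has_vector_derivative_def)
  have c0: "c 0 = x" by (simp add: c_def)
  have "((\<lambda>s. f (c s)) has_real_derivative g \<bullet> u) (at 0)"
    by (rule C1_sphere_curve) (use dg c c' c0 in simp_all)
  moreover have "((\<lambda>s. f (c s)) has_real_derivative k \<bullet> u) (at 0)"
    by (rule C1_sphere_curve) (use dk c c' c0 in simp_all)
  ultimately have "g \<bullet> u = k \<bullet> u" by (rule DERIV_unique)
  then have "(g - k) \<bullet> u = 0" by (simp add: inner_diff_left)
  then show False using ne by (simp add: u_def)
qed

lemma smooth_C1_sphere:
  assumes sm: "smooth_grad S2 f G"
  shows "C1_sphere f G"
proof -
  from sm obtain U where U: "open U" "sph \<subseteq> U" "smooth_on U f"
    and G: "\<And>x. x \<in> sph \<Longrightarrow> G x \<bullet> x = 0"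
      "\<And>x. x \<in> sph \<Longrightarrow> (f has_derivative (\<lambda>h. G x \<bullet> h)) (at x within sph)"
    unfolding smooth_grad_S2 by blast
  obtain \<Gamma> where \<Gamma>: "\<And>x. x \<in> U \<Longrightarrow> GDERIV f x :> \<Gamma> x" and cont: "continuous_on U \<Gamma>"
    using smooth_on_gradient[OF U(3)] by blast
  have eq: "G x = \<Gamma> x - (\<Gamma> x \<bullet> x) *\<^sub>R x" if x: "x \<in> sph" for x
  proof (rule tangential_gradient_unique[OF x G(1)[OF x] _ G(2)[OF x]])
    show "(\<Gamma> x - (\<Gamma> x \<bullet> x) *\<^sub>R x) \<bullet> x = 0"
      using x by (simp add: inner_diff_left norm_eq_1)
    show "(f has_derivative (\<lambda>h. (\<Gamma> x - (\<Gamma> x \<bullet> x) *\<^sub>R x) \<bullet> h)) (at x within sph)"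
      by (rule tangential_derivative[OF \<Gamma> x]) (use x U in auto)
  qed
  have "continuous_on sph (\<lambda>x. \<Gamma> x - (\<Gamma> x \<bullet> x) *\<^sub>R x)"
    by (intro continuous_intros continuous_on_subset[OF cont] U)
  then have "continuous_on sph G" by (subst continuous_on_cong[OF refl eq])
  moreover have "continuous_on sph f"
    by (rule continuous_on_subset[OF smooth_on_continuous[OF U(3)] U(2)])
  ultimately show ?thesis using G by (simp add: C1_sphere_def)
qed

lemma C1_sphereD:
  assumes "C1_sphere f G"
  shows "continuous_on sph f" "continuous_on sph G"
    "\<And>x. x \<in> sph \<Longrightarrow> G x \<bullet> x = 0"
    "\<And>x. x \<in> sph \<Longrightarrow> (f has_derivative (\<lambda>h. G x \<bullet> h)) (at x within sph)"
proof -
  note C = assms[unfolded C1_sphere_def]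
  show "continuous_on sph f" by (rule C[THEN conjunct1])
  show "continuous_on sph G" by (rule C[THEN conjunct2, THEN conjunct1])
  fix x assume x: "x \<in> sph"
  note D = bspec[OF C[THEN conjunct2, THEN conjunct2] x]
  show "G x \<bullet> x = 0" by (rule D[THEN conjunct1])
  show "(f has_derivative (\<lambda>h. G x \<bullet> h)) (at x within sph)" by (rule D[THEN conjunct2])
qed

lemma C1_sphere_mult:
  assumes f: "C1_sphere f F" and g: "C1_sphere g G"
  shows "C1_sphere (\<lambda>x. f x * g x) (\<lambda>x. f x *\<^sub>R G x + g x *\<^sub>R F x)"
  unfolding C1_sphere_def
proof (intro conjI ballI)
  show "continuous_on sph (\<lambda>x. f x * g x)" "continuous_on sph (\<lambda>x. f x *\<^sub>R G x + g x *\<^sub>R F x)"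
    by (intro continuous_on_mult continuous_on_add continuous_on_scaleR
        C1_sphereD(1,2)[OF f] C1_sphereD(1,2)[OF g])+
  fix x assume x: "x \<in> sph"
  show "(f x *\<^sub>R G x + g x *\<^sub>R F x) \<bullet> x = 0"
    by (simp add: inner_add_left C1_sphereD(3)[OF f x] C1_sphereD(3)[OF g x])
  have "((\<lambda>x. f x * g x) has_derivative (\<lambda>h. f x * (G x \<bullet> h) + (F x \<bullet> h) * g x)) (at x within sph)"
    by (rule has_derivative_mult[OF C1_sphereD(4)[OF f x] C1_sphereD(4)[OF g x]])
  moreover have "(\<lambda>h. f x * (G x \<bullet> h) + (F x \<bullet> h) * g x) = (\<lambda>h. (f x *\<^sub>R G x + g x *\<^sub>R F x) \<bullet> h)"
    by (auto simp: inner_add_left mult.commute)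
  ultimately show "((\<lambda>x. f x * g x) has_derivative (\<lambda>h. (f x *\<^sub>R G x + g x *\<^sub>R F x) \<bullet> h)) (at x within sph)"
    by (simp only:)
qed

subsection \<open>The divergence theorem\<close>

text \<open>Trigonometric bookkeeping for the divergence theorem: \<open>s\<close>, \<open>c\<close>, \<open>S\<close>, \<open>C\<close> are the sines and cosines
  of \<open>\<theta>\<close> and \<open>\<phi>\<close>, the vector \<open>(g, h, k)\<close> is tangent at the point with these coordinates, and \<open>F\<close> is
  the value of the function.  With \<open>F\<^sub>\<theta> = c C g + c S h - s k\<close> and \<open>F\<^sub>\<phi> / s = - S g + C h\<close> the right-hand
  sides are total derivatives: \<open>\<partial>\<^sub>\<theta>(s c C F) - \<partial>\<^sub>\<phi>(S F)\<close>, \<open>\<partial>\<^sub>\<theta>(s c S F) + \<partial>\<^sub>\<phi>(C F)\<close> and \<open>- \<partial>\<^sub>\<theta>(s\<^sup>2 F)\<close>.\<close>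

lemma divergence_identity:
  fixes s c S C g h k F :: real
  assumes "s * C * g + s * S * h + c * k = 0" "s * s + c * c = 1" "S * S + C * C = 1"
  shows "s * (g - 2 * F * (s * C)) = (c * c - s * s) * C * F
      + s * c * C * (c * C * g + c * S * h - s * k) + (- C * F - S * (- s * S * g + s * C * h))"
    and "s * (h - 2 * F * (s * S)) = (c * c - s * s) * S * F
      + s * c * S * (c * C * g + c * S * h - s * k) + (- S * F + C * (- s * S * g + s * C * h))"
    and "s * (k - 2 * F * c) = - 2 * s * c * F - s * s * (c * C * g + c * S * h - s * k)"
proof -
  define m where "m = C * g + S * h"
  have ck: "c * k = - (s * m)" using assms(1) by (simp add: m_def algebra_simps)
  have cc: "c * c = 1 - s * s" using assms(2) by simp
  have A: "s * c * (c * C * g + c * S * h - s * k) = s * m"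
  proof -
    have "s * c * (c * C * g + c * S * h - s * k) = s * ((c * c) * m - s * (c * k))"
      by (simp add: m_def algebra_simps)
    then show ?thesis unfolding ck cc by (simp add: algebra_simps)
  qed
  have g: "s * C * m - S * (- s * S * g + s * C * h) = s * g" "s * S * m + C * (- s * S * g + s * C * h) = s * h"
  proof -
    have "s * C * m - S * (- s * S * g + s * C * h) = s * g * (S * S + C * C)"
      "s * S * m + C * (- s * S * g + s * C * h) = s * h * (S * S + C * C)"
      by (simp_all add: m_def algebra_simps)
    then show "s * C * m - S * (- s * S * g + s * C * h) = s * g" "s * S * m + C * (- s * S * g + s * C * h) = s * h"
      using assms(3) by simp_all
  qed
  have A': "s * c * D * (c * C * g + c * S * h - s * k) = s * D * m" for D
    using arg_cong[OF A, of "\<lambda>t. D * t"] by (simp add: ac_simps)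
  show "s * (g - 2 * F * (s * C)) = (c * c - s * s) * C * F
      + s * c * C * (c * C * g + c * S * h - s * k) + (- C * F - S * (- s * S * g + s * C * h))"
  proof -
    have "(c * c - s * s) * C * F + s * c * C * (c * C * g + c * S * h - s * k)
        + (- C * F - S * (- s * S * g + s * C * h))
      = (c * c - s * s - 1) * C * F + (s * C * m - S * (- s * S * g + s * C * h))"
      unfolding A' by (simp add: left_diff_distrib)
    also have "\<dots> = (- 2 * (s * s)) * C * F + s * g"
      unfolding g cc by simp
    finally show ?thesis by (simp add: algebra_simps)
  qed
  show "s * (h - 2 * F * (s * S)) = (c * c - s * s) * S * F
      + s * c * S * (c * C * g + c * S * h - s * k) + (- S * F + C * (- s * S * g + s * C * h))"
  proof -
    have "(c * c - s * s) * S * F + s * c * S * (c * C * g + c * S * h - s * k)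
        + (- S * F + C * (- s * S * g + s * C * h))
      = (c * c - s * s - 1) * S * F + (s * S * m + C * (- s * S * g + s * C * h))"
      unfolding A' by (simp add: left_diff_distrib)
    also have "\<dots> = (- 2 * (s * s)) * S * F + s * h"
      unfolding g cc by simp
    finally show ?thesis by (simp add: algebra_simps)
  qed
  have "s * s * (c * C * g + c * S * h - s * k) = s * (c * (s * m) - s * s * k)"
    by (simp add: m_def algebra_simps)
  also have "s * m = - (c * k)" using ck by simp
  also have "s * (c * - (c * k) - s * s * k) = - (s * k * (s * s + c * c))"
    by (simp add: algebra_simps)
  finally have q: "s * s * (c * C * g + c * S * h - s * k) = - (s * k)" using assms(2) by simp
  show "s * (k - 2 * F * c) = - 2 * s * c * F - s * s * (c * C * g + c * S * h - s * k)"
    unfolding q by (simp add: algebra_simps)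
qed

text \<open>The tangential part of a constant field \<open>v\<close> has divergence \<open>-2 (y \<bullet> v)\<close> along the sphere.  In spherical coordinates the difference of the
  integrands is a sum of total derivatives (\<open>divergence_identity\<close>); the terms in \<open>\<theta>\<close> vanish at the poles
  because of the factor \<open>sin \<theta>\<close>, the ones in \<open>\<phi>\<close> are periodic.\<close>

lemma sphere_divergence:
  assumes C1: "C1_sphere f G"
  shows "(\<integral>y. G y \<bullet> v \<partial>sphere_measure) = 2 * (\<integral>y. f y * (y \<bullet> v) \<partial>sphere_measure)"
proof -
  let ?X = spherical_coords
  have cf: "continuous_on sph f" and cG: "continuous_on sph G"
    and tan: "\<And>x. x \<in> sph \<Longrightarrow> G x \<bullet> x = 0"
    and der: "\<And>x. x \<in> sph \<Longrightarrow> (f has_derivative (\<lambda>h. G x \<bullet> h)) (at x within sph)"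
    by (fact C1_sphereD[OF C1])+
  define g where "g i p = G (?X p) $ i" for i p
  define F where "F p = f (?X p)" for p
  have cF: "continuous_on UNIV F"
    unfolding F_def [abs_def]
    by (rule continuous_on_compose2[OF cf spherical_coords_continuous]) (use spherical_coords_sphere in auto)
  have cg: "continuous_on UNIV (g i)" for i
    unfolding g_def [abs_def]
    by (intro continuous_on_component continuous_on_compose2[OF cG spherical_coords_continuous])
      (use spherical_coords_sphere in auto)
  have dth: "((\<lambda>a. F (a, b)) has_real_derivative
      cos a * cos b * g 1 (a, b) + cos a * sin b * g 2 (a, b) - sin a * g 3 (a, b)) (at a)" for a b
  proof -
    have "((\<lambda>a. f (?X (a, b))) has_real_derivative
        G (?X (a, b)) \<bullet> vector [cos a * cos b, cos a * sin b, - sin a]) (at a)"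
    proof (rule C1_sphere_curve[where c = "\<lambda>a. ?X (a, b)"])
      have e1: "(\<lambda>a. ?X (a, b)) = (\<lambda>a. sin a *\<^sub>R vector [cos b, sin b, 0] + cos a *\<^sub>R vector [0, 0, 1])"
        by (auto simp: spherical_coords_def vec_eq_iff forall_3)
      have e2: "(vector [cos a * cos b, cos a * sin b, - sin a] :: real^3)
          = cos a *\<^sub>R vector [cos b, sin b, 0] + (- sin a) *\<^sub>R vector [0, 0, 1]"
        by (auto simp: vec_eq_iff forall_3)
      show "((\<lambda>a. ?X (a, b)) has_vector_derivative vector [cos a * cos b, cos a * sin b, - sin a]) (at a)"
        unfolding e1 e2 by (auto intro!: derivative_eq_intros simp: has_vector_derivative_def algebra_simps)
    qed (use der spherical_coords_sphere in auto)
    moreover have "G (?X (a, b)) \<bullet> vector [cos a * cos b, cos a * sin b, - sin a]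
        = cos a * cos b * g 1 (a, b) + cos a * sin b * g 2 (a, b) - sin a * g 3 (a, b)"
      by (simp add: g_def inner_vec_def sum_3)
    ultimately show ?thesis unfolding F_def by (simp only:)
  qed
  have dph: "((\<lambda>b. F (a, b)) has_real_derivative
      - sin a * sin b * g 1 (a, b) + sin a * cos b * g 2 (a, b)) (at b)" for a b
  proof -
    have "((\<lambda>b. f (?X (a, b))) has_real_derivative
        G (?X (a, b)) \<bullet> vector [- sin a * sin b, sin a * cos b, 0]) (at b)"
    proof (rule C1_sphere_curve[where c = "\<lambda>b. ?X (a, b)"])
      have e1: "(\<lambda>b. ?X (a, b)) = (\<lambda>b. cos b *\<^sub>R vector [sin a, 0, 0] + sin b *\<^sub>R vector [0, sin a, 0]
          + vector [0, 0, cos a])"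
        by (auto simp: spherical_coords_def vec_eq_iff forall_3)
      have e2: "(vector [- sin a * sin b, sin a * cos b, 0] :: real^3)
          = (- sin b) *\<^sub>R vector [sin a, 0, 0] + cos b *\<^sub>R vector [0, sin a, 0]"
        by (auto simp: vec_eq_iff forall_3)
      show "((\<lambda>b. ?X (a, b)) has_vector_derivative vector [- sin a * sin b, sin a * cos b, 0]) (at b)"
        unfolding e1 e2 by (auto intro!: derivative_eq_intros simp: has_vector_derivative_def algebra_simps)
    qed (use der spherical_coords_sphere in auto)
    moreover have "G (?X (a, b)) \<bullet> vector [- sin a * sin b, sin a * cos b, 0]
        = - sin a * sin b * g 1 (a, b) + sin a * cos b * g 2 (a, b)"
      by (simp add: g_def inner_vec_def sum_3)
    ultimately show ?thesis unfolding F_def by (simp only:)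
  qed
  have tan': "sin a * cos b * g 1 (a, b) + sin a * sin b * g 2 (a, b) + cos a * g 3 (a, b) = 0" for a b
    using tan[OF spherical_coords_sphere[of "(a, b)"]]
    by (simp add: g_def inner_vec_def sum_3 spherical_coords_def ac_simps)
  have pyth: "sin a * sin a + cos a * cos a = 1" for a :: real
    using sin_cos_squared_add[of a] by (simp add: power2_eq_square)
  have X: "?X (a, b) $ 1 = sin a * cos b" "?X (a, b) $ 2 = sin a * sin b" "?X (a, b) $ 3 = cos a" for a b
    by (simp_all add: spherical_coords_def)
  define ft where "ft p = cos (fst p) * cos (snd p) * g 1 p + cos (fst p) * sin (snd p) * g 2 p - sin (fst p) * g 3 p" for p
  define fp where "fp p = - sin (fst p) * sin (snd p) * g 1 p + sin (fst p) * cos (snd p) * g 2 p" for p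
  have cft: "continuous_on UNIV ft" and cfp: "continuous_on UNIV fp"
    unfolding ft_def [abs_def] fp_def [abs_def] by (intro continuous_intros cg)+
  have dth': "((\<lambda>a. F (a, b)) has_real_derivative ft (a, b)) (at a)" for a b
    using dth[of b a] by (simp only: ft_def fst_conv snd_conv)
  have dph': "((\<lambda>b. F (a, b)) has_real_derivative fp (a, b)) (at b)" for a b
    using dph[of a b] by (simp only: fp_def fst_conv snd_conv)
  have cfst: "continuous_on UNIV (\<lambda>p :: real \<times> real. A (fst p))"
    and csnd: "continuous_on UNIV (\<lambda>p :: real \<times> real. A (snd p))"
    if "continuous_on UNIV A" for A :: "real \<Rightarrow> real"
    by (rule continuous_on_compose2[OF that], intro continuous_intros, simp)+
  have part1: "continuous_on UNIV (\<lambda>p. A' (fst p) * c (snd p) * F p + A (fst p) * c (snd p) * ft p)"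
    "(\<integral>p. indicator coord_domain p * (A' (fst p) * c (snd p) * F p + A (fst p) * c (snd p) * ft p) \<partial>lborel) = 0"
    if A: "\<And>a. (A has_real_derivative A' a) (at a)" "A 0 = 0" "A pi = 0" and cA: "continuous_on UNIV A'"
      and c: "continuous_on UNIV c" for A A' c :: "real \<Rightarrow> real"
  proof -
    have "continuous_on UNIV A" using A(1) by (auto simp: continuous_on_eq_continuous_at intro: DERIV_isCont)
    then show ct: "continuous_on UNIV (\<lambda>p. A' (fst p) * c (snd p) * F p + A (fst p) * c (snd p) * ft p)"
      by (intro continuous_on_add continuous_on_mult cfst csnd cA c cF cft)
    show "(\<integral>p. indicator coord_domain p * (A' (fst p) * c (snd p) * F p + A (fst p) * c (snd p) * ft p) \<partial>lborel) = 0"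
    proof (rule rectangle_derivative_fst[where H = "\<lambda>p. A (fst p) * c (snd p) * F p", OF _ ct])
      show "((\<lambda>a. A (fst (a, b)) * c (snd (a, b)) * F (a, b)) has_real_derivative
          A' (fst (a, b)) * c (snd (a, b)) * F (a, b) + A (fst (a, b)) * c (snd (a, b)) * ft (a, b)) (at a)" for a b
        using DERIV_mult[OF DERIV_cmult_right[OF A(1), of "c b"] dth'[of b a]]
        by (simp add: add.commute mult.commute mult.left_commute)
    qed (simp_all add: A)
  qed
  have part2: "continuous_on UNIV (\<lambda>p. B' (snd p) * F p + B (snd p) * fp p)"
    "(\<integral>p. indicator coord_domain p * (B' (snd p) * F p + B (snd p) * fp p) \<partial>lborel) = 0"
    if B: "\<And>a. (B has_real_derivative B' a) (at a)" "B (2 * pi) = B 0" and cB: "continuous_on UNIV B'"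
    for B B' :: "real \<Rightarrow> real"
  proof -
    have "continuous_on UNIV B" using B(1) by (auto simp: continuous_on_eq_continuous_at intro: DERIV_isCont)
    then show ct: "continuous_on UNIV (\<lambda>p. B' (snd p) * F p + B (snd p) * fp p)"
      by (intro continuous_on_add continuous_on_mult csnd cB cF cfp)
    show "(\<integral>p. indicator coord_domain p * (B' (snd p) * F p + B (snd p) * fp p) \<partial>lborel) = 0"
    proof (rule rectangle_derivative_snd[where H = "\<lambda>p. B (snd p) * F p", OF _ ct])
      show "((\<lambda>b. B (snd (a, b)) * F (a, b)) has_real_derivative
          B' (snd (a, b)) * F (a, b) + B (snd (a, b)) * fp (a, b)) (at b)" for a b
        using DERIV_mult[OF B(1)[of b] dph'[of a b]] by (simp add: mult.commute)
      show "B (snd (a, 2 * pi)) * F (a, 2 * pi) = B (snd (a, 0)) * F (a, 0)" for a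
        by (simp add: B F_def spherical_coords_def)
    qed simp
  qed
  have split: "(\<integral>p. indicator coord_domain p * (u p + w p) \<partial>lborel) = 0"
    if "continuous_on UNIV u" "continuous_on UNIV w"
      "(\<integral>p. indicator coord_domain p * u p \<partial>lborel) = 0" "(\<integral>p. indicator coord_domain p * w p \<partial>lborel) = 0"
    for u w :: "real \<times> real \<Rightarrow> real"
    using that rectangle_integrable[OF that(1)] rectangle_integrable[OF that(2)] by (simp add: distrib_left)
  have sc: "((\<lambda>a. sin a * cos a) has_real_derivative cos a * cos a - sin a * sin a) (at a)" for a :: real
    by (auto intro!: derivative_eq_intros)
  have csc: "continuous_on UNIV (\<lambda>a :: real. cos a * cos a - sin a * sin a)"
    "continuous_on UNIV (cos :: real \<Rightarrow> real)" "continuous_on UNIV (sin :: real \<Rightarrow> real)"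
    "continuous_on UNIV (\<lambda>a :: real. - cos a)" "continuous_on UNIV (\<lambda>a :: real. - sin a)"
    by (intro continuous_intros)+
  define e where "e i p = sin (fst p) * (g i p - 2 * F p * (?X p $ i))" for i p
  have e1: "e 1 p = ((cos (fst p) * cos (fst p) - sin (fst p) * sin (fst p)) * cos (snd p) * F p
        + sin (fst p) * cos (fst p) * cos (snd p) * ft p) + (- cos (snd p) * F p + - sin (snd p) * fp p)"
    and e2: "e 2 p = ((cos (fst p) * cos (fst p) - sin (fst p) * sin (fst p)) * sin (snd p) * F p
        + sin (fst p) * cos (fst p) * sin (snd p) * ft p) + (- sin (snd p) * F p + cos (snd p) * fp p)"
    and e3: "e 3 p = (- 2 * (sin (fst p) * cos (fst p))) * 1 * F p + - (sin (fst p) * sin (fst p)) * 1 * ft p" for p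
  proof -
    obtain a b where p: "p = (a, b)" by (cases p)
    note id = divergence_identity[OF tan'[of a b] pyth[of a] pyth[of b], of "F p"]
    show "e 1 p = ((cos (fst p) * cos (fst p) - sin (fst p) * sin (fst p)) * cos (snd p) * F p
        + sin (fst p) * cos (fst p) * cos (snd p) * ft p) + (- cos (snd p) * F p + - sin (snd p) * fp p)"
      using id(1) by (simp only: p e_def ft_def fp_def X fst_conv snd_conv diff_conv_add_uminus mult_minus_left)
    show "e 2 p = ((cos (fst p) * cos (fst p) - sin (fst p) * sin (fst p)) * sin (snd p) * F p
        + sin (fst p) * cos (fst p) * sin (snd p) * ft p) + (- sin (snd p) * F p + cos (snd p) * fp p)"
      using id(2) by (simp only: p e_def ft_def fp_def X fst_conv snd_conv)
    show "e 3 p = (- 2 * (sin (fst p) * cos (fst p))) * 1 * F p + - (sin (fst p) * sin (fst p)) * 1 * ft p"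
      using id(3) by (simp add: p e_def ft_def X)
  qed
  have zero: "(\<integral>p. indicator coord_domain p * e i p \<partial>lborel) = 0" for i
  proof -
    consider "i = 1" | "i = 2" | "i = 3" using exhaust_3[of i] by blast
    then show ?thesis
    proof cases
      case 1
      show ?thesis unfolding 1 e1
        by (intro split part1[of "\<lambda>a. sin a * cos a"] part2[of "\<lambda>b. - sin b"] sc csc)
          (auto intro!: derivative_eq_intros)
    next
      case 2
      show ?thesis unfolding 2 e2
        by (intro split part1[of "\<lambda>a. sin a * cos a"] part2[of cos] sc csc)
          (auto intro!: derivative_eq_intros)
    next
      case 3
      have "continuous_on UNIV (\<lambda>a :: real. - 2 * (sin a * cos a))" "continuous_on UNIV (\<lambda>a :: real. 1 :: real)"
        by (intro continuous_intros)+
      then show ?thesis unfolding 3 e3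
        by (intro part1(2)[of "\<lambda>a. - (sin a * sin a)"]) (auto intro!: derivative_eq_intros)
    qed
  qed
  have comp: "(\<integral>y. G y $ i - 2 * f y * (y $ i) \<partial>sphere_measure) = 0" for i
  proof (subst sphere_integral)
    show "continuous_on sph (\<lambda>y. G y $ i - 2 * f y * (y $ i))"
      by (intro continuous_intros cf cG)
    show "(\<integral>p. indicator coord_domain p * (sin (fst p) * (G (?X p) $ i - 2 * f (?X p) * (?X p $ i))) \<partial>lborel) = 0"
      using zero[of i] by (simp add: e_def g_def F_def)
  qed
  have "(\<integral>y. G y \<bullet> v - 2 * (f y * (y \<bullet> v)) \<partial>sphere_measure)
      = (\<integral>y. (\<Sum>i\<in>UNIV. v $ i * (G y $ i - 2 * f y * (y $ i))) \<partial>sphere_measure)"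
    by (simp add: inner_vec_def sum_distrib_left sum_subtractf algebra_simps)
  also have "\<dots> = (\<Sum>i\<in>UNIV. v $ i * (\<integral>y. G y $ i - 2 * f y * (y $ i) \<partial>sphere_measure))"
    by (subst Bochner_Integration.integral_sum)
      (auto intro!: integrable_mult_right sphere_integrable continuous_intros cf cG)
  also have "\<dots> = 0" by (simp add: comp)
  finally have "(\<integral>y. G y \<bullet> v - 2 * (f y * (y \<bullet> v)) \<partial>sphere_measure) = 0" .
  moreover have "integrable sphere_measure (\<lambda>y. G y \<bullet> v)" "integrable sphere_measure (\<lambda>y. f y * (y \<bullet> v))"
    by (intro sphere_integrable continuous_intros cf cG)+
  ultimately show ?thesis by simp
qed

subsection \<open>Legendre polynomials\<close>

fun legendre :: "nat \<Rightarrow> real poly" where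
  "legendre 0 = 1"
| "legendre (Suc 0) = [:0, 1:]"
| "legendre (Suc (Suc n)) = smult (1 / real (n + 2))
     (smult (real (2 * n + 3)) ([:0, 1:] * legendre (Suc n)) - smult (real (n + 1)) (legendre n))"

abbreviation "leg n t \<equiv> poly (legendre n) t"
abbreviation "leg' n t \<equiv> poly (pderiv (legendre n)) t"

lemma leg_rec: "real (n + 2) * leg (Suc (Suc n)) t = real (2 * n + 3) * t * leg (Suc n) t - real (n + 1) * leg n t"
  by (simp add: field_simps)

lemma leg'_rec:
  "real (n + 2) * leg' (Suc (Suc n)) t
    = real (2 * n + 3) * (leg (Suc n) t + t * leg' (Suc n) t) - real (n + 1) * leg' n t"
  by (simp add: pderiv_smult pderiv_diff pderiv_mult pderiv_pCons field_simps del: of_nat_Suc)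

lemma leg_at_1: "leg n 1 = 1"
proof (induction n rule: legendre.induct)
  case (3 n)
  have "real (n + 2) * leg (Suc (Suc n)) 1 = real (n + 2) * 1"
    unfolding leg_rec 3 by simp
  then show ?case by (simp only: mult_cancel_left) simp
qed simp_all

text \<open>The classical relations \<open>P'\<^sub>n\<^sub>+\<^sub>1 = t P'\<^sub>n + (n+1) P\<^sub>n\<close> and \<open>t P'\<^sub>n\<^sub>+\<^sub>1 - P'\<^sub>n = (n+1) P\<^sub>n\<^sub>+\<^sub>1\<close>.  Each
  follows from the other and the three-term recursion, so they are proved together.\<close>

lemma leg_derivative_relations:
  "leg' (Suc n) t = t * leg' n t + real (n + 1) * leg n t \<and>
   t * leg' (Suc n) t - leg' n t = real (n + 1) * leg (Suc n) t"
proof (induction n)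
  case 0
  show ?case by (simp add: pderiv_pCons)
next
  case (Suc n)
  let ?p = "leg n t" and ?q = "leg (Suc n) t" and ?p' = "leg' n t" and ?q' = "leg' (Suc n) t"
  define x where "x = real n"
  have r: "(x + 2) * leg (Suc (Suc n)) t = (2 * x + 3) * t * ?q - (x + 1) * ?p"
    using leg_rec[of n t] by (simp add: x_def add.commute)
  have r': "(x + 2) * leg' (Suc (Suc n)) t = (2 * x + 3) * (?q + t * ?q') - (x + 1) * ?p'"
    using leg'_rec[of n t] by (simp add: x_def add.commute)
  have IH: "?q' = t * ?p' + (x + 1) * ?p" "t * ?q' - ?p' = (x + 1) * ?q"
  proof -
    have x1: "real (n + 1) = x + 1" by (simp add: x_def)
    show "?q' = t * ?p' + (x + 1) * ?p" using Suc unfolding x1 by (rule conjunct1)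
    show "t * ?q' - ?p' = (x + 1) * ?q" using Suc unfolding x1 by (rule conjunct2)
  qed
  have nz: "x + 2 \<noteq> 0" by (simp add: x_def)
  have "(x + 2) * leg' (Suc (Suc n)) t = (x + 2) * (t * ?q' + (x + 2) * ?q)"
    using r' IH by algebra
  then have B: "leg' (Suc (Suc n)) t = t * ?q' + (x + 2) * ?q" using nz by simp
  have "t * leg' (Suc (Suc n)) t - ?q' = (x + 2) * leg (Suc (Suc n)) t"
    using B r IH by algebra
  with B show ?case by (simp add: x_def add.commute)
qed

lemma leg_first_order:
  "(1 - t\<^sup>2) * leg' (Suc n) t = real (n + 1) * (leg n t - t * leg (Suc n) t)"
proof -
  define x where "x = real (n + 1)"
  have "leg' (Suc n) t = t * leg' n t + x * leg n t" "t * leg' (Suc n) t - leg' n t = x * leg (Suc n) t"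
    using leg_derivative_relations[of n t] by (auto simp: x_def)
  then have "(1 - t\<^sup>2) * leg' (Suc n) t = x * (leg n t - t * leg (Suc n) t)" by algebra
  then show ?thesis by (simp add: x_def)
qed

text \<open>Differentiate \<open>leg_first_order\<close> and eliminate \<open>P\<^sub>n\<^sub>-\<^sub>1\<close> by the second derivative relation.\<close>

lemma legendre_equation:
  "2 * t * leg' n t - (1 - t\<^sup>2) * poly (pderiv (pderiv (legendre n))) t = real n * real (n + 1) * leg n t"
proof (cases n)
  case (Suc m)
  let ?P = "legendre (Suc m)"
  have "[:1, 0, -1:] * pderiv ?P = smult (real (m + 1)) (legendre m - [:0, 1:] * ?P)"
  proof (rule poly_ext)
    show "poly ([:1, 0, -1:] * pderiv ?P) s = poly (smult (real (m + 1)) (legendre m - [:0, 1:] * ?P)) s" for s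
      using leg_first_order[of s m] by (simp add: power2_eq_square algebra_simps)
  qed
  then have d: "poly (pderiv ([:1, 0, -1:] * pderiv ?P)) t
      = poly (pderiv (smult (real (m + 1)) (legendre m - [:0, 1:] * ?P))) t" by (rule arg_cong)
  have v: "poly [:1, 0, -1:] t = 1 - t\<^sup>2" "poly (pderiv [:1, 0, -1:]) t = - (2 * t)"
    "poly [:0, 1:] t = t" "poly (pderiv [:0, 1:]) t = 1"
    by (simp_all add: pderiv_pCons power2_eq_square algebra_simps)
  have "(1 - t\<^sup>2) * poly (pderiv (pderiv ?P)) t - 2 * t * leg' (Suc m) t
      = real (m + 1) * (leg' m t - leg (Suc m) t - t * leg' (Suc m) t)"
    using d unfolding pderiv_mult pderiv_smult pderiv_diff poly_add poly_mult poly_diff poly_smult v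
    by (simp add: algebra_simps del: of_nat_Suc legendre.simps)
  then have "2 * t * leg' (Suc m) t - (1 - t\<^sup>2) * poly (pderiv (pderiv ?P)) t
      = real (m + 1) * (leg (Suc m) t + (t * leg' (Suc m) t - leg' m t))"
    by (simp add: algebra_simps del: of_nat_Suc legendre.simps)
  also have "t * leg' (Suc m) t - leg' m t = real (m + 1) * leg (Suc m) t"
    by (rule leg_derivative_relations[THEN conjunct2])
  finally have "2 * t * leg' (Suc m) t - (1 - t\<^sup>2) * poly (pderiv (pderiv ?P)) t
      = real (m + 1) * (leg (Suc m) t + real (m + 1) * leg (Suc m) t)" .
  then show ?thesis unfolding Suc by (simp add: algebra_simps del: legendre.simps)
qed simp

inductive legendre_span :: "(real \<Rightarrow> real) \<Rightarrow> bool" where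
  ls_leg: "legendre_span (\<lambda>t. leg n t)"
| ls_scale: "legendre_span f \<Longrightarrow> legendre_span (\<lambda>t. c * f t)"
| ls_add: "legendre_span f \<Longrightarrow> legendre_span g \<Longrightarrow> legendre_span (\<lambda>t. f t + g t)"

lemma legendre_span_times: "legendre_span f \<Longrightarrow> legendre_span (\<lambda>t. t * f t)"
proof (induction rule: legendre_span.induct)
  case (ls_leg n)
  show ?case
  proof (cases n)
    case 0
    then show ?thesis using legendre_span.ls_leg[of "Suc 0"] by simp
  next
    case (Suc m)
    have "legendre_span (\<lambda>t. real (m + 2) / real (2 * m + 3) * leg (Suc (Suc m)) t
        + real (m + 1) / real (2 * m + 3) * leg m t)"
      by (intro legendre_span.intros)
    moreover have "real (m + 2) / real (2 * m + 3) * leg (Suc (Suc m)) t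
        + real (m + 1) / real (2 * m + 3) * leg m t = t * leg (Suc m) t" for t
    proof -
      have "real (2 * m + 3) * t * leg (Suc m) t = real (m + 2) * leg (Suc (Suc m)) t + real (m + 1) * leg m t"
        unfolding leg_rec by simp
      moreover have "a / d * u + b / d * v = t * w" if "d * t * w = a * u + b * v" "d \<noteq> 0"
        for a b d u v w :: real
        using that by (simp add: field_simps)
      ultimately show ?thesis by (metis of_nat_eq_0_iff add_eq_0_iff_both_eq_0 zero_neq_numeral)
    qed
    ultimately show ?thesis unfolding Suc by (simp only:)
  qed
next
  case (ls_scale f c)
  from legendre_span.ls_scale[OF ls_scale.IH, of c] show ?case by (simp add: mult.left_commute)
next
  case (ls_add f g)
  from legendre_span.ls_add[OF ls_add.IH] show ?case by (simp add: distrib_left)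
qed

lemma legendre_span_const: "legendre_span (\<lambda>t. c)"
  using ls_scale[OF ls_leg[of 0], of c] by simp

lemma legendre_span_power: "legendre_span (\<lambda>t. t ^ n)"
  by (induction n) (use legendre_span_const[of 1] legendre_span_times in auto)

lemma legendre_span_sum:
  "finite I \<Longrightarrow> (\<And>i. i \<in> I \<Longrightarrow> legendre_span (f i)) \<Longrightarrow> legendre_span (\<lambda>t. \<Sum>i\<in>I. f i t)"
  by (induction I rule: finite_induct) (auto intro: legendre_span_const ls_add)

lemma degree_legendre: "degree (legendre n) \<le> n"
proof (induction n rule: legendre.induct)
  case (3 n)
  have "degree ([:0, 1:] * legendre (Suc n)) \<le> Suc (Suc n)"
    using degree_mult_le[of "[:0, 1:]" "legendre (Suc n)"] 3 by simp
  then have "degree (smult (real (2 * n + 3)) ([:0, 1:] * legendre (Suc n)) - smult (real (n + 1)) (legendre n)) \<le> Suc (Suc n)"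
    using 3 by (intro degree_diff_le) (auto intro: order_trans[OF degree_smult_le])
  then show ?case unfolding legendre.simps by (rule order_trans[OF degree_smult_le])
qed simp_all

subsection \<open>The Funk--Hecke formula\<close>

text \<open>The gradient along the sphere of the function \<open>p (x \<bullet> y)\<close> of \<open>y\<close>.\<close>

definition ridge_grad :: "real poly \<Rightarrow> real^3 \<Rightarrow> real^3 \<Rightarrow> real^3" where
  "ridge_grad p x y = poly (pderiv p) (x \<bullet> y) *\<^sub>R (x - (x \<bullet> y) *\<^sub>R y)"

lemma poly_ridge_continuous: "continuous_on S (\<lambda>y. poly p (x \<bullet> y))" for x :: "real^3"
  by (rule continuous_on_compose2[of UNIV "poly p"]) (auto intro!: continuous_intros)

lemma ridge_gderiv: "GDERIV (\<lambda>y. poly p (x \<bullet> y)) y :> poly (pderiv p) (x \<bullet> y) *\<^sub>R x" for x :: "real^3"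
proof (rule GDERIV_DERIV_compose[where f = "\<lambda>y. x \<bullet> y" and g = "poly p", OF _ poly_DERIV])
  show "GDERIV (\<lambda>y. x \<bullet> y) y :> x"
    unfolding gderiv_def by (auto intro!: derivative_eq_intros simp: inner_commute)
qed

lemma ridge_smooth: "smooth_grad S2 (\<lambda>y. poly p (x \<bullet> y)) (ridge_grad p x)"
  unfolding smooth_grad_S2
proof (intro conjI ballI)
  have "smooth_on UNIV (\<lambda>y. poly p (x \<bullet> y))"
  proof (rule smooth_on_ridge[where P = "\<lambda>f. \<exists>p. f = poly p" and p = "poly p"])
    fix f :: "real \<Rightarrow> real" and c assume "\<exists>p. f = poly p"
    then obtain q where q: "f = poly q" by blast
    show "\<exists>f'. (\<exists>p. f' = poly p) \<and> (\<exists>p. (\<lambda>s. f' s * c) = poly p) \<and> (\<forall>s. (f has_real_derivative f' s) (at s))"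
      by (intro exI[of _ "poly (pderiv q)"] conjI exI[of _ "pderiv q"] exI[of _ "smult c (pderiv q)"])
        (auto simp: q poly_DERIV mult.commute)
  qed blast
  then show "\<exists>U. open U \<and> sph \<subseteq> U \<and> smooth_on U (\<lambda>y. poly p (x \<bullet> y))" by blast
next
  fix y assume y: "y \<in> sph"
  then have yy: "y \<bullet> y = 1" by (simp add: norm_eq_1)
  show "ridge_grad p x y \<bullet> y = 0" by (simp add: ridge_grad_def inner_diff_left yy)
  have "ridge_grad p x y = poly (pderiv p) (x \<bullet> y) *\<^sub>R x - ((poly (pderiv p) (x \<bullet> y) *\<^sub>R x) \<bullet> y) *\<^sub>R y"
    by (simp add: ridge_grad_def algebra_simps)
  then show "((\<lambda>y. poly p (x \<bullet> y)) has_derivative (\<lambda>h. ridge_grad p x y \<bullet> h)) (at y within sph)"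
    using tangential_derivative[OF ridge_gderiv y] by simp
qed

lemmas ridge_C1 = smooth_C1_sphere[OF ridge_smooth]

text \<open>Green's formula against a function of \<open>x \<bullet> y\<close> only: on such functions the Laplacian of the
  sphere is the Legendre operator.\<close>

lemma ridge_green:
  assumes f: "C1_sphere f G" and x: "x \<in> sph"
  shows "(\<integral>y. G y \<bullet> ridge_grad p x y \<partial>sphere_measure)
    = (\<integral>y. f y * (2 * (x \<bullet> y) * poly (pderiv p) (x \<bullet> y)
        - (1 - (x \<bullet> y)\<^sup>2) * poly (pderiv (pderiv p)) (x \<bullet> y)) \<partial>sphere_measure)"
proof -
  let ?q = "pderiv p"
  have cf: "continuous_on sph f" and cG: "continuous_on sph G" and tan: "\<And>y. y \<in> sph \<Longrightarrow> G y \<bullet> y = 0"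
    by (fact C1_sphereD[OF f])+
  have xx: "x \<bullet> x = 1" using x by (simp add: norm_eq_1)
  have "(\<integral>y. (f y *\<^sub>R ridge_grad ?q x y + poly ?q (x \<bullet> y) *\<^sub>R G y) \<bullet> x \<partial>sphere_measure)
      = 2 * (\<integral>y. f y * poly ?q (x \<bullet> y) * (y \<bullet> x) \<partial>sphere_measure)"
    by (rule sphere_divergence[OF C1_sphere_mult[OF f ridge_C1]])
  also have "(\<integral>y. (f y *\<^sub>R ridge_grad ?q x y + poly ?q (x \<bullet> y) *\<^sub>R G y) \<bullet> x \<partial>sphere_measure)
      = (\<integral>y. f y * ((1 - (x \<bullet> y)\<^sup>2) * poly (pderiv ?q) (x \<bullet> y)) + G y \<bullet> ridge_grad p x y \<partial>sphere_measure)"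
  proof (rule Bochner_Integration.integral_cong[OF refl])
    fix y assume "y \<in> space sphere_measure"
    then have "G y \<bullet> y = 0" using tan by simp
    then show "(f y *\<^sub>R ridge_grad ?q x y + poly ?q (x \<bullet> y) *\<^sub>R G y) \<bullet> x
        = f y * ((1 - (x \<bullet> y)\<^sup>2) * poly (pderiv ?q) (x \<bullet> y)) + G y \<bullet> ridge_grad p x y"
      by (simp add: ridge_grad_def inner_add_left inner_diff_left inner_diff_right xx inner_commute
          power2_eq_square algebra_simps)
  qed
  also have "\<dots> = (\<integral>y. f y * ((1 - (x \<bullet> y)\<^sup>2) * poly (pderiv ?q) (x \<bullet> y)) \<partial>sphere_measure)
      + (\<integral>y. G y \<bullet> ridge_grad p x y \<partial>sphere_measure)"
    by (intro Bochner_Integration.integral_add sphere_integrable continuous_intros cf cG poly_ridge_continuous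
        C1_sphereD(2)[OF ridge_C1])
  finally have "(\<integral>y. G y \<bullet> ridge_grad p x y \<partial>sphere_measure)
      = (\<integral>y. 2 * (f y * poly ?q (x \<bullet> y) * (y \<bullet> x)) \<partial>sphere_measure)
      - (\<integral>y. f y * ((1 - (x \<bullet> y)\<^sup>2) * poly (pderiv ?q) (x \<bullet> y)) \<partial>sphere_measure)" by simp
  also have "\<dots> = (\<integral>y. 2 * (f y * poly ?q (x \<bullet> y) * (y \<bullet> x))
      - f y * ((1 - (x \<bullet> y)\<^sup>2) * poly (pderiv ?q) (x \<bullet> y)) \<partial>sphere_measure)"
    by (rule Bochner_Integration.integral_diff[symmetric])
      (intro sphere_integrable continuous_intros cf poly_ridge_continuous)+
  finally show ?thesis by (simp add: right_diff_distrib inner_commute[of _ x] ac_simps)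
qed

text \<open>The integrals of \<open>(z \<bullet> y)\<^sup>k\<close> over the sphere.\<close>

fun sphere_moment :: "nat \<Rightarrow> real" where
  "sphere_moment 0 = 4 * pi"
| "sphere_moment (Suc 0) = 0"
| "sphere_moment (Suc (Suc k)) = (real k + 1) / (real k + 3) * sphere_moment k"

text \<open>The Funk--Hecke multiplier of \<open>(z \<bullet> y)\<^sup>k\<close> on spherical harmonics of degree \<open>n\<close>.  For \<open>k = 0\<close> the
  truncated difference \<open>k - 1\<close> occurs with the factor \<open>0\<close>.\<close>

fun funk_hecke :: "nat \<Rightarrow> nat \<Rightarrow> real" where
  "funk_hecke 0 k = sphere_moment k"
| "funk_hecke (Suc n) k = real k / (real n + real k + 2) * funk_hecke n (k - 1)"

lemma funk_hecke_eq_0: "k < n \<Longrightarrow> funk_hecke n k = 0"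
proof (induction n arbitrary: k)
  case (Suc n)
  then show ?case by (cases k) auto
qed simp

text \<open>Relates the multipliers of degrees \<open>m\<close> and \<open>m + 1\<close>; in \<open>funk_hecke_formula\<close> it turns the terms
  coming from \<open>P\<^sub>m\<close> and \<open>P\<^sub>m\<^sub>+\<^sub>1\<close> into a multiple of \<open>P\<^sub>m\<^sub>+\<^sub>2\<close>.\<close>

lemma funk_hecke_relation:
  "(real k - real m) * funk_hecke m k = real k * funk_hecke (Suc m) (k - 1)"
proof (induction m arbitrary: k)
  case 0
  show ?case
    by (cases k rule: sphere_moment.cases) (simp_all add: field_simps)
next
  case (Suc m)
  show ?case
  proof (cases k)
    case 0
    then show ?thesis by (simp add: funk_hecke_eq_0)
  next
    case (Suc j)
    have "real j - real m = real k - real (Suc m)" using Suc by simp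
    then have "(real k - real (Suc m)) * funk_hecke m j = real j * funk_hecke (Suc m) (j - 1)"
      using Suc.IH[of j] by (simp only:)
    moreover have "funk_hecke (Suc m) k = real k / (real m + real j + 3) * funk_hecke m j"
      using Suc by (simp add: algebra_simps)
    moreover have "funk_hecke (Suc (Suc m)) (k - 1) = real j / (real m + real j + 3) * funk_hecke (Suc m) (j - 1)"
      using Suc by (simp add: algebra_simps del: funk_hecke.simps(2)[of m])
    moreover have "(real k - real (Suc m)) * (real k / d * u) = real k * (real j / d * v)"
      if "(real k - real (Suc m)) * u = real j * v" for d u v :: real
    proof -
      have "(real k - real (Suc m)) * (real k / d * u) = real k / d * ((real k - real (Suc m)) * u)"
        by (simp only: ac_simps)
      then show ?thesis unfolding that by simp
    qed
    ultimately show ?thesis by (simp only:)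
  qed
qed

lemma inner_power_C1:
  "C1_sphere (\<lambda>y. (z \<bullet> y) ^ k) (\<lambda>y. (real k * (z \<bullet> y) ^ (k - 1)) *\<^sub>R (z - (z \<bullet> y) *\<^sub>R y))"
proof -
  have "(\<lambda>y. (z \<bullet> y) ^ k) = (\<lambda>y. poly (monom 1 k) (z \<bullet> y))"
    by (simp add: poly_monom)
  moreover have "(\<lambda>y. (real k * (z \<bullet> y) ^ (k - 1)) *\<^sub>R (z - (z \<bullet> y) *\<^sub>R y)) = ridge_grad (monom 1 k) z"
    by (auto simp: ridge_grad_def pderiv_monom poly_monom)
  ultimately show ?thesis using ridge_C1[of "monom 1 k" z] by simp
qed

text \<open>The divergence theorem for \<open>(z \<bullet> y)\<^sup>k f(y)\<close> in the direction \<open>x\<close>.\<close>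

lemma moment_recursion:
  fixes f G assumes f: "C1_sphere f G" and x: "x \<in> sph" and z: "z \<in> sph"
  shows "(real k + 2) * (\<integral>y. (z \<bullet> y) ^ k * (x \<bullet> y) * f y \<partial>sphere_measure)
    = real k * (x \<bullet> z) * (\<integral>y. (z \<bullet> y) ^ (k - 1) * f y \<partial>sphere_measure)
      + (\<integral>y. (z \<bullet> y) ^ k * (G y \<bullet> x) \<partial>sphere_measure)"
proof -
  have cf: "continuous_on sph f" and cG: "continuous_on sph G"
    by (fact C1_sphereD[OF f])+
  have pk: "real k * t ^ (k - 1) * t = real k * t ^ k" for t :: real by (cases k) auto
  let ?H = "\<lambda>y. (z \<bullet> y) ^ k *\<^sub>R G y + f y *\<^sub>R ((real k * (z \<bullet> y) ^ (k - 1)) *\<^sub>R (z - (z \<bullet> y) *\<^sub>R y))"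
  have "(\<integral>y. ?H y \<bullet> x \<partial>sphere_measure) = 2 * (\<integral>y. (z \<bullet> y) ^ k * f y * (y \<bullet> x) \<partial>sphere_measure)"
    by (rule sphere_divergence[OF C1_sphere_mult[OF inner_power_C1 f]])
  also have "(\<lambda>y. ?H y \<bullet> x) = (\<lambda>y. (z \<bullet> y) ^ k * (G y \<bullet> x)
      + real k * (x \<bullet> z) * ((z \<bullet> y) ^ (k - 1) * f y) - real k * ((z \<bullet> y) ^ k * (x \<bullet> y) * f y))"
  proof
    fix y
    have "?H y \<bullet> x = (z \<bullet> y) ^ k * (G y \<bullet> x) + real k * (x \<bullet> z) * ((z \<bullet> y) ^ (k - 1) * f y)
        - (real k * (z \<bullet> y) ^ (k - 1) * (z \<bullet> y)) * (x \<bullet> y) * f y"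
      by (simp add: inner_add_left inner_diff_left inner_commute[of _ x] algebra_simps)
    then show "?H y \<bullet> x = (z \<bullet> y) ^ k * (G y \<bullet> x)
      + real k * (x \<bullet> z) * ((z \<bullet> y) ^ (k - 1) * f y) - real k * ((z \<bullet> y) ^ k * (x \<bullet> y) * f y)"
      unfolding pk by (simp add: mult.assoc)
  qed
  also have "integral\<^sup>L sphere_measure \<dots> = (\<integral>y. (z \<bullet> y) ^ k * (G y \<bullet> x) \<partial>sphere_measure)
      + real k * (x \<bullet> z) * (\<integral>y. (z \<bullet> y) ^ (k - 1) * f y \<partial>sphere_measure)
      - real k * (\<integral>y. (z \<bullet> y) ^ k * (x \<bullet> y) * f y \<partial>sphere_measure)"
  proof -
    have "integrable sphere_measure (\<lambda>y. (z \<bullet> y) ^ k * (G y \<bullet> x))"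
      "integrable sphere_measure (\<lambda>y. real k * (x \<bullet> z) * ((z \<bullet> y) ^ (k - 1) * f y))"
      "integrable sphere_measure (\<lambda>y. real k * ((z \<bullet> y) ^ k * (x \<bullet> y) * f y))"
      by (intro sphere_integrable continuous_intros cf cG)+
    then show ?thesis
      by (simp only: Bochner_Integration.integral_diff Bochner_Integration.integral_add
          Bochner_Integration.integrable_add integral_mult_right_zero)
  qed
  finally show ?thesis by (simp add: inner_commute[of _ x] algebra_simps)
qed

lemma sphere_moments:
  assumes z: "z \<in> sph"
  shows "(\<integral>y. (z \<bullet> y) ^ k \<partial>sphere_measure) = sphere_moment k"
proof (induction k rule: sphere_moment.induct)
  case 1
  show ?case using sphere_area by simp
next
  have 1: "C1_sphere (\<lambda>y. 1) (\<lambda>y. 0)" by (simp add: C1_sphere_def)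
  note rec = moment_recursion[OF 1 z z]
  have zz: "z \<bullet> z = 1" using z by (simp add: norm_eq_1)
  {
    case 2
    show ?case using rec[of 0] by simp
  next
    case (3 k)
    have "(real k + 3) * (\<integral>y. (z \<bullet> y) ^ Suc (Suc k) \<partial>sphere_measure) = (real k + 1) * sphere_moment k"
      using rec[of "Suc k"] 3 zz by (simp add: ac_simps)
    then show ?case by (simp add: field_simps)
  }
qed

text \<open>Multiplying by the linear form \<open>x \<bullet> y\<close> costs one derivative by the divergence theorem, and the
  derivative of a Legendre polynomial is again a combination of Legendre polynomials. With the
  three-term recursion this gives the formula by induction on \<open>n\<close>.\<close>

lemma funk_hecke_formula:
  assumes x: "x \<in> sph" and z: "z \<in> sph"
  shows "(\<integral>y. (z \<bullet> y) ^ k * leg n (x \<bullet> y) \<partial>sphere_measure) = funk_hecke n k * leg n (x \<bullet> z)"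
proof (induction n arbitrary: k rule: legendre.induct)
  case 1
  show ?case using sphere_moments[OF z] by simp
next
  case 2
  have "C1_sphere (\<lambda>y. 1) (\<lambda>y. 0)" by (simp add: C1_sphere_def)
  from moment_recursion[OF this x z, of k] show ?case
    using sphere_moments[OF z] by (simp add: field_simps)
next
  case (3 m)
  define J where "J n k = (\<integral>y. (z \<bullet> y) ^ k * leg n (x \<bullet> y) \<partial>sphere_measure)" for n k
  define T where "T = (\<integral>y. (z \<bullet> y) ^ k * (x \<bullet> y) * leg (Suc m) (x \<bullet> y) \<partial>sphere_measure)"
  define a where "a = real m"
  define b where "b = real k"
  define \<tau> where "\<tau> = x \<bullet> z"
  have int: "integrable sphere_measure (\<lambda>y. (z \<bullet> y) ^ k * leg n (x \<bullet> y))"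
    "integrable sphere_measure (\<lambda>y. (z \<bullet> y) ^ k * (x \<bullet> y) * leg n (x \<bullet> y))" for n
    by (intro sphere_integrable continuous_intros poly_ridge_continuous)+
  have xx: "x \<bullet> x = 1" using x by (simp add: norm_eq_1)
  have "(b + 2) * T = b * \<tau> * J (Suc m) (k - 1)
      + (\<integral>y. (z \<bullet> y) ^ k * (ridge_grad (legendre (Suc m)) x y \<bullet> x) \<partial>sphere_measure)"
    using moment_recursion[OF ridge_C1[of "legendre (Suc m)" x] x z, of k]
    by (simp only: T_def J_def b_def \<tau>_def)
  also have "(\<lambda>y. (z \<bullet> y) ^ k * (ridge_grad (legendre (Suc m)) x y \<bullet> x))
      = (\<lambda>y. (a + 1) * ((z \<bullet> y) ^ k * leg m (x \<bullet> y)) - (a + 1) * ((z \<bullet> y) ^ k * (x \<bullet> y) * leg (Suc m) (x \<bullet> y)))"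
  proof
    fix y
    have "ridge_grad (legendre (Suc m)) x y \<bullet> x = (1 - (x \<bullet> y)\<^sup>2) * leg' (Suc m) (x \<bullet> y)"
      by (simp only: ridge_grad_def inner_scaleR_left inner_diff_left xx inner_commute[of y x] power2_eq_square mult.commute)
    also have "\<dots> = (a + 1) * (leg m (x \<bullet> y) - (x \<bullet> y) * leg (Suc m) (x \<bullet> y))"
      unfolding leg_first_order by (simp add: a_def)
    finally show "(z \<bullet> y) ^ k * (ridge_grad (legendre (Suc m)) x y \<bullet> x)
      = (a + 1) * ((z \<bullet> y) ^ k * leg m (x \<bullet> y)) - (a + 1) * ((z \<bullet> y) ^ k * (x \<bullet> y) * leg (Suc m) (x \<bullet> y))"
      by (simp only: right_diff_distrib ac_simps)
  qed
  also have "integral\<^sup>L sphere_measure \<dots> = (a + 1) * J m k - (a + 1) * T"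
    using int(1)[of m] int(2)[of "Suc m"] unfolding J_def T_def
    by (simp only: Bochner_Integration.integral_diff Bochner_Integration.integrable_mult_right integral_mult_right_zero)
  finally have T: "(a + b + 3) * T = b * \<tau> * J (Suc m) (k - 1) + (a + 1) * J m k"
    by (simp add: algebra_simps)
  have "(a + 2) * J (Suc (Suc m)) k
      = (\<integral>y. (a + 2) * ((z \<bullet> y) ^ k * leg (Suc (Suc m)) (x \<bullet> y)) \<partial>sphere_measure)"
    by (simp only: J_def integral_mult_right_zero)
  also have "\<dots> = (\<integral>y. (2 * a + 3) * ((z \<bullet> y) ^ k * (x \<bullet> y) * leg (Suc m) (x \<bullet> y))
      - (a + 1) * ((z \<bullet> y) ^ k * leg m (x \<bullet> y)) \<partial>sphere_measure)"
  proof (rule Bochner_Integration.integral_cong[OF refl])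
    fix y
    have "(a + 2) * leg (Suc (Suc m)) (x \<bullet> y) = (2 * a + 3) * (x \<bullet> y) * leg (Suc m) (x \<bullet> y) - (a + 1) * leg m (x \<bullet> y)"
      using leg_rec[of m "x \<bullet> y"] by (simp add: a_def add.commute del: legendre.simps)
    then have "(z \<bullet> y) ^ k * ((a + 2) * leg (Suc (Suc m)) (x \<bullet> y))
      = (z \<bullet> y) ^ k * ((2 * a + 3) * (x \<bullet> y) * leg (Suc m) (x \<bullet> y) - (a + 1) * leg m (x \<bullet> y))" by simp
    then show "(a + 2) * ((z \<bullet> y) ^ k * leg (Suc (Suc m)) (x \<bullet> y))
      = (2 * a + 3) * ((z \<bullet> y) ^ k * (x \<bullet> y) * leg (Suc m) (x \<bullet> y)) - (a + 1) * ((z \<bullet> y) ^ k * leg m (x \<bullet> y))"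
      by (simp only: right_diff_distrib ac_simps)
  qed
  also have "\<dots> = (2 * a + 3) * T - (a + 1) * J m k"
    using int(1)[of m] int(2)[of "Suc m"] unfolding J_def T_def
    by (simp only: Bochner_Integration.integral_diff Bochner_Integration.integrable_mult_right integral_mult_right_zero)
  finally have S: "(a + 2) * J (Suc (Suc m)) k = (2 * a + 3) * T - (a + 1) * J m k" .
  define g where "g = funk_hecke (Suc m) (k - 1)"
  define g0 where "g0 = funk_hecke m k"
  have IH: "J (Suc m) (k - 1) = g * leg (Suc m) \<tau>" "J m k = g0 * leg m \<tau>"
    using 3 by (simp_all only: J_def g_def g0_def \<tau>_def)
  have E: "(b - a) * g0 = b * g"
    using funk_hecke_relation[of k m] by (simp only: a_def b_def g_def g0_def)
  have L: "(a + 2) * leg (Suc (Suc m)) \<tau> = (2 * a + 3) * \<tau> * leg (Suc m) \<tau> - (a + 1) * leg m \<tau>"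
    using leg_rec[of m \<tau>] by (simp add: a_def add.commute del: legendre.simps)
  have nz: "a + 2 \<noteq> 0" "a + b + 3 \<noteq> 0" by (auto simp: a_def b_def)
  have "(a + 2) * ((a + b + 3) * J (Suc (Suc m)) k) = (a + 2) * (b * g * leg (Suc (Suc m)) \<tau>)"
    using S T IH E L by algebra
  then have "(a + b + 3) * J (Suc (Suc m)) k = b * g * leg (Suc (Suc m)) \<tau>" using nz by (simp del: legendre.simps)
  then have "J (Suc (Suc m)) k = b / (a + b + 3) * g * leg (Suc (Suc m)) \<tau>"
    using nz by (simp add: field_simps del: legendre.simps)
  also have "b / (a + b + 3) * g = funk_hecke (Suc (Suc m)) k"
    by (simp add: a_def b_def g_def algebra_simps del: funk_hecke.simps(2)[of m])
  finally show ?case by (simp only: J_def \<tau>_def)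
qed


subsection \<open>Spectral projections of the sphere\<close>

text \<open>The Funk--Hecke formula applied to the polynomial \<open>P\<^sub>m\<close>: this is the factor by which integration
  against \<open>P\<^sub>m(z \<bullet> y)\<close> multiplies \<open>P\<^sub>n(x \<bullet> y)\<close>.\<close>

definition leg_inner :: "nat \<Rightarrow> nat \<Rightarrow> real" where
  "leg_inner n m = (\<Sum>k\<le>m. coeff (legendre m) k * funk_hecke n k)"

lemma leg_inner:
  assumes x: "x \<in> sph" and z: "z \<in> sph"
  shows "(\<integral>y. leg m (z \<bullet> y) * leg n (x \<bullet> y) \<partial>sphere_measure) = leg_inner n m * leg n (x \<bullet> z)"
proof -
  have p: "leg m t = (\<Sum>k\<le>m. coeff (legendre m) k * t ^ k)" for t
    unfolding poly_altdef by (intro sum.mono_neutral_left) (auto simp: coeff_eq_0 intro: order_trans[OF _ degree_legendre])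
  have "(\<integral>y. leg m (z \<bullet> y) * leg n (x \<bullet> y) \<partial>sphere_measure)
      = (\<integral>y. (\<Sum>k\<le>m. coeff (legendre m) k * ((z \<bullet> y) ^ k * leg n (x \<bullet> y))) \<partial>sphere_measure)"
    by (simp only: p sum_distrib_right mult.assoc)
  also have "\<dots> = (\<Sum>k\<le>m. \<integral>y. coeff (legendre m) k * ((z \<bullet> y) ^ k * leg n (x \<bullet> y)) \<partial>sphere_measure)"
    by (intro Bochner_Integration.integral_sum sphere_integrable continuous_intros poly_ridge_continuous)
  also have "\<dots> = (\<Sum>k\<le>m. coeff (legendre m) k * (funk_hecke n k * leg n (x \<bullet> z)))"
    using funk_hecke_formula[OF x z] by simp
  finally show ?thesis by (simp only: leg_inner_def sum_distrib_right mult.assoc)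
qed

lemma leg_inner_diagonal:
  assumes x: "x \<in> sph"
  shows "(\<integral>y. leg m (x \<bullet> y) * leg n (x \<bullet> y) \<partial>sphere_measure) = leg_inner n m"
proof -
  have "x \<bullet> x = 1" using x by (simp add: norm_eq_1)
  then show ?thesis using leg_inner[OF x x, of m n] leg_at_1[of n] by simp
qed

text \<open>Powers of degree less than \<open>n\<close> have multiplier \<open>0\<close> on \<open>P\<^sub>n\<close>.\<close>

lemma leg_inner_less: "m < n \<Longrightarrow> leg_inner n m = 0"
  unfolding leg_inner_def by (intro sum.neutral) (simp add: funk_hecke_eq_0)

lemma ex_sphere: "axis 1 1 \<in> sph" by (simp add: norm_axis_1)

text \<open>For \<open>z = x\<close> the factor is the inner product of \<open>P\<^sub>m(x \<bullet> y)\<close> and \<open>P\<^sub>n(x \<bullet> y)\<close>, as \<open>P\<^sub>n(1) = 1\<close>.\<close>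

lemma leg_inner_sym: "leg_inner n m = leg_inner m n"
  using leg_inner_diagonal[OF ex_sphere, of m n] leg_inner_diagonal[OF ex_sphere, of n m]
  by (simp add: mult.commute)

lemma leg_inner_neq: "m \<noteq> n \<Longrightarrow> leg_inner n m = 0"
  using leg_inner_less[of m n] leg_inner_less[of n m] leg_inner_sym[of n m] by (cases m n rule: linorder_cases) auto

lemma leading_coeff_legendre:
  "coeff (legendre (Suc n)) (Suc n) = (2 * real n + 1) / (real n + 1) * coeff (legendre n) n"
proof (cases n)
  case (Suc m)
  have "coeff (legendre m) (Suc (Suc m)) = 0"
    by (rule coeff_eq_0) (use degree_legendre[of m] in linarith)
  then show ?thesis unfolding Suc legendre.simps(3) by (simp add: field_simps del: legendre.simps)
qed simp

text \<open>Only the leading coefficient of \<open>P\<^sub>n\<close> contributes, and both factors satisfy simple recursions in \<open>n\<close>.\<close>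

lemma leg_inner_same: "leg_inner n n = 4 * pi / (2 * real n + 1)"
proof -
  have "leg_inner n n = coeff (legendre n) n * funk_hecke n n"
    by (simp add: leg_inner_def lessThan_Suc_atMost [symmetric] funk_hecke_eq_0)
  also have "\<dots> = 4 * pi / (2 * real n + 1)"
  proof (induction n)
    case (Suc n)
    have "coeff (legendre (Suc n)) (Suc n) * funk_hecke (Suc n) (Suc n)
        = ((2 * real n + 1) / (real n + 1) * ((real n + 1) / (2 * real n + 3))) * (coeff (legendre n) n * funk_hecke n n)"
      unfolding leading_coeff_legendre by (simp add: add.commute)
    also have "(2 * real n + 1) / (real n + 1) * ((real n + 1) / (2 * real n + 3)) = (2 * real n + 1) / (2 * real n + 3)"
      by simp
    finally show ?case unfolding Suc by (simp add: add.commute)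
  qed simp
  finally show ?thesis .
qed

definition sphere_kernel :: "nat \<Rightarrow> real^3 \<Rightarrow> real^3 \<Rightarrow> real" where
  "sphere_kernel n x y = poly (smult ((2 * real n + 1) / (4 * pi)) (legendre n)) (x \<bullet> y)"

lemma sphere_reproducing:
  assumes x: "x \<in> sph" and z: "z \<in> sph"
  shows "(\<integral>y. sphere_kernel i x y * sphere_kernel j y z \<partial>sphere_measure)
    = (if i = j then sphere_kernel i x z else 0)"
proof -
  let ?c = "\<lambda>n. (2 * real n + 1) / (4 * pi)"
  have "(\<integral>y. sphere_kernel i x y * sphere_kernel j y z \<partial>sphere_measure)
      = (\<integral>y. ?c i * ?c j * (leg j (z \<bullet> y) * leg i (x \<bullet> y)) \<partial>sphere_measure)"
    by (simp only: sphere_kernel_def poly_smult inner_commute[of _ z] ac_simps)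
  also have "\<dots> = ?c i * ?c j * (leg_inner i j * leg i (x \<bullet> z))"
    by (simp only: integral_mult_right_zero leg_inner[OF x z])
  also have "\<dots> = (if i = j then sphere_kernel i x z else 0)"
  proof (cases "i = j")
    case True
    have "?c i * leg_inner i i = 1" unfolding leg_inner_same by (simp add: add_pos_nonneg)
    then have "?c i * (?c i * leg_inner i i) * leg i (x \<bullet> z) = ?c i * leg i (x \<bullet> z)" by simp
    then show ?thesis using True by (simp add: sphere_kernel_def mult.assoc)
  next
    case False
    then show ?thesis by (simp add: leg_inner_neq)
  qed
  finally show ?thesis .
qed

text \<open>Legendre's equation is the eigenvalue equation of the sphere on functions of \<open>x \<bullet> y\<close>.\<close>

lemma sphere_green:
  assumes sm: "smooth_grad S2 \<phi> G" and x: "x \<in> sph"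
  shows "(\<integral>y. G y \<bullet> ridge_grad (smult c (legendre n)) x y \<partial>sphere_measure)
    = real n * real (n + 1) * (\<integral>y. \<phi> y * poly (smult c (legendre n)) (x \<bullet> y) \<partial>sphere_measure)"
proof -
  have "(\<integral>y. G y \<bullet> ridge_grad (smult c (legendre n)) x y \<partial>sphere_measure)
      = (\<integral>y. \<phi> y * (2 * (x \<bullet> y) * poly (pderiv (smult c (legendre n))) (x \<bullet> y)
        - (1 - (x \<bullet> y)\<^sup>2) * poly (pderiv (pderiv (smult c (legendre n)))) (x \<bullet> y)) \<partial>sphere_measure)"
    by (rule ridge_green[OF smooth_C1_sphere[OF sm] x])
  also have "\<dots> = (\<integral>y. real n * real (n + 1) * (\<phi> y * poly (smult c (legendre n)) (x \<bullet> y)) \<partial>sphere_measure)"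
  proof (rule Bochner_Integration.integral_cong[OF refl])
    fix y
    have "2 * (x \<bullet> y) * poly (pderiv (smult c (legendre n))) (x \<bullet> y)
        - (1 - (x \<bullet> y)\<^sup>2) * poly (pderiv (pderiv (smult c (legendre n)))) (x \<bullet> y)
      = c * (2 * (x \<bullet> y) * leg' n (x \<bullet> y) - (1 - (x \<bullet> y)\<^sup>2) * poly (pderiv (pderiv (legendre n))) (x \<bullet> y))"
      by (simp add: pderiv_smult algebra_simps)
    also have "\<dots> = c * (real n * real (n + 1) * leg n (x \<bullet> y))"
      by (simp only: legendre_equation)
    finally show "\<phi> y * (2 * (x \<bullet> y) * poly (pderiv (smult c (legendre n))) (x \<bullet> y)
        - (1 - (x \<bullet> y)\<^sup>2) * poly (pderiv (pderiv (smult c (legendre n)))) (x \<bullet> y))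
      = real n * real (n + 1) * (\<phi> y * poly (smult c (legendre n)) (x \<bullet> y))"
      by (simp only: poly_smult ac_simps)
  qed
  finally show ?thesis by (simp only: integral_mult_right_zero)
qed

text \<open>Midpoint rule for the convex function \<open>e\<^sup>-\<^sup>\<tau>\<^sup>s\<close>: the point \<open>n (n + 1)\<close> is the centre of
  \<open>[n\<^sup>2 - 1/2, (n + 1)\<^sup>2 - 1/2]\<close>, an interval of length \<open>2 n + 1\<close>, and these intervals tile a half-line.\<close>

lemma sphere_heat_sum:
  assumes \<tau>: "0 < \<tau>"
  shows "(\<Sum>n=1..R. (2 * real n + 1) * exp (- \<tau> * (real n * real (n + 1)))) \<le> 1 / \<tau>"
proof -
  have "(\<Sum>n=1..R. (2 * real n + 1) * exp (- \<tau> * (real n * real (n + 1))))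
      \<le> (exp (- \<tau> / 2) - exp (- \<tau> * ((real R + 1)\<^sup>2 - 1/2))) / \<tau>"
  proof (induction R)
    case (Suc R)
    define h where "h = \<tau> * (2 * real (Suc R) + 1) / 2"
    define e where "e = exp (- \<tau> * (real (Suc R) * real (Suc R + 1)))"
    have h: "0 \<le> h" using \<tau> by (simp add: h_def)
    have "h \<le> (exp h - inverse (exp h)) / 2" using h by (rule real_le_x_sinh)
    then have sinh: "2 * h \<le> exp h - exp (- h)" by (simp add: exp_minus)
    have "(2 * real (Suc R) + 1) * e = (2 * h) * e / \<tau>" using \<tau> by (simp add: h_def)
    also have "\<dots> \<le> (exp h - exp (- h)) * e / \<tau>"
      using sinh \<tau> by (intro divide_right_mono mult_right_mono) (auto simp: e_def)
    also have "(exp h - exp (- h)) * e = exp (- \<tau> * ((real R + 1)\<^sup>2 - 1/2)) - exp (- \<tau> * ((real (Suc R) + 1)\<^sup>2 - 1/2))"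
    proof -
      have "h + - \<tau> * (real (Suc R) * real (Suc R + 1)) = - \<tau> * ((real R + 1)\<^sup>2 - 1/2)"
        "- h + - \<tau> * (real (Suc R) * real (Suc R + 1)) = - \<tau> * ((real (Suc R) + 1)\<^sup>2 - 1/2)"
        by (simp_all add: h_def power2_eq_square field_simps)
      then show ?thesis by (simp only: e_def left_diff_distrib exp_add[symmetric])
    qed
    finally show ?case using Suc by (simp add: e_def diff_divide_distrib)
  qed (simp add: power2_eq_square)
  also have "\<dots> \<le> 1 / \<tau>"
  proof (rule divide_right_mono)
    have "exp (- \<tau> / 2) \<le> 1" using \<tau> by simp
    moreover have "0 < exp (- \<tau> * ((real R + 1)\<^sup>2 - 1/2))" by simp
    ultimately show "exp (- \<tau> / 2) - exp (- \<tau> * ((real R + 1)\<^sup>2 - 1/2)) \<le> 1" by linarith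
  qed (use \<tau> in simp)
  finally show ?thesis .
qed

text \<open>The exponentials of linear forms span an algebra that separates points, and each of them depends on
  \<open>x \<bullet> y\<close> only, for one \<open>x\<close>.  This reduces density on the sphere to approximation of functions of one
  variable.\<close>

inductive exp_sum :: "(real^3 \<Rightarrow> real) \<Rightarrow> bool" where
  es_exp: "exp_sum (\<lambda>y. exp (w \<bullet> y))"
| es_scale: "exp_sum f \<Longrightarrow> exp_sum (\<lambda>y. c * f y)"
| es_add: "exp_sum f \<Longrightarrow> exp_sum g \<Longrightarrow> exp_sum (\<lambda>y. f y + g y)"

lemma exp_sum_const: "exp_sum (\<lambda>y. c)"
  using es_scale[OF es_exp[of 0], of c] by simp

lemma exp_sum_continuous: "exp_sum f \<Longrightarrow> continuous_on S f"
  by (induction rule: exp_sum.induct) (auto intro!: continuous_intros)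

lemma exp_sum_mult:
  assumes "exp_sum f" and g: "exp_sum g"
  shows "exp_sum (\<lambda>y. f y * g y)"
  using assms(1)
proof induction
  case (es_exp w)
  show ?case using g
  proof induction
    case (es_exp v)
    show ?case using exp_sum.es_exp[of "w + v"] by (simp only: inner_add_left exp_add)
  next
    case (es_scale g c)
    from exp_sum.es_scale[OF es_scale.IH, of c] show ?case by (simp add: mult.left_commute)
  next
    case (es_add g h)
    from exp_sum.es_add[OF es_add.IH] show ?case by (simp add: distrib_left)
  qed
next
  case (es_scale f c)
  from exp_sum.es_scale[OF es_scale.IH, of c] show ?case by (simp add: mult.assoc)
next
  case (es_add f h)
  from exp_sum.es_add[OF es_add.IH] show ?case by (simp add: distrib_right)
qed

lemma exp_sum_dense:
  assumes f: "continuous_on sph f" and e: "0 < e"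
  shows "\<exists>p. exp_sum p \<and> (\<forall>y\<in>sph. \<bar>f y - p y\<bar> < e)"
proof -
  have "\<exists>g. exp_sum g \<and> (\<forall>y\<in>sph. \<bar>f y - g y\<bar> < e)"
  proof (rule Stone_Weierstrass_HOL[where P = exp_sum])
    fix x y :: "real^3" assume "x \<in> sph \<and> y \<in> sph \<and> x \<noteq> y"
    then have "(x - y) \<bullet> (x - y) \<noteq> 0" by simp
    then have "(x - y) \<bullet> x \<noteq> (x - y) \<bullet> y" by (simp add: inner_diff_right)
    then show "\<exists>g. exp_sum g \<and> g x \<noteq> g y"
      using es_exp[of "x - y"] by (intro exI[of _ "\<lambda>z. exp ((x - y) \<bullet> z)"]) simp
  qed (use f e in \<open>auto intro: exp_sum_const exp_sum_continuous es_add exp_sum_mult\<close>)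
  then show ?thesis .
qed

subsection \<open>The spectral decomposition of the sphere\<close>

lemma legendre_span_kernel_span:
  assumes "legendre_span f" and x: "x \<in> sph"
  shows "kernel_span sphere_kernel (\<lambda>R. {1..R}) sph (\<lambda>y. f (x \<bullet> y))"
  using assms(1)
proof induction
  case (ls_leg n)
  show ?case
  proof (cases "n = 0")
    case True
    then show ?thesis by (simp add: kernel_span.const)
  next
    case False
    then have "kernel_span sphere_kernel (\<lambda>R. {1..R}) sph (\<lambda>y. 4 * pi / (2 * real n + 1) * sphere_kernel n x y)"
      by (intro kernel_span.scale kernel_span.kernel[where R = n] x) simp
    moreover have "4 * pi / (2 * real n + 1) * sphere_kernel n x y = leg n (x \<bullet> y)" for y
      by (simp add: sphere_kernel_def add_pos_nonneg divide_simps del: legendre.simps)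
    ultimately show ?thesis by (simp only:)
  qed
qed (auto intro: kernel_span.scale kernel_span.add)

text \<open>For a single exponential of \<open>w \<bullet> y = |w| (x \<bullet> y)\<close>, approximate \<open>e\<^sup>|\<^sup>w\<^sup>|\<^sup>t\<close> on \<open>[-1, 1]\<close> by polynomials in \<open>t\<close>,
  which are combinations of Legendre polynomials.\<close>

lemma exp_sum_kernel_span:
  assumes "exp_sum f" and "0 < e"
  shows "\<exists>q. kernel_span sphere_kernel (\<lambda>R. {1..R}) sph q \<and> (\<forall>y\<in>sph. \<bar>f y - q y\<bar> \<le> e)"
  using assms
proof (induction arbitrary: e)
  case (es_exp w)
  show ?case
  proof (cases "w = 0")
    case True
    have "kernel_span sphere_kernel (\<lambda>R. {1..R}) sph (\<lambda>y. 1)" by (rule kernel_span.const)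
    then show ?thesis using True es_exp by (intro exI[of _ "\<lambda>y. 1"]) simp
  next
    case False
    define x where "x = w /\<^sub>R norm w"
    have x: "x \<in> sph" using False by (simp add: x_def)
    have w: "w \<bullet> y = norm w * (x \<bullet> y)" for y using False by (simp add: x_def)
    have "continuous_on {-1..1} (\<lambda>t :: real. exp (norm w * t))" by (intro continuous_intros)
    then obtain g where g: "real_polynomial_function g" "\<And>t. t \<in> {-1..1} \<Longrightarrow> \<bar>exp (norm w * t) - g t\<bar> < e"
      using Stone_Weierstrass_real_polynomial_function[of "{-1..1}" "\<lambda>t. exp (norm w * t)" e] es_exp by auto
    from g(1) obtain a n where "g = (\<lambda>t. \<Sum>i\<le>n. a i * t ^ i)"
      unfolding real_polynomial_function_iff_sum by blast
    then have "legendre_span g"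
      by (auto intro!: legendre_span_sum ls_scale legendre_span_power)
    from legendre_span_kernel_span[OF this x]
    show ?thesis
    proof (intro exI[of _ "\<lambda>y. g (x \<bullet> y)"] conjI ballI)
      fix y assume "y \<in> sph"
      then have "x \<bullet> y \<in> {-1..1}"
        using Cauchy_Schwarz_ineq2[of x y] x by (auto simp: abs_le_iff)
      from g(2)[OF this] show "\<bar>exp (w \<bullet> y) - g (x \<bullet> y)\<bar> \<le> e" unfolding w by simp
    qed
  qed
next
  case (es_scale f c)
  have "0 < e / (\<bar>c\<bar> + 1)" using es_scale.prems by simp
  from es_scale.IH[OF this] obtain q where q: "kernel_span sphere_kernel (\<lambda>R. {1..R}) sph q"
    "\<And>y. y \<in> sph \<Longrightarrow> \<bar>f y - q y\<bar> \<le> e / (\<bar>c\<bar> + 1)" by blast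
  show ?case
  proof (intro exI[of _ "\<lambda>y. c * q y"] conjI ballI kernel_span.scale q(1))
    fix y assume y: "y \<in> sph"
    have "\<bar>c * f y - c * q y\<bar> = \<bar>c\<bar> * \<bar>f y - q y\<bar>" by (simp add: right_diff_distrib[symmetric] abs_mult)
    also have "\<dots> \<le> (\<bar>c\<bar> + 1) * (e / (\<bar>c\<bar> + 1))" using q(2)[OF y] by (intro mult_mono) auto
    also have "\<dots> = e" by (simp add: add_nonneg_pos)
    finally show "\<bar>c * f y - c * q y\<bar> \<le> e" .
  qed
next
  case (es_add f g)
  have "0 < e / 2" using es_add.prems by simp
  from es_add.IH(1)[OF this] es_add.IH(2)[OF this] obtain q r
    where q: "kernel_span sphere_kernel (\<lambda>R. {1..R}) sph q" "\<And>y. y \<in> sph \<Longrightarrow> \<bar>f y - q y\<bar> \<le> e / 2"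
      and r: "kernel_span sphere_kernel (\<lambda>R. {1..R}) sph r" "\<And>y. y \<in> sph \<Longrightarrow> \<bar>g y - r y\<bar> \<le> e / 2"
    by blast
  show ?case
  proof (intro exI[of _ "\<lambda>y. q y + r y"] conjI ballI kernel_span.add q(1) r(1))
    fix y assume y: "y \<in> sph"
    show "\<bar>f y + g y - (q y + r y)\<bar> \<le> e" using q(2)[OF y] r(2)[OF y] by linarith
  qed
qed

lemma sphere_spectral_surface:
  "spectral_surface S2 sphere_kernel
    (\<lambda>n. ridge_grad (smult ((2 * real n + 1) / (4 * pi)) (legendre n)))
    (\<lambda>n. real n * real (n + 1)) (\<lambda>R. {1..R}) (21/20)"
proof (rule spectral_surface.intro)
  have sp: "space (vol S2) = sph" by (simp add: vol_S2)
  have id: "(\<lambda>x. x) \<in> vol S2 \<rightarrow>\<^sub>M borel" unfolding vol_S2 by (rule sphere_borel) (rule continuous_on_id)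
  have pb: "poly p \<in> borel_measurable borel" for p :: "real poly"
    by (intro borel_measurable_continuous_onI continuous_intros)
  have f1: "fst \<in> vol S2 \<Otimes>\<^sub>M vol S2 \<rightarrow>\<^sub>M borel" and f2: "snd \<in> vol S2 \<Otimes>\<^sub>M vol S2 \<rightarrow>\<^sub>M borel"
    by (rule measurable_compose[OF measurable_fst id] measurable_compose[OF measurable_snd id])+
  have ib: "(\<lambda>p. fst p \<bullet> snd p) \<in> borel_measurable (vol S2 \<Otimes>\<^sub>M vol S2)"
    by (rule borel_measurable_inner[OF f1 f2])
  have pi: "(\<lambda>q. poly p (fst q \<bullet> snd q)) \<in> borel_measurable (vol S2 \<Otimes>\<^sub>M vol S2)" for p
    by (rule measurable_compose[OF ib pb])
  have inner_le: "x \<bullet> y \<in> {-1..1}" if "x \<in> sph" "y \<in> sph" for x y :: "real^3"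
    using Cauchy_Schwarz_ineq2[of x y] that by (auto simp: abs_le_iff)
  have poly_bd: "\<exists>C\<ge>0. \<forall>t\<in>{-1..1}. \<bar>poly p t\<bar> \<le> C" for p :: "real poly"
  proof -
    have "compact (poly p ` {-1..1})" by (intro compact_continuous_image continuous_intros) simp
    then have "bounded (poly p ` {-1..1})" by (rule compact_imp_bounded)
    then obtain C where C: "\<forall>s\<in>poly p ` {-1..1}. norm s \<le> C" unfolding bounded_iff by blast
    then have "\<forall>t\<in>{-1..1}. \<bar>poly p t\<bar> \<le> C" by simp
    moreover from this have "0 \<le> C" using abs_ge_zero[of "poly p 0"] by (auto dest: bspec[of _ _ 0])
    ultimately show ?thesis by blast
  qed
  show "finite_measure (vol S2)" unfolding vol_S2 by (rule sphere_finite_measure)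
  show "\<phi> \<in> borel_measurable (vol S2) \<and> G \<in> borel_measurable (vol S2)"
    if "smooth_grad S2 \<phi> G" for \<phi> G
    using C1_sphereD(1,2)[OF smooth_C1_sphere[OF that]] unfolding vol_S2 by (simp add: sphere_borel)
  show "\<exists>C. \<forall>x\<in>space (vol S2). \<bar>\<phi> x\<bar> \<le> C \<and> norm (G x) \<le> C" if sm: "smooth_grad S2 \<phi> G" for \<phi> G
  proof -
    obtain C where C: "\<forall>x\<in>sph. norm (\<phi> x) \<le> C"
      using sphere_bounded[OF C1_sphereD(1)[OF smooth_C1_sphere[OF sm]]] by blast
    obtain C' where C': "\<forall>x\<in>sph. norm (G x) \<le> C'"
      using sphere_bounded[OF C1_sphereD(2)[OF smooth_C1_sphere[OF sm]]] by blast
    show ?thesis unfolding sp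
    proof (intro exI[of _ "max C C'"] ballI conjI)
      fix x assume x: "x \<in> sph"
      show "\<bar>\<phi> x\<bar> \<le> max C C'" using bspec[OF C x] by simp
      show "norm (G x) \<le> max C C'" using bspec[OF C' x] by simp
    qed
  qed
  show "finite {1..R}" for R :: nat by simp
  show "mono (\<lambda>R :: nat. {1..R})" by (auto simp: mono_def)
  show "0 < real n * real (n + 1)" if "n \<in> {1..R}" for n R using that by simp
  show "case_prod (sphere_kernel n) \<in> borel_measurable (vol S2 \<Otimes>\<^sub>M vol S2)" for n
    unfolding sphere_kernel_def [abs_def] case_prod_beta' by (rule pi)
  show "case_prod (ridge_grad p) \<in> borel_measurable (vol S2 \<Otimes>\<^sub>M vol S2)" for p
    unfolding ridge_grad_def [abs_def] case_prod_beta'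
    by (intro borel_measurable_scaleR borel_measurable_diff pi ib f1 f2)
  show "\<exists>C. \<forall>x\<in>space (vol S2). \<forall>y\<in>space (vol S2). \<bar>sphere_kernel n x y\<bar> \<le> C \<and>
      norm (ridge_grad (smult ((2 * real n + 1) / (4 * pi)) (legendre n)) x y) \<le> C" for n
  proof -
    let ?p = "smult ((2 * real n + 1) / (4 * pi)) (legendre n)"
    obtain C where C: "0 \<le> C" "\<And>t. t \<in> {-1..1} \<Longrightarrow> \<bar>poly ?p t\<bar> \<le> C" using poly_bd[of ?p] by blast
    obtain C' where C': "0 \<le> C'" "\<And>t. t \<in> {-1..1} \<Longrightarrow> \<bar>poly (pderiv ?p) t\<bar> \<le> C'" using poly_bd[of "pderiv ?p"] by blast
    show ?thesis unfolding sp
    proof (intro exI[of _ "C + C' * 2"] ballI conjI)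
      fix x y assume x: "x \<in> sph" and y: "y \<in> sph"
      show "\<bar>sphere_kernel n x y\<bar> \<le> C + C' * 2"
        unfolding sphere_kernel_def using C(2)[OF inner_le[OF x y]] C'(1) by linarith
      have "norm (x - (x \<bullet> y) *\<^sub>R y) \<le> norm x + norm ((x \<bullet> y) *\<^sub>R y)" by (rule norm_triangle_ineq4)
      also have "\<dots> \<le> 2" using x y inner_le[OF x y] by (simp add: abs_le_iff)
      finally have "norm (ridge_grad ?p x y) \<le> C' * 2"
        unfolding ridge_grad_def norm_scaleR using C'(2)[OF inner_le[OF x y]] C'(1)
        by (intro mult_mono) auto
      then show "norm (ridge_grad ?p x y) \<le> C + C' * 2" using C(1) by linarith
    qed
  qed
  show "sphere_kernel n x y = sphere_kernel n y x" for n x y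
    unfolding sphere_kernel_def by (simp only: inner_commute[of x y])
  show "(\<integral>y. sphere_kernel i x y * sphere_kernel j y z \<partial>vol S2) = (if i = j then sphere_kernel i x z else 0)"
    if "x \<in> space (vol S2)" "z \<in> space (vol S2)" for i j x z
    using that unfolding vol_S2 sphere_space by (rule sphere_reproducing)
  show "smooth_grad S2 (sphere_kernel n x) (ridge_grad (smult ((2 * real n + 1) / (4 * pi)) (legendre n)) x)" for n x
    unfolding sphere_kernel_def [abs_def] by (rule ridge_smooth)
  show "(\<integral>y. G y \<bullet> ridge_grad (smult ((2 * real n + 1) / (4 * pi)) (legendre n)) x y \<partial>vol S2)
      = real n * real (n + 1) * (\<integral>y. \<phi> y * sphere_kernel n x y \<partial>vol S2)"
    if "smooth_grad S2 \<phi> G" "x \<in> space (vol S2)" for \<phi> G n x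
    using that unfolding vol_S2 sphere_space sphere_kernel_def by (rule sphere_green)
  show "\<exists>q. kernel_span sphere_kernel (\<lambda>R. {1..R}) (space (vol S2)) q \<and>
      (\<forall>y\<in>space (vol S2). \<bar>\<phi> y - q y\<bar> \<le> \<epsilon>)"
    if sm: "smooth_grad S2 \<phi> G" and e: "0 < \<epsilon>" for \<phi> G \<epsilon>
  proof -
    have e2: "0 < \<epsilon> / 2" using e by simp
    obtain p where p: "exp_sum p" "\<And>y. y \<in> sph \<Longrightarrow> \<bar>\<phi> y - p y\<bar> < \<epsilon> / 2"
      using exp_sum_dense[OF C1_sphereD(1)[OF smooth_C1_sphere[OF sm]] e2] by blast
    obtain q where q: "kernel_span sphere_kernel (\<lambda>R. {1..R}) sph q" "\<And>y. y \<in> sph \<Longrightarrow> \<bar>p y - q y\<bar> \<le> \<epsilon> / 2"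
      using exp_sum_kernel_span[OF p(1) e2] by blast
    show ?thesis unfolding sp
    proof (intro exI[of _ q] conjI ballI q(1))
      fix y assume y: "y \<in> sph"
      show "\<bar>\<phi> y - q y\<bar> \<le> \<epsilon>" using p(2)[OF y] q(2)[OF y] by linarith
    qed
  qed
  show "(\<Sum>n\<in>{1..R}. exp (- \<tau> * (real n * real (n + 1))) * sphere_kernel n x x) \<le> 21/20 / (4 * pi * \<tau>)"
    if x: "x \<in> space (vol S2)" and \<tau>: "0 < \<tau>" for R x \<tau>
  proof -
    have xx: "x \<bullet> x = 1" using x by (simp add: sp norm_eq_1)
    have "(\<Sum>n\<in>{1..R}. exp (- \<tau> * (real n * real (n + 1))) * sphere_kernel n x x)
        = (\<Sum>n=1..R. (2 * real n + 1) * exp (- \<tau> * (real n * real (n + 1)))) / (4 * pi)"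
      unfolding sphere_kernel_def xx poly_smult leg_at_1 sum_divide_distrib
      by (intro sum.cong refl) simp
    also have "\<dots> \<le> (1 / \<tau>) / (4 * pi)"
      by (intro divide_right_mono sphere_heat_sum \<tau>) simp
    also have "\<dots> \<le> 21/20 / (4 * pi * \<tau>)"
      using \<tau> by (simp add: field_simps)
    finally show ?thesis .
  qed
  show "smooth_grad S2 (\<lambda>_. 1) (\<lambda>_. 0)"
  proof -
    have "ridge_grad 1 0 = (\<lambda>_. 0)" by (auto simp: ridge_grad_def)
    then show ?thesis using ridge_smooth[of 1 0] by simp
  qed
qed simp

section \<open>The Lieb--Thirring constant\<close>

text \<open>The claim is \<open>\<pi>\<^sup>2 \<ge> 9.8\<close>, while \<open>\<pi>\<^sup>2 = 9.8696\<dots>\<close>.\<close>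

lemma lieb_thirring_constant: "7 * (21/20) / (8 * pi) \<le> 3 * pi / (32 :: real)"
proof -
  have "(314/100)\<^sup>2 \<le> pi\<^sup>2" using pi_approx by (intro power_mono) auto
  then have "98/10 \<le> pi * pi" by (simp add: power2_eq_square)
  then show ?thesis using pi_gt_zero by (simp add: field_simps)
qed

lemma spectral_surface_bound:
  assumes "spectral_surface M Z D lam F (21/20)"
  shows "\<exists>k::real. k \<le> 3 * pi / 32 \<and>
      (\<forall>N\<ge>1. \<forall>\<psi> :: nat \<Rightarrow> 'a::euclidean_space \<Rightarrow> real.
         (\<forall>j\<in>{1..N}. \<psi> j \<in> H1_dot M) \<and> L2_orthonormal (vol M) {1..N} \<psi> \<longrightarrow>
         (let \<rho> = (\<lambda>x. \<Sum>j=1..N. \<bar>\<psi> j x\<bar>\<^sup>2) in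
            integrable (vol M) (\<lambda>x. (\<rho> x)\<^sup>2) \<and>
            (\<integral>x. (\<rho> x)\<^sup>2 \<partial>vol M)
              \<le> k * (\<Sum>j=1..N. (L2_norm (vol M) (H1_grad M (\<psi> j)))\<^sup>2)))"
proof (intro exI[of _ "7 * (21/20) / (8 * pi)"] conjI allI impI lieb_thirring_constant)
  fix N :: nat and \<psi> :: "nat \<Rightarrow> 'a \<Rightarrow> real"
  assume "(\<forall>j\<in>{1..N}. \<psi> j \<in> H1_dot M) \<and> L2_orthonormal (vol M) {1..N} \<psi>"
  then have H: "\<And>j. j \<in> {1..N} \<Longrightarrow> \<psi> j \<in> H1_dot M" and on: "L2_orthonormal (vol M) {1..N} \<psi>"
    by blast+
  from spectral_surface.lieb_thirring[OF assms on finite_atLeastAtMost H]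
  show "let \<rho> = (\<lambda>x. \<Sum>j=1..N. \<bar>\<psi> j x\<bar>\<^sup>2) in
      integrable (vol M) (\<lambda>x. (\<rho> x)\<^sup>2) \<and>
      (\<integral>x. (\<rho> x)\<^sup>2 \<partial>vol M)
        \<le> 7 * (21/20) / (8 * pi) * (\<Sum>j=1..N. (L2_norm (vol M) (H1_grad M (\<psi> j)))\<^sup>2)"
    unfolding Let_def power2_abs by (intro conjI)
qed

theorem theorem1p1:
  shows "(\<exists>k::real. k \<le> 3 * pi / 32 \<and>
      (\<forall>N\<ge>1. \<forall>\<psi> :: nat \<Rightarrow> real^3 \<Rightarrow> real.
         (\<forall>j\<in>{1..N}. \<psi> j \<in> H1_dot S2) \<and> L2_orthonormal (vol S2) {1..N} \<psi> \<longrightarrow>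
         (let \<rho> = (\<lambda>x. \<Sum>j=1..N. \<bar>\<psi> j x\<bar>\<^sup>2) in
            integrable (vol S2) (\<lambda>x. (\<rho> x)\<^sup>2) \<and>
            (\<integral>x. (\<rho> x)\<^sup>2 \<partial>vol S2)
              \<le> k * (\<Sum>j=1..N. (L2_norm (vol S2) (H1_grad S2 (\<psi> j)))\<^sup>2))))
    \<and> (\<forall>L>0. \<exists>k::real. k \<le> 3 * pi / 32 \<and>
      (\<forall>N\<ge>1. \<forall>\<psi> :: nat \<Rightarrow> real^2 \<Rightarrow> real.
         (\<forall>j\<in>{1..N}. \<psi> j \<in> H1_dot (T2 L)) \<and> L2_orthonormal (vol (T2 L)) {1..N} \<psi> \<longrightarrow>
         (let \<rho> = (\<lambda>x. \<Sum>j=1..N. \<bar>\<psi> j x\<bar>\<^sup>2) in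
            integrable (vol (T2 L)) (\<lambda>x. (\<rho> x)\<^sup>2) \<and>
            (\<integral>x. (\<rho> x)\<^sup>2 \<partial>vol (T2 L))
              \<le> k * (\<Sum>j=1..N. (L2_norm (vol (T2 L)) (H1_grad (T2 L) (\<psi> j)))\<^sup>2))))"
  by (intro conjI allI impI spectral_surface_bound[OF sphere_spectral_surface]
      spectral_surface_bound[OF torus_spectral_surface])

end
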